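(* Let $k \geq 1$ be an integer and let $1 < p_1,\dots,p_k,p < \infty$ satisfy $\frac{1}{p} = \frac{1}{p_1} + \dots + \frac{1}{p_k}$. For every $\varepsilon > 0$ there exists $K = K(\varepsilon,k,p_1,\dots,p_k,p)$ such that whenever $R \geq r \geq 1$ are real numbers with $R/r \geq K$, one has $$ \Big\| \sum_{t \in \mathbb{Z}: r \leq |t| \leq R} \frac{f_1(x+t) f_2(x+2t) \cdots f_k(x+kt)}{t} \Big\|_{\ell^p(\mathbb{Z})} \leq \varepsilon \log\frac{R}{r} \prod_{i=1}^k \|f_i\|_{\ell^{p_i}(\mathbb{Z})}$$ for all $f_i \in \ell^{p_i}(\mathbb{Z})$, $i=1,\dots,k$, where the $\ell^p(\mathbb{Z})$ norm on the left is taken in the variable $x \in \mathbb{Z}$. *)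

theory Defs
  imports "HOL-Analysis.Analysis"
begin

definition in_lp :: "real \<Rightarrow> (int \<Rightarrow> complex) \<Rightarrow> bool" where
  "in_lp p f \<longleftrightarrow> (\<lambda>x. norm (f x) powr p) summable_on UNIV"

definition lp_norm :: "real \<Rightarrow> (int \<Rightarrow> complex) \<Rightarrow> real" where
  "lp_norm p f = (\<Sum>\<^sub>\<infinity>x. norm (f x) powr p) powr (1 / p)"

end

theory Submission
  imports Defs
begin

text \<open>
  By duality and a decomposition into level sets it suffices to bound the dual form, for functions bounded by \<open>1\<close>,
  by a small multiple of \<open>log (R / r)\<close> times the sizes of the supports, and one may work on a long cycle.  Write
  \<open>B\<^sub>m(x, t) = \<Prod>i=m..k. f\<^sub>i(x + i t)\<close> and let \<open>e\<^sub>j = (-j, 1)\<close>, the direction along which \<open>f\<^sub>j(x + j t)\<close> is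
  constant.  The claim is that for most \<open>n\<close> the averages of \<open>B\<^sub>0\<close> over \<open>t\<close> in windows of length \<open>2\<^sup>n\<close> and \<open>2\<^sup>n\<^sup>+\<^sup>1\<close>
  are close.  Cauchy-Schwarz removes the function \<open>f\<^sub>m\<close> at the cost of doubling the remaining ones in the
  direction \<open>e\<^sub>m\<close>, and leads to box-norm type forms of \<open>B\<^sub>m\<^sub>+\<^sub>1\<close> over the directions \<open>e\<^sub>0, \<dots>, e\<^sub>m\<close>.  These
  energies, with Fejer weights in every direction, are bounded, and up to small errors they decrease when the scale
  of one of the directions is doubled; the decrement is the square function that Cauchy-Schwarz produces.  Hence
  the square functions sum up over the scales to a bounded quantity, except for the effect of changing the window
  in \<open>t\<close>, and this effect is the same problem with one function less.
\<close>

section \<open>Averages over windows\<close>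

text \<open>The energies telescope only if all their scales double together: the scale of the
  current direction, those of the earlier directions and the window in \<open>t\<close>. Positivity
  makes the doubling of a direction cost no more than an edge error. Nothing of this kind controls
  the window in \<open>t\<close>, and this obstacle forces the induction on the number of functions.
  It ends when a single function is left: its sum over the cycle does not depend on
  \<open>t\<close>. The passage to \<open>1 / t\<close> uses that the kernel is odd. After Abel
  summation it is enough that the averages over \<open>1..N\<close> and over \<open>-N..-1\<close>
  nearly agree, and both are compared with one much longer average. For general exponents, tuples of
  values at nearby levels behave like bounded functions. For tuples at distant levels no
  cancellation is available; there a small shift of the exponents in the arithmetic-geometric
  inequality gains a negative power of the ratio of consecutive levels, which beats the divergence
  of the sum of \<open>1 / |t|\<close>.\<close>

definition avg :: "nat \<Rightarrow> (int \<Rightarrow> real) \<Rightarrow> int \<Rightarrow> real" where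
  "avg M C s = (\<Sum>t<M. C (s + int t)) / real M"

lemma avg_bound:
  assumes "\<And>s. \<bar>C s\<bar> \<le> c" "c \<ge> 0"
  shows "\<bar>avg M C s\<bar> \<le> c"
proof (cases "M = 0")
  case False
  have "\<bar>\<Sum>t<M. C (s + int t)\<bar> \<le> (\<Sum>t<M. c)"
    by (rule order_trans[OF sum_abs]) (intro sum_mono assms)
  then show ?thesis using False by (simp add: avg_def field_simps)
qed (use assms in \<open>simp add: avg_def\<close>)

lemma avg_nonneg: "(\<And>s. C s \<ge> 0) \<Longrightarrow> avg M C s \<ge> 0"
  by (simp add: avg_def sum_nonneg)

lemma avg_add: "avg M (\<lambda>s. C s + C' s) s = avg M C s + avg M C' s"
  by (simp add: avg_def sum.distrib add_divide_distrib)

lemma avg_diff: "avg M (\<lambda>s. C s - C' s) s = avg M C s - avg M C' s"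
  by (simp add: avg_def sum_subtractf diff_divide_distrib)

lemma avg_cmult: "avg M (\<lambda>s. c * C s) s = c * avg M C s"
  by (simp add: avg_def sum_distrib_left)

lemma avg_divide: "avg M (\<lambda>s. C s / c) s = avg M C s / c"
  by (simp add: avg_def sum_divide_distrib field_simps)

lemma avg_sum: "avg M (\<lambda>s. \<Sum>i\<in>I. C i s) s = (\<Sum>i\<in>I. avg M (C i) s)"
  unfolding avg_def by (subst sum.swap) (simp add: sum_divide_distrib)

lemma avg_translate: "avg M (\<lambda>s. C (s + c)) s = avg M C (s + c)"
  by (simp add: avg_def algebra_simps)

lemma avg_double: "avg (2 * M) C s = (avg M C s + avg M C (s + int M)) / 2"
proof -
  have "(\<Sum>t<2*M. C (s + int t)) = (\<Sum>t<M. C (s + int t)) + (\<Sum>t=M..<M+M. C (s + int t))"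
    using sum.atLeastLessThan_concat[of 0 M "M+M" "\<lambda>t. C (s + int t)"]
    by (simp add: atLeast0LessThan mult_2)
  also have "(\<Sum>t=M..<M+M. C (s + int t)) = (\<Sum>t<M. C (s + int M + int t))"
    using sum.shift_bounds_nat_ivl[of "\<lambda>t. C (s + int t)" 0 M M]
    by (simp add: atLeast0LessThan algebra_simps)
  finally show ?thesis by (simp add: avg_def add_divide_distrib)
qed

text \<open>A unit shift exchanges only the two end terms. All later edge errors, of the size of a
  shift divided by a window length, come from here.\<close>

lemma avg_shift_one:
  assumes "\<And>s. \<bar>C s\<bar> \<le> 1"
  shows "\<bar>avg M C (s + 1) - avg M C s\<bar> \<le> 2 / real M"
proof -
  have "(\<Sum>t<M. C (s + 1 + int t)) - (\<Sum>t<M. C (s + int t))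
      = (\<Sum>t<M. C (s + int (Suc t)) - C (s + int t))"
    by (simp add: sum_subtractf algebra_simps)
  also have "\<dots> = C (s + int M) - C s"
    using sum_lessThan_telescope[of "\<lambda>t. C (s + int t)" M] by simp
  finally have "avg M C (s + 1) - avg M C s = (C (s + int M) - C s) / M"
    by (simp add: avg_def diff_divide_distrib[symmetric])
  moreover have "\<bar>C (s + int M) - C s\<bar> \<le> 2"
    using assms[of "s + int M"] assms[of s] by linarith
  ultimately show ?thesis by (simp add: divide_right_mono)
qed

lemma avg_shift_nat:
  assumes "\<And>s. \<bar>C s\<bar> \<le> 1"
  shows "\<bar>avg M C (s + int u) - avg M C s\<bar> \<le> 2 * real u / real M"
proof (induction u)
  case (Suc u)
  have "\<bar>avg M C (s + int u + 1) - avg M C (s + int u)\<bar> \<le> 2 / real M"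
    by (rule avg_shift_one[OF assms])
  then have "\<bar>avg M C (s + int (Suc u)) - avg M C s\<bar> \<le> 2 / real M + 2 * real u / real M"
    using Suc by (simp add: algebra_simps)
  then show ?case by (simp add: add_divide_distrib algebra_simps)
qed simp

lemma avg_shift:
  assumes "\<And>s. \<bar>C s\<bar> \<le> 1"
  shows "\<bar>avg M C s - avg M C s'\<bar> \<le> 2 * \<bar>real_of_int (s - s')\<bar> / real M"
proof (cases "s' \<le> s")
  case True
  then show ?thesis using avg_shift_nat[where M = M and s = s' and u = "nat (s - s')", OF assms] by simp
next
  case False
  then show ?thesis using avg_shift_nat[where M = M and s = s and u = "nat (s' - s)", OF assms]
    by (simp add: abs_minus_commute)
qed

lemma avg_comm: "avg M (\<lambda>s. avg N C s) s = avg N (\<lambda>s. avg M C s) s"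
proof -
  have "(\<Sum>t<M. \<Sum>u<N. C (s + int t + int u)) = (\<Sum>u<N. \<Sum>t<M. C (s + int u + int t))"
    by (subst sum.swap) (simp add: add_ac)
  then show ?thesis by (simp add: avg_def sum_divide_distrib[symmetric] mult.commute)
qed

definition haar :: "nat \<Rightarrow> nat \<Rightarrow> real" where
  "haar M t = (if t < M then 1 else -1) / (2 * real M)"

lemma avg_minus_avg_double:
  assumes "M > 0"
  shows "avg M C s - avg (2 * M) C s = (\<Sum>t<2*M. haar M t * C (s + int t))"
proof -
  have "(\<Sum>t<2*M. haar M t * C (s + int t))
     = (\<Sum>t<M. haar M t * C (s + int t)) + (\<Sum>t=M..<M+M. haar M t * C (s + int t))"
    using sum.atLeastLessThan_concat[of 0 M "M+M" "\<lambda>t. haar M t * C (s + int t)"]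
    by (simp add: atLeast0LessThan mult_2)
  also have "(\<Sum>t=M..<M+M. haar M t * C (s + int t)) = (\<Sum>t<M. haar M (t+M) * C (s + int M + int t))"
    using sum.shift_bounds_nat_ivl[of "\<lambda>t. haar M t * C (s + int t)" 0 M M]
    by (simp add: atLeast0LessThan algebra_simps)
  also have "(\<Sum>t<M. haar M t * C (s + int t)) = avg M C s / 2"
    by (simp add: haar_def avg_def sum_divide_distrib mult.commute)
  also have "(\<Sum>t<M. haar M (t+M) * C (s + int M + int t)) = - avg M C (s + int M) / 2"
    by (simp add: haar_def avg_def sum_divide_distrib sum_negf mult.commute)
  finally show ?thesis unfolding avg_double by argo
qed

lemma abs_haar: "\<bar>haar M t\<bar> = 1 / (2 * real M)"
  by (simp add: haar_def)

section \<open>Energies of functions on a cycle\<close>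

locale periodic_mean =
  fixes P :: int and S :: real
  assumes P_pos: "P > 0" and S_pos: "S > 0"
begin

text \<open>The divisor is \<open>S\<close>, not the period. \<open>S\<close> will bound the l1
  norms of the functions, so that means of absolute values stay below 1 however long the cycle and
  however sparse the supports are.\<close>

definition mean :: "(int \<Rightarrow> real) \<Rightarrow> real" where
  "mean g = (\<Sum>x\<in>{0..<P}. g x) / S"

definition periodic :: "(int \<Rightarrow> 'a) \<Rightarrow> bool" where
  "periodic g \<longleftrightarrow> (\<forall>x. g (x + P) = g x)"

lemma periodic_mult_int:
  assumes "periodic g"
  shows "g (x + P * c) = g x"
proof -
  have nat: "g (x + P * int n) = g x" for x n
  proof (induction n)
    case (Suc n)
    have "g (x + P * int (Suc n)) = g ((x + P * int n) + P)" by (simp add: algebra_simps)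
    also have "\<dots> = g x" using assms Suc by (simp add: periodic_def)
    finally show ?case .
  qed simp
  show ?thesis
  proof (cases "c \<ge> 0")
    case True
    then show ?thesis using nat[of x "nat c"] by simp
  next
    case False
    then show ?thesis using nat[of "x + P * c" "nat (- c)"] by simp
  qed
qed

lemma periodic_mod: "periodic g \<Longrightarrow> g (x mod P) = g x"
  using periodic_mult_int[of g "x mod P" "x div P"] by simp

lemma sum_periodic_shift:
  assumes "periodic g"
  shows "(\<Sum>x\<in>{0..<P}. g (x + c)) = (\<Sum>x\<in>{0..<P}. g x :: real)"
proof (rule sum.reindex_bij_witness[where i = "\<lambda>x. (x - c) mod P" and j = "\<lambda>x. (x + c) mod P"])
  fix x assume "x \<in> {0..<P}"
  then show "((x + c) mod P - c) mod P = x" "((x - c) mod P + c) mod P = x"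
    by (simp_all add: mod_simps)
  show "(x + c) mod P \<in> {0..<P}" "(x - c) mod P \<in> {0..<P}"
    using P_pos by simp_all
  show "g ((x + c) mod P) = g (x + c)" by (rule periodic_mod[OF assms])
qed

lemma mean_shift: "periodic g \<Longrightarrow> mean (\<lambda>x. g (x + c)) = mean g"
  by (simp add: mean_def sum_periodic_shift)

lemma mean_mono: "(\<And>x. g x \<le> g' x) \<Longrightarrow> mean g \<le> mean g'"
  using S_pos by (auto simp: mean_def intro!: divide_right_mono sum_mono)

lemma mean_nonneg: "(\<And>x. 0 \<le> g x) \<Longrightarrow> 0 \<le> mean g"
  using S_pos by (auto simp: mean_def intro!: divide_nonneg_pos sum_nonneg)

lemma mean_abs: "\<bar>mean g\<bar> \<le> mean (\<lambda>x. \<bar>g x\<bar>)"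
  using S_pos by (auto simp: mean_def intro!: divide_right_mono sum_abs)

lemma mean_add: "mean (\<lambda>x. g x + g' x) = mean g + mean g'"
  by (simp add: mean_def sum.distrib add_divide_distrib)

lemma mean_diff: "mean (\<lambda>x. g x - g' x) = mean g - mean g'"
  by (simp add: mean_def sum_subtractf diff_divide_distrib)

lemma mean_cmult: "mean (\<lambda>x. c * g x) = c * mean g"
  by (simp add: mean_def sum_distrib_left)

lemma mean_divide: "mean (\<lambda>x. g x / c) = mean g / c"
  by (simp add: mean_def sum_divide_distrib field_simps)

lemma mean_sum: "mean (\<lambda>x. \<Sum>i\<in>I. g i x) = (\<Sum>i\<in>I. mean (g i))"
  unfolding mean_def by (subst sum.swap) (simp add: sum_divide_distrib)

lemma mean_avg: "mean (\<lambda>y. avg M (\<lambda>t. g y t) s) = avg M (\<lambda>t. mean (\<lambda>y. g y t)) s"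
  by (simp add: avg_def mean_sum mean_divide)

text \<open>In a product one factor supplies the bound on the mean and the others only need the sup
  bound; hence the class is stable under all the doublings below.\<close>

definition admissible1 :: "(int \<Rightarrow> real) \<Rightarrow> bool" where
  "admissible1 g \<longleftrightarrow> periodic g \<and> (\<forall>x. \<bar>g x\<bar> \<le> 1) \<and> mean (\<lambda>x. \<bar>g x\<bar>) \<le> 1"

definition admissible :: "(int \<Rightarrow> int \<Rightarrow> real) \<Rightarrow> bool" where
  "admissible b \<longleftrightarrow> (\<forall>t. admissible1 (\<lambda>x. b x t))"

text \<open>\<open>cross j h\<close> doubles a function in the direction \<open>(-j, 1)\<close> by the step \<open>h\<close>, and \<open>along j b y\<close>
  restricts it to a line in that direction.\<close>

definition cross :: "int \<Rightarrow> int \<Rightarrow> (int \<Rightarrow> int \<Rightarrow> real) \<Rightarrow> int \<Rightarrow> int \<Rightarrow> real" where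
  "cross j h b = (\<lambda>x t. b x t * b (x - j * h) (t + h))"

definition slice :: "(int \<Rightarrow> int \<Rightarrow> real) \<Rightarrow> int \<Rightarrow> real" where
  "slice b t = mean (\<lambda>x. b x t)"

definition along :: "int \<Rightarrow> (int \<Rightarrow> int \<Rightarrow> real) \<Rightarrow> int \<Rightarrow> int \<Rightarrow> real" where
  "along j b y t = b (y - j * t) t"

lemma periodic_mult: "periodic g \<Longrightarrow> periodic g' \<Longrightarrow> periodic (\<lambda>x. g x * g' x :: real)"
  by (simp add: periodic_def)

lemma periodic_shift: "periodic g \<Longrightarrow> periodic (\<lambda>x. g (x + c))"
  unfolding periodic_def by (metis add.assoc add.commute)

lemma admissible1_mult:
  assumes "admissible1 g" "periodic g'" "\<And>x. \<bar>g' x\<bar> \<le> 1"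
  shows "admissible1 (\<lambda>x. g x * g' x)"
proof -
  have le: "\<bar>g x * g' x\<bar> \<le> \<bar>g x\<bar>" for x
    using assms(3)[of x] by (simp add: abs_mult mult_left_le)
  have "mean (\<lambda>x. \<bar>g x * g' x\<bar>) \<le> mean (\<lambda>x. \<bar>g x\<bar>)" by (rule mean_mono[OF le])
  moreover have "\<bar>g x * g' x\<bar> \<le> 1" for x using le[of x] assms(1) by (force simp: admissible1_def intro: order_trans)
  ultimately show ?thesis using assms by (auto simp: admissible1_def periodic_mult)
qed

lemma admissible1_shift:
  assumes "admissible1 g" shows "admissible1 (\<lambda>x. g (x + c))"
proof -
  have "periodic (\<lambda>x. \<bar>g x\<bar>)" using assms by (auto simp: admissible1_def periodic_def)
  from mean_shift[OF this, of c] show ?thesis using assms by (auto simp: admissible1_def periodic_shift)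
qed

lemma admissible_cross: "admissible b \<Longrightarrow> admissible (cross j h b)"
  using admissible1_shift[of "\<lambda>x. b x (t + h)" "- j * h" for t]
  unfolding admissible_def cross_def by (intro allI admissible1_mult) (auto simp: admissible1_def)

lemma abs_slice_le:
  assumes "admissible b" shows "\<bar>slice b t\<bar> \<le> 1"
  using order_trans[OF mean_abs[of "\<lambda>x. b x t"]] assms by (simp add: admissible_def admissible1_def slice_def)

lemma cross_commute: "cross i h (cross j h' b) = cross j h' (cross i h b)"
  by (simp add: cross_def fun_eq_iff algebra_simps)

lemma slice_along: "admissible b \<Longrightarrow> slice b t = mean (\<lambda>y. along j b y t)"
  using mean_shift[of "\<lambda>x. b x t" "- j * t"] by (simp add: admissible_def admissible1_def along_def slice_def)

text \<open>On a line in direction \<open>j\<close> the doubled function is a product of two values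
  of one function. Slices of \<open>cross\<close> are therefore the correlations that appear when
  the square of a window average along lines is expanded.\<close>

lemma slice_cross_along:
  assumes "admissible b"
  shows "slice (cross j (t' - t) b) (s + t) = mean (\<lambda>y. along j b y (s + t) * along j b y (s + t'))"
proof -
  have *: "along j (cross j (t' - t) b) y (s + t) = along j b y (s + t) * along j b y (s + t')" for y
    by (simp add: along_def cross_def algebra_simps)
  show ?thesis using slice_along[OF admissible_cross[OF assms], of j "t' - t" "s + t" j] unfolding * .
qed

section \<open>Squares of averages along lines and their loss under doubling\<close>

definition sq_avg :: "int \<Rightarrow> nat \<Rightarrow> (int \<Rightarrow> int \<Rightarrow> real) \<Rightarrow> int \<Rightarrow> real" where
  "sq_avg j M b s = mean (\<lambda>y. (avg M (along j b y) s)\<^sup>2)"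

definition sq_osc :: "int \<Rightarrow> nat \<Rightarrow> (int \<Rightarrow> int \<Rightarrow> real) \<Rightarrow> int \<Rightarrow> real" where
  "sq_osc j M b s = mean (\<lambda>y. (avg M (along j b y) s - avg (2 * M) (along j b y) s)\<^sup>2)"

lemma sq_osc_nonneg: "sq_osc j M b s \<ge> 0"
  by (simp add: sq_osc_def mean_nonneg)

lemma sq_avg_eq:
  assumes "admissible b"
  shows "sq_avg j M b s = (\<Sum>t<M. \<Sum>t'<M. slice (cross j (int t' - int t) b) (s + int t)) / (real M)\<^sup>2"
  by (simp add: sq_avg_def avg_def slice_cross_along[OF assms] power_divide mean_divide mean_sum power2_eq_square
      sum_product)

text \<open>The average over the double window is the midpoint of two averages over windows of
  length \<open>M\<close>, so the parallelogram identity applies: the square function is exactly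
  what \<open>sq_avg\<close> loses when its window doubles.\<close>

lemma sq_osc_eq_sq_avg: "sq_osc j M b s = (sq_avg j M b s + sq_avg j M b (s + int M)) / 2 - sq_avg j (2 * M) b s"
proof -
  have "(a - (a + a') / 2)\<^sup>2 = (a\<^sup>2 + a'\<^sup>2) / 2 - ((a + a') / 2)\<^sup>2" for a a' :: real
    by (simp add: power2_eq_square field_simps)
  then show ?thesis unfolding sq_osc_def sq_avg_def avg_double by (simp add: mean_diff mean_add mean_divide)
qed

text \<open>A second expression for the same quantity, linear in the slices of doubled functions.
  This form allows the window in \<open>t\<close> to be changed term by term.\<close>

lemma sq_osc_eq_haar:
  assumes "admissible b" "M > 0"
  shows "sq_osc j M b s = (\<Sum>t<2*M. \<Sum>t'<2*M. haar M t * haar M t' * slice (cross j (int t' - int t) b) (s + int t))"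
  unfolding sq_osc_def avg_minus_avg_double[OF assms(2)] slice_cross_along[OF assms(1)]
  by (simp add: power2_eq_square sum_product mean_sum mean_cmult[symmetric] mult_ac)

lemma sq_avg_nonneg: "sq_avg j M b s \<ge> 0"
  by (simp add: sq_avg_def mean_nonneg)

lemma sq_avg_le_1:
  assumes "admissible b" shows "sq_avg j M b s \<le> 1"
proof (cases "M = 0")
  case False
  have "\<bar>slice (cross j h b) t\<bar> \<le> 1" for h t by (rule abs_slice_le[OF admissible_cross[OF assms]])
  then have "(\<Sum>t<M. \<Sum>t'<M. slice (cross j (int t' - int t) b) (s + int t)) \<le> (\<Sum>t<M. \<Sum>t'<M. 1)"
    by (intro sum_mono) (simp add: abs_le_iff)
  then show ?thesis using False by (simp add: sq_avg_eq[OF assms] power2_eq_square field_simps)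
qed (simp add: sq_avg_def avg_def mean_def)

text \<open>\<open>fejer\<close> is the average over \<open>h\<close> with the Fejer kernel as weight, \<open>flat\<close> dominates it by an
  unweighted sum.  The former is monotone in the scale for positive definite functionals, the latter for
  nonnegative ones.\<close>

definition fejer :: "int \<Rightarrow> nat \<Rightarrow> ((int \<Rightarrow> int \<Rightarrow> real) \<Rightarrow> real) \<Rightarrow> (int \<Rightarrow> int \<Rightarrow> real) \<Rightarrow> real" where
  "fejer j H \<Lambda> b = (\<Sum>t<H. \<Sum>t'<H. \<Lambda> (cross j (int t' - int t) b)) / (real H)\<^sup>2"

definition flat :: "int \<Rightarrow> nat \<Rightarrow> ((int \<Rightarrow> int \<Rightarrow> real) \<Rightarrow> real) \<Rightarrow> (int \<Rightarrow> int \<Rightarrow> real) \<Rightarrow> real" where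
  "flat j H \<Lambda> b = (\<Sum>h\<in>{- int H<..<int H}. \<Lambda> (cross j h b)) / real H"

text \<open>Stands in for a translation invariant mean in \<open>t\<close>: when \<open>T\<close> is
  much longer than the steps, shifts cost little and Fejer averages of this functional are nearly
  means of squares.\<close>

definition long_avg :: "nat \<Rightarrow> (int \<Rightarrow> int \<Rightarrow> real) \<Rightarrow> real" where
  "long_avg T b = avg T (slice b) 0"

definition osc_avg :: "nat \<Rightarrow> nat \<Rightarrow> (int \<Rightarrow> int \<Rightarrow> real) \<Rightarrow> real" where
  "osc_avg M H b = (\<Sum>s\<in>{- int H..<int H}. \<bar>avg M (slice b) s - avg (2 * M) (slice b) s\<bar>) / real H"

lemma osc_avg_nonneg: "osc_avg M H b \<ge> 0"
  by (simp add: osc_avg_def sum_nonneg)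

text \<open>In the expansion of \<open>sq_avg\<close> the correlation with first index
  \<open>t\<close> sits at \<open>s + t\<close>, whereas \<open>fejer\<close> puts all of them at
  the origin. Moving a window of length \<open>T\<close> by \<open>t < M\<close> costs at most
  \<open>2 * M / T\<close>.\<close>

lemma fejer_long_avg_near_sq_avg:
  assumes "admissible b" "M > 0"
  shows "\<bar>fejer j M (long_avg T) b - avg T (sq_avg j M b) 0\<bar> \<le> 2 * real M / real T"
proof -
  have eq: "avg T (sq_avg j M b) 0 = (\<Sum>t<M. \<Sum>t'<M. avg T (slice (cross j (int t' - int t) b)) (int t)) / (real M)\<^sup>2"
    unfolding sq_avg_eq[OF assms(1)] by (simp add: avg_divide avg_sum avg_translate)
  have "\<bar>long_avg T (cross j (int t' - int t) b) - avg T (slice (cross j (int t' - int t) b)) (int t)\<bar> \<le> 2 * real M / real T"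
    if "t < M" for t t'
    unfolding long_avg_def
    by (rule order_trans[OF avg_shift[OF abs_slice_le[OF admissible_cross[OF assms(1)]]] divide_right_mono]) (use that in auto)
  then have "\<bar>\<Sum>t<M. \<Sum>t'<M. long_avg T (cross j (int t' - int t) b) - avg T (slice (cross j (int t' - int t) b)) (int t)\<bar>
      \<le> (\<Sum>t<M. \<Sum>t'<M. 2 * real M / real T)"
    by (intro order_trans[OF sum_abs] sum_mono) auto
  then have "\<bar>(\<Sum>t<M. \<Sum>t'<M. long_avg T (cross j (int t' - int t) b) - avg T (slice (cross j (int t' - int t) b)) (int t)) / (real M)\<^sup>2\<bar>
      \<le> 2 * real M / real T"
    using assms(2) by (simp add: field_simps power2_eq_square)
  then show ?thesis
    unfolding eq fejer_def by (simp add: sum_subtractf diff_divide_distrib)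
qed

text \<open>The identity for \<open>sq_osc\<close>, averaged over a long window, becomes a
  difference of two energies up to edge errors. The window starts at \<open>- int H\<close> because
  \<open>osc_avg\<close> samples \<open>{- int H..<int H}\<close>.\<close>

lemma avg_sq_osc_le:
  assumes "admissible b" "M > 0" "M \<le> H"
  shows "avg T (sq_osc j M b) (- int H)
    \<le> fejer j M (long_avg T) b - fejer j (2 * M) (long_avg T) b + 10 * real H / real T"
proof -
  have G1: "\<bar>sq_avg j N b s\<bar> \<le> 1" for N s
    using sq_avg_nonneg[of j N b s] sq_avg_le_1[OF assms(1), of j N s] by simp
  have "avg T (sq_osc j M b) (- int H) = (avg T (sq_avg j M b) (- int H) + avg T (sq_avg j M b) (- int H + int M)) / 2
      - avg T (sq_avg j (2 * M) b) (- int H)"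
    unfolding sq_osc_eq_sq_avg by (simp add: avg_diff avg_add avg_divide avg_translate)
  moreover have "\<bar>avg T (sq_avg j N b) s - avg T (sq_avg j N b) 0\<bar> \<le> 2 * real H / real T"
    if "- int H \<le> s" "s \<le> 0" for N s
    using that by (intro order_trans[OF avg_shift[OF G1]] divide_right_mono) auto
  from this[of "- int H" M] this[of "- int H + int M" M] this[of "- int H" "2 * M"]
  have "\<bar>avg T (sq_avg j M b) (- int H) - avg T (sq_avg j M b) 0\<bar> \<le> 2 * real H / real T"
    "\<bar>avg T (sq_avg j M b) (- int H + int M) - avg T (sq_avg j M b) 0\<bar> \<le> 2 * real H / real T"
    "\<bar>avg T (sq_avg j (2 * M) b) (- int H) - avg T (sq_avg j (2 * M) b) 0\<bar> \<le> 2 * real H / real T"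
    using assms(3) by simp_all
  moreover have "\<bar>fejer j M (long_avg T) b - avg T (sq_avg j M b) 0\<bar> \<le> 2 * real H / real T"
    by (rule order_trans[OF fejer_long_avg_near_sq_avg[OF assms(1,2)] divide_right_mono]) (use assms in auto)
  moreover have "\<bar>fejer j (2 * M) (long_avg T) b - avg T (sq_avg j (2 * M) b) 0\<bar> \<le> 4 * real H / real T"
    by (rule order_trans[OF fejer_long_avg_near_sq_avg[OF assms(1)] divide_right_mono]) (use assms in auto)
  \<comment> \<open>The three shifts contribute \<open>4 * H / T\<close>, two of them having weight
    one half; the comparisons with the two energies contribute \<open>2 * H / T\<close> and
    \<open>4 * H / T\<close>.\<close>
  ultimately show ?thesis by (simp add: abs_le_iff field_simps)
qed

text \<open>The loss is a mean of squares up to edge errors, and a mean of squares is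
  nonnegative.\<close>

lemma fejer_long_avg_almost_decreasing:
  assumes "admissible b" "M > 0"
  shows "fejer j (2 * M) (long_avg T) b \<le> fejer j M (long_avg T) b + 10 * real M / real T"
  using avg_sq_osc_le[OF assms order_refl, of T j] avg_nonneg[of "sq_osc j M b" T "- int M"] sq_osc_nonneg by simp

lemma fejer_mono:
  assumes "\<And>b. admissible b \<Longrightarrow> \<Lambda> b \<le> \<Lambda>' b" "admissible b"
  shows "fejer j H \<Lambda> b \<le> fejer j H \<Lambda>' b"
  unfolding fejer_def by (intro divide_right_mono sum_mono assms admissible_cross) auto

lemma flat_mono:
  assumes "\<And>b. admissible b \<Longrightarrow> \<Lambda> b \<le> \<Lambda>' b" "admissible b"
  shows "flat j H \<Lambda> b \<le> flat j H \<Lambda>' b"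
  unfolding flat_def by (intro divide_right_mono sum_mono assms admissible_cross) auto

lemma fejer_add: "fejer j H (\<lambda>b. \<Lambda> b + \<Lambda>' b) b = fejer j H \<Lambda> b + fejer j H \<Lambda>' b"
  by (simp add: fejer_def sum.distrib add_divide_distrib)

lemma fejer_cmult: "fejer j H (\<lambda>b. c * \<Lambda> b) b = c * fejer j H \<Lambda> b"
  by (simp add: fejer_def sum_distrib_left)

lemma flat_cmult: "flat j H (\<lambda>b. c * \<Lambda> b) b = c * flat j H \<Lambda> b"
  by (simp add: flat_def sum_distrib_left)

lemma fejer_const: "H > 0 \<Longrightarrow> fejer j H (\<lambda>b. c) b = c"
  by (simp add: fejer_def power2_eq_square)

lemma flat_nonneg: "(\<And>b. admissible b \<Longrightarrow> \<Lambda> b \<ge> 0) \<Longrightarrow> admissible b \<Longrightarrow> flat j H \<Lambda> b \<ge> 0"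
  unfolding flat_def by (intro divide_nonneg_nonneg sum_nonneg) (auto simp: admissible_cross)

text \<open>Doublings in two directions commute. A change of scale in one direction can thus be made
  at the innermost place, next to \<open>long_avg\<close>, where positivity is available.\<close>

lemma fejer_fejer_commute: "fejer j H (fejer i K \<Lambda>) b = fejer i K (fejer j H \<Lambda>) b"
proof -
  have "(\<Sum>t<H. \<Sum>t'<H. \<Sum>u<K. \<Sum>u'<K. \<Lambda> (cross i (int u' - int u) (cross j (int t' - int t) b)))
      = (\<Sum>u<K. \<Sum>u'<K. \<Sum>t<H. \<Sum>t'<H. \<Lambda> (cross j (int t' - int t) (cross i (int u' - int u) b)))"
    unfolding cross_commute[of i _ j]
    by (subst (2) sum.swap, subst sum.swap, subst (4) sum.swap, subst (3) sum.swap) (rule refl)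
  then show ?thesis
    by (simp add: fejer_def sum_divide_distrib[symmetric] mult.commute)
qed

text \<open>For fixed \<open>t\<close> every difference \<open>h\<close> comes from at most one
  \<open>t'\<close>. The summand may depend on \<open>t\<close> as well, because in a later use it
  contains a window that starts at \<open>- int H + int t\<close>.\<close>

lemma sum_diff_le_flat:
  fixes \<phi> :: "int \<Rightarrow> nat \<Rightarrow> real"
  assumes "\<And>h t. \<phi> h t \<ge> 0"
  shows "(\<Sum>t<H. \<Sum>t'<H. \<phi> (int t' - int t) t) \<le> (\<Sum>h\<in>{- int H<..<int H}. \<Sum>t<H. \<phi> h t)"
proof -
  have "(\<Sum>t'<H. \<phi> (int t' - int t) t) \<le> (\<Sum>h\<in>{- int H<..<int H}. \<phi> h t)" if "t < H" for t
  proof -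
    have "(\<Sum>t'<H. \<phi> (int t' - int t) t) = (\<Sum>h\<in>(\<lambda>t'. int t' - int t) ` {..<H}. \<phi> h t)"
      by (subst sum.reindex) (auto simp: inj_on_def)
    also have "\<dots> \<le> (\<Sum>h\<in>{- int H<..<int H}. \<phi> h t)"
      by (intro sum_mono2 assms) (use that in auto)
    finally show ?thesis .
  qed
  then have "(\<Sum>t<H. \<Sum>t'<H. \<phi> (int t' - int t) t) \<le> (\<Sum>t<H. \<Sum>h\<in>{- int H<..<int H}. \<phi> h t)"
    by (intro sum_mono) auto
  also have "\<dots> = (\<Sum>h\<in>{- int H<..<int H}. \<Sum>t<H. \<phi> h t)" by (rule sum.swap)
  finally show ?thesis .
qed

lemma fejer_le_flat:
  assumes "\<And>b. admissible b \<Longrightarrow> \<Lambda> b \<ge> 0" "admissible b" "H > 0"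
  shows "fejer j H \<Lambda> b \<le> flat j H \<Lambda> b"
proof -
  have "(\<Sum>t<H. \<Sum>t'<H. \<Lambda> (cross j (int t' - int t) b)) \<le> (\<Sum>h\<in>{- int H<..<int H}. \<Sum>t<H. \<Lambda> (cross j h b))"
    by (rule sum_diff_le_flat) (simp add: assms admissible_cross)
  also have "\<dots> = real H * (\<Sum>h\<in>{- int H<..<int H}. \<Lambda> (cross j h b))"
    by (simp add: sum_distrib_left)
  finally show ?thesis using assms(3) by (simp add: fejer_def flat_def field_simps power2_eq_square)
qed

text \<open>At scale \<open>2 * H\<close> the Fejer weight of a step \<open>h\<close> with
  \<open>|h| < H\<close> is at least \<open>H / (2 * H)^2\<close>, a quarter of the weight
  \<open>1 / H\<close> in \<open>flat\<close>.\<close>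

lemma flat_le_fejer:
  assumes "\<And>b. admissible b \<Longrightarrow> \<Lambda> b \<ge> 0" "admissible b" "H > 0"
  shows "flat j H \<Lambda> b \<le> 4 * fejer j (2 * H) \<Lambda> b"
proof -
  let ?f = "\<lambda>h. \<Lambda> (cross j h b)"
  have nn: "?f h \<ge> 0" for h by (simp add: assms admissible_cross)
  txt \<open>Each \<open>h\<close> with \<open>\<bar>h\<bar> < H\<close> is a difference \<open>t' - t\<close> for all \<open>t\<close> in a window of length \<open>H\<close>.\<close>
  have win: "real H * ?f h \<le> (\<Sum>t<2*H. \<Sum>t'\<in>{t'. t' < 2*H \<and> int t' - int t = h}. ?f (int t' - int t))"
    if "h \<in> {- int H<..<int H}" for h
  proof -
    \<comment> \<open>The least start that keeps both \<open>t\<close> and \<open>t + h\<close>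
      nonnegative; on the next \<open>H\<close> values of \<open>t\<close> both stay below
      \<open>2 * H\<close>.\<close>
    define a where "a = nat (max 0 (- h))"
    have ha: "- int H < h" "h < int H" using that by auto
    have "real H * ?f h = (\<Sum>t\<in>{a..<a+H}. ?f h)" by simp
    also have "\<dots> = (\<Sum>t\<in>{a..<a+H}. \<Sum>t'\<in>{nat (int t + h)}. ?f (int t' - int t))"
    proof (rule sum.cong[OF refl])
      fix t assume "t \<in> {a..<a+H}"
      then have "int t + h \<ge> 0" by (auto simp: a_def)
      then show "?f h = (\<Sum>t'\<in>{nat (int t + h)}. ?f (int t' - int t))" by simp
    qed
    also have "\<dots> \<le> (\<Sum>t\<in>{a..<a+H}. \<Sum>t'\<in>{t'. t' < 2*H \<and> int t' - int t = h}. ?f (int t' - int t))"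
      using ha by (intro sum_mono sum_mono2 nn) (auto simp: a_def max_def split: if_splits)
    also have "\<dots> \<le> (\<Sum>t<2*H. \<Sum>t'\<in>{t'. t' < 2*H \<and> int t' - int t = h}. ?f (int t' - int t))"
      using ha by (intro sum_mono2 sum_nonneg nn) (auto simp: a_def max_def split: if_splits)
    finally show ?thesis .
  qed
  have "real H * (\<Sum>h\<in>{- int H<..<int H}. ?f h)
      \<le> (\<Sum>h\<in>{- int H<..<int H}. \<Sum>t<2*H. \<Sum>t'\<in>{t'. t' < 2*H \<and> int t' - int t = h}. ?f (int t' - int t))"
    unfolding sum_distrib_left by (intro sum_mono win)
  also have "\<dots> = (\<Sum>t<2*H. \<Sum>h\<in>{- int H<..<int H}. \<Sum>t'\<in>{t'. t' < 2*H \<and> int t' - int t = h}. ?f (int t' - int t))"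
    by (rule sum.swap)
  also have "\<dots> \<le> (\<Sum>t<2*H. \<Sum>t'<2*H. ?f (int t' - int t))"
  proof (rule sum_mono)
    fix t
    have "(\<Sum>h\<in>{- int H<..<int H}. \<Sum>t'\<in>{t'. t' < 2*H \<and> int t' - int t = h}. ?f (int t' - int t))
        = (\<Sum>t'\<in>(\<Union>h\<in>{- int H<..<int H}. {t'. t' < 2*H \<and> int t' - int t = h}). ?f (int t' - int t))"
      by (subst sum.UNION_disjoint) auto
    also have "\<dots> \<le> (\<Sum>t'<2*H. ?f (int t' - int t))"
      by (intro sum_mono2 nn) auto
    finally show "(\<Sum>h\<in>{- int H<..<int H}. \<Sum>t'\<in>{t'. t' < 2*H \<and> int t' - int t = h}. ?f (int t' - int t))
      \<le> (\<Sum>t'<2*H. ?f (int t' - int t))" .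
  qed
  finally show ?thesis using assms(3) by (simp add: fejer_def flat_def field_simps power2_eq_square)
qed

lemma flat_enlarge:
  assumes "\<And>b. admissible b \<Longrightarrow> \<Lambda> b \<ge> 0" "admissible b" "H > 0" "H \<le> H'"
  shows "flat j H \<Lambda> b \<le> (real H' / real H) * flat j H' \<Lambda> b"
proof -
  have "(\<Sum>h\<in>{- int H<..<int H}. \<Lambda> (cross j h b)) \<le> (\<Sum>h\<in>{- int H'<..<int H'}. \<Lambda> (cross j h b))"
    using assms by (intro sum_mono2) (auto simp: admissible_cross)
  then show ?thesis using assms(3,4) by (simp add: flat_def field_simps)
qed

lemma osc_avg_enlarge:
  assumes "H > 0" "H \<le> H'"
  shows "osc_avg M H b \<le> (real H' / real H) * osc_avg M H' b"
proof -
  have "(\<Sum>s\<in>{- int H..<int H}. \<bar>avg M (slice b) s - avg (2 * M) (slice b) s\<bar>)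
      \<le> (\<Sum>s\<in>{- int H'..<int H'}. \<bar>avg M (slice b) s - avg (2 * M) (slice b) s\<bar>)"
    using assms by (intro sum_mono2) auto
  then show ?thesis using assms by (simp add: osc_avg_def field_simps)
qed

section \<open>Averages in several directions at once\<close>

primrec fejers :: "int list \<Rightarrow> nat \<Rightarrow> ((int \<Rightarrow> int \<Rightarrow> real) \<Rightarrow> real) \<Rightarrow> (int \<Rightarrow> int \<Rightarrow> real) \<Rightarrow> real" where
  "fejers [] H \<Lambda> = \<Lambda>"
| "fejers (j # js) H \<Lambda> = fejer j H (fejers js H \<Lambda>)"

primrec flats :: "int list \<Rightarrow> nat \<Rightarrow> ((int \<Rightarrow> int \<Rightarrow> real) \<Rightarrow> real) \<Rightarrow> (int \<Rightarrow> int \<Rightarrow> real) \<Rightarrow> real" where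
  "flats [] H \<Lambda> = \<Lambda>"
| "flats (j # js) H \<Lambda> = flat j H (flats js H \<Lambda>)"

lemma flats_snoc: "flats (js @ [j]) H \<Lambda> = flats js H (flat j H \<Lambda>)"
  by (induction js) simp_all

lemma fejers_mono:
  assumes "\<And>b. admissible b \<Longrightarrow> \<Lambda> b \<le> \<Lambda>' b" "admissible b"
  shows "fejers js H \<Lambda> b \<le> fejers js H \<Lambda>' b"
  using assms(2) by (induction js arbitrary: b) (simp_all add: assms(1) fejer_mono)

lemma flats_mono:
  assumes "\<And>b. admissible b \<Longrightarrow> \<Lambda> b \<le> \<Lambda>' b" "admissible b"
  shows "flats js H \<Lambda> b \<le> flats js H \<Lambda>' b"
  using assms(2) by (induction js arbitrary: b) (simp_all add: assms(1) flat_mono)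

lemma fejers_add: "fejers js H (\<lambda>b. \<Lambda> b + \<Lambda>' b) b = fejers js H \<Lambda> b + fejers js H \<Lambda>' b"
proof (induction js arbitrary: b)
  case (Cons j js)
  then have "fejers js H (\<lambda>b. \<Lambda> b + \<Lambda>' b) = (\<lambda>b. fejers js H \<Lambda> b + fejers js H \<Lambda>' b)" by blast
  then show ?case by (simp add: fejer_add)
qed simp

lemma fejers_cmult: "fejers js H (\<lambda>b. c * \<Lambda> b) b = c * fejers js H \<Lambda> b"
proof (induction js arbitrary: b)
  case (Cons j js)
  then have "fejers js H (\<lambda>b. c * \<Lambda> b) = (\<lambda>b. c * fejers js H \<Lambda> b)" by blast
  then show ?case by (simp add: fejer_cmult)
qed simp

lemma flats_cmult: "flats js H (\<lambda>b. c * \<Lambda> b) b = c * flats js H \<Lambda> b"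
proof (induction js arbitrary: b)
  case (Cons j js)
  then have "flats js H (\<lambda>b. c * \<Lambda> b) = (\<lambda>b. c * flats js H \<Lambda> b)" by blast
  then show ?case by (simp add: flat_cmult)
qed simp

lemma fejers_const: "H > 0 \<Longrightarrow> fejers js H (\<lambda>b. c) b = c"
proof (induction js arbitrary: b)
  case (Cons j js)
  then have "fejers js H (\<lambda>b. c) = (\<lambda>b. c)" by blast
  then show ?case using Cons.prems by (simp add: fejer_const)
qed simp

lemma fejers_diff: "fejers js H (\<lambda>b. \<Lambda> b - \<Lambda>' b) b = fejers js H \<Lambda> b - fejers js H \<Lambda>' b"
  using fejers_add[of js H "\<lambda>b. \<Lambda> b - \<Lambda>' b" \<Lambda>' b] by simp

lemma flat_add: "flat j H (\<lambda>b. \<Lambda> b + \<Lambda>' b) b = flat j H \<Lambda> b + flat j H \<Lambda>' b"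
  by (simp add: flat_def sum.distrib add_divide_distrib)

lemma flats_add: "flats js H (\<lambda>b. \<Lambda> b + \<Lambda>' b) b = flats js H \<Lambda> b + flats js H \<Lambda>' b"
proof (induction js arbitrary: b)
  case (Cons j js)
  then have "flats js H (\<lambda>b. \<Lambda> b + \<Lambda>' b) = (\<lambda>b. flats js H \<Lambda> b + flats js H \<Lambda>' b)" by blast
  then show ?case by (simp add: flat_add)
qed simp

lemma flats_sum: "finite I \<Longrightarrow> flats js H (\<lambda>b. \<Sum>i\<in>I. \<Lambda> i b) b = (\<Sum>i\<in>I. flats js H (\<Lambda> i) b)"
proof (induction I rule: finite_induct)
  case empty
  then show ?case using flats_cmult[of js H 0 "\<lambda>b. 0" b] by simp
qed (simp add: flats_add)

lemma flats_nonneg: "(\<And>b. admissible b \<Longrightarrow> \<Lambda> b \<ge> 0) \<Longrightarrow> admissible b \<Longrightarrow> flats js H \<Lambda> b \<ge> 0"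
  by (induction js arbitrary: b) (simp_all add: flat_nonneg)

lemma fejers_le_flats:
  assumes "\<And>b. admissible b \<Longrightarrow> \<Lambda> b \<ge> 0" "admissible b" "H > 0"
  shows "fejers js H \<Lambda> b \<le> flats js H \<Lambda> b"
  using assms(2)
proof (induction js arbitrary: b)
  case (Cons j js)
  have "fejer j H (fejers js H \<Lambda>) b \<le> fejer j H (flats js H \<Lambda>) b"
    by (rule fejer_mono[OF Cons.IH Cons.prems])
  also have "\<dots> \<le> flat j H (flats js H \<Lambda>) b"
    by (rule fejer_le_flat) (auto simp: assms flats_nonneg Cons.prems)
  finally show ?case by simp
qed simp

lemma flats_le_fejers:
  assumes "\<And>b. admissible b \<Longrightarrow> \<Lambda> b \<ge> 0" "admissible b" "H > 0"
  shows "flats js H \<Lambda> b \<le> 4 ^ length js * fejers js (2 * H) \<Lambda> b"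
  using assms(2)
proof (induction js arbitrary: b)
  case (Cons j js)
  have "flat j H (flats js H \<Lambda>) b \<le> 4 * fejer j (2 * H) (flats js H \<Lambda>) b"
    by (rule flat_le_fejer) (auto simp: assms flats_nonneg Cons.prems)
  also have "\<dots> \<le> 4 * fejer j (2 * H) (\<lambda>b. 4 ^ length js * fejers js (2 * H) \<Lambda> b) b"
    by (intro mult_left_mono fejer_mono Cons) auto
  finally show ?case by (simp add: fejer_cmult)
qed simp

lemma flats_enlarge:
  assumes "\<And>b. admissible b \<Longrightarrow> \<Lambda> b \<ge> 0" "admissible b" "H > 0" "H \<le> H'"
  shows "flats js H \<Lambda> b \<le> (real H' / real H) ^ length js * flats js H' \<Lambda> b"
  using assms(2)
proof (induction js arbitrary: b)
  case (Cons j js)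
  have "flat j H (flats js H \<Lambda>) b \<le> (real H' / real H) * flat j H' (flats js H \<Lambda>) b"
    by (rule flat_enlarge) (auto simp: assms flats_nonneg Cons.prems)
  also have "\<dots> \<le> (real H' / real H) * flat j H' (\<lambda>b. (real H' / real H) ^ length js * flats js H' \<Lambda> b) b"
    by (intro mult_left_mono flat_mono Cons) auto
  finally show ?case by (simp add: flat_cmult)
qed simp

lemma flats_osc_avg_enlarge:
  assumes "admissible b" "H > 0" "H \<le> H'"
  shows "flats js H (osc_avg K H) b \<le> (real H' / real H) ^ Suc (length js) * flats js H' (osc_avg K H') b"
proof -
  have "flats js H (osc_avg K H) b \<le> flats js H (\<lambda>b. (real H' / real H) * osc_avg K H' b) b"
    by (intro flats_mono osc_avg_enlarge assms)
  also have "\<dots> = (real H' / real H) * flats js H (osc_avg K H') b" by (rule flats_cmult)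
  also have "\<dots> \<le> (real H' / real H) * ((real H' / real H) ^ length js * flats js H' (osc_avg K H') b)"
    by (intro mult_left_mono flats_enlarge assms osc_avg_nonneg) auto
  finally show ?thesis by simp
qed

lemma fejer_fejers_commute: "fejer j H (fejers js K \<Lambda>) b = fejers js K (fejer j H \<Lambda>) b"
proof (induction js arbitrary: b)
  case (Cons i js)
  have "fejer j H (fejer i K (fejers js K \<Lambda>)) b = fejer i K (fejer j H (fejers js K \<Lambda>)) b"
    by (rule fejer_fejer_commute)
  also have "fejer j H (fejers js K \<Lambda>) = fejers js K (fejer j H \<Lambda>)"
    using Cons by blast
  finally show ?case by simp
qed simp

text \<open>The directions are rescaled one at a time. By commutation the outer average moves inside
  the others, where the hypothesis applies; Fejer averages preserve inequalities and constants, so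
  the errors merely add up.\<close>

lemma fejers_almost_decreasing:
  assumes "\<And>b j. admissible b \<Longrightarrow> fejer j (2 * H) \<Lambda> b \<le> fejer j H \<Lambda> b + e" "admissible b" "H > 0"
  shows "fejers js (2 * H) \<Lambda> b \<le> fejers js H \<Lambda> b + real (length js) * e"
  using assms(2)
proof (induction js arbitrary: b)
  case (Cons j js)
  have "fejer j (2 * H) (fejers js (2 * H) \<Lambda>) b
      \<le> fejer j (2 * H) (\<lambda>b. fejers js H \<Lambda> b + real (length js) * e) b"
    by (rule fejer_mono[OF Cons.IH Cons.prems])
  also have "\<dots> = fejers js H (fejer j (2 * H) \<Lambda>) b + real (length js) * e"
    using assms(3) by (simp add: fejer_add fejer_const fejer_fejers_commute)
  also have "fejers js H (fejer j (2 * H) \<Lambda>) b \<le> fejers js H (\<lambda>b. fejer j H \<Lambda> b + e) b"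
    by (rule fejers_mono[OF assms(1) Cons.prems])
  also have "\<dots> = fejer j H (fejers js H \<Lambda>) b + e"
    using assms(3) by (simp add: fejers_add fejers_const fejer_fejers_commute)
  finally show ?case by (simp add: algebra_simps)
qed simp

lemma fejer_fejer_long_avg_almost_decreasing:
  assumes "admissible b" "H > 0" "M > 0"
  shows "fejer j (2 * H) (fejer m M (long_avg T)) b \<le> fejer j H (fejer m M (long_avg T)) b + 10 * real H / real T"
proof -
  have "fejer m M (fejer j (2 * H) (long_avg T)) b \<le> fejer m M (\<lambda>b. fejer j H (long_avg T) b + 10 * real H / real T) b"
    using assms by (intro fejer_mono fejer_long_avg_almost_decreasing) auto
  also have "\<dots> = fejer m M (fejer j H (long_avg T)) b + 10 * real H / real T"
    using assms by (simp add: fejer_add fejer_const)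
  finally show ?thesis by (simp add: fejer_fejer_commute[of j])
qed

text \<open>Moving both windows to a start \<open>s\<close> with \<open>|s| <= H\<close> costs
  \<open>2 * H / T\<close> and \<open>H / T\<close>. Averaging over these \<open>s\<close> replaces
  the difference at the origin by a mean oscillation, the only quantity the induction
  controls.\<close>

lemma long_avg_double_le:
  assumes "admissible b" "H > 0"
  shows "\<bar>long_avg (2 * T) b - long_avg T b\<bar> \<le> osc_avg T H b + 3 * real H / real T"
proof -
  have C1: "\<bar>slice b s\<bar> \<le> 1" for s by (rule abs_slice_le[OF assms(1)])
  let ?d = "\<lambda>s. \<bar>avg T (slice b) s - avg (2 * T) (slice b) s\<bar>"
  have "\<bar>long_avg (2 * T) b - long_avg T b\<bar> - 3 * real H / real T \<le> ?d s" if "s \<in> {- int H..<int H}" for s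
  proof -
    have "\<bar>avg N (slice b) s - avg N (slice b) 0\<bar> \<le> 2 * real H / real N" for N
      by (rule order_trans[OF avg_shift[OF C1] divide_right_mono]) (use that in auto)
    from this[of T] this[of "2 * T"] show ?thesis by (simp add: long_avg_def abs_le_iff) argo
  qed
  then have "(\<Sum>s\<in>{- int H..<int H}. \<bar>long_avg (2 * T) b - long_avg T b\<bar> - 3 * real H / real T)
      \<le> (\<Sum>s\<in>{- int H..<int H}. ?d s)" by (intro sum_mono)
  \<comment> \<open>The range of \<open>s\<close> has \<open>2 * H\<close> points while
    \<open>osc_avg\<close> divides by \<open>H\<close>; hence the factor 2.\<close>
  then have "2 * (\<bar>long_avg (2 * T) b - long_avg T b\<bar> - 3 * real H / real T) \<le> osc_avg T H b"
    using assms(2) by (simp add: osc_avg_def field_simps)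
  then show ?thesis using osc_avg_nonneg[of T H b] by argo
qed

section \<open>Removing one function by Cauchy-Schwarz\<close>

text \<open>The added factor is constant along the direction \<open>(-m, 1)\<close>; this is how the
  function to be removed enters the product.\<close>

definition twist :: "int \<Rightarrow> (int \<Rightarrow> real) \<Rightarrow> (int \<Rightarrow> int \<Rightarrow> real) \<Rightarrow> int \<Rightarrow> int \<Rightarrow> real" where
  "twist m g b = (\<lambda>x t. g (x + m * t) * b x t)"

text \<open>A step \<open>h\<close> in direction \<open>(-j, 1)\<close> moves
  \<open>x + m * t\<close> by \<open>(m - j) * h\<close>. The doubled factor therefore still depends
  on \<open>x + m * t\<close> alone.\<close>

lemma cross_twist: "cross j h (twist m g b) = twist m (\<lambda>y. g y * g (y + (m - j) * h)) (cross j h b)"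
  by (simp add: cross_def twist_def fun_eq_iff algebra_simps)

lemma admissible1_mult_shift: "admissible1 g \<Longrightarrow> admissible1 (\<lambda>y. g y * g (y + c))"
  using admissible1_shift[of g c] by (intro admissible1_mult) (auto simp: admissible1_def)

lemma along_twist: "along m (twist m g b) y t = g y * along m b y t"
  by (simp add: along_def twist_def)

lemma admissible_twist:
  assumes "admissible1 g" "admissible b" shows "admissible (twist m g b)"
  unfolding admissible_def twist_def
proof
  fix t
  show "admissible1 (\<lambda>x. g (x + m * t) * b x t)"
    using assms(2) by (intro admissible1_mult admissible1_shift assms(1)) (auto simp: admissible_def admissible1_def)
qed

text \<open>On a line in direction \<open>(-m, 1)\<close> the factor is the constant
  \<open>g y\<close>, so the oscillation is a mean of \<open>g y\<close> times an oscillation along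
  the line. The inequality \<open>|z| <= \<eta> + z^2 / \<eta>\<close> plays the part of
  Cauchy-Schwarz: the mean of \<open>|g|\<close> pays for the first term, and
  \<open>|g| <= 1\<close> removes \<open>g\<close> from the second.\<close>

lemma osc_avg_twist_le:
  assumes "admissible1 g" "admissible b" "H > 0" "\<eta> > 0"
  shows "osc_avg M H (twist m g b) \<le> 2 * \<eta> + (2 / \<eta>) * avg (2 * H) (sq_osc m M b) (- int H)"
proof -
  let ?b = "twist m g b"
  have pt: "\<bar>avg M (slice ?b) s - avg (2 * M) (slice ?b) s\<bar> \<le> \<eta> + sq_osc m M b s / \<eta>" for s
  proof -
    let ?X = "\<lambda>y. avg M (along m b y) s - avg (2 * M) (along m b y) s"
    have "slice ?b = (\<lambda>t. mean (\<lambda>y. g y * along m b y t))"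
      using slice_along[OF admissible_twist[OF assms(1,2)], of m _ m] by (simp add: along_twist fun_eq_iff)
    then have eq: "avg M (slice ?b) s - avg (2 * M) (slice ?b) s = mean (\<lambda>y. g y * ?X y)"
      by (simp add: mean_avg[symmetric] avg_cmult mean_diff right_diff_distrib)
    have "\<bar>mean (\<lambda>y. g y * ?X y)\<bar> \<le> mean (\<lambda>y. \<bar>g y * ?X y\<bar>)" by (rule mean_abs)
    also have "\<dots> \<le> mean (\<lambda>y. \<eta> * \<bar>g y\<bar> + (?X y)\<^sup>2 / \<eta>)"
    proof (rule mean_mono)
      fix y
      have g1: "\<bar>g y\<bar> \<le> 1" using assms(1) by (simp add: admissible1_def)
      have am: "\<bar>z\<bar> \<le> \<eta> + z\<^sup>2 / \<eta>" for z :: real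
      proof -
        have "2 * (\<bar>z\<bar> * \<eta>) \<le> \<eta>\<^sup>2 + z\<^sup>2"
          using zero_le_power2[of "\<bar>z\<bar> - \<eta>"] by (simp add: power2_diff mult_ac)
        moreover have "0 \<le> \<bar>z\<bar> * \<eta>" using assms(4) by simp
        ultimately have "\<bar>z\<bar> * \<eta> \<le> \<eta>\<^sup>2 + z\<^sup>2" by linarith
        then show ?thesis using assms(4) by (simp add: field_simps power2_eq_square)
      qed
      have "\<bar>g y * ?X y\<bar> \<le> \<bar>g y\<bar> * (\<eta> + (?X y)\<^sup>2 / \<eta>)"
        unfolding abs_mult by (intro mult_left_mono am) simp
      also have "\<dots> = \<eta> * \<bar>g y\<bar> + \<bar>g y\<bar> * ((?X y)\<^sup>2 / \<eta>)" by (simp add: algebra_simps)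
      also have "\<bar>g y\<bar> * ((?X y)\<^sup>2 / \<eta>) \<le> (?X y)\<^sup>2 / \<eta>"
        by (rule mult_left_le_one_le) (use assms(4) g1 in auto)
      finally show "\<bar>g y * ?X y\<bar> \<le> \<eta> * \<bar>g y\<bar> + (?X y)\<^sup>2 / \<eta>" by simp
    qed
    also have "\<dots> = \<eta> * mean (\<lambda>y. \<bar>g y\<bar>) + sq_osc m M b s / \<eta>"
      by (simp add: mean_add mean_cmult mean_divide sq_osc_def)
    also have "\<eta> * mean (\<lambda>y. \<bar>g y\<bar>) \<le> \<eta>"
      using assms(1,4) by (simp add: admissible1_def mult_left_le)
    finally show ?thesis unfolding eq by simp
  qed
  have re: "(\<Sum>s\<in>{- int H..<int H}. sq_osc m M b s) = 2 * real H * avg (2 * H) (sq_osc m M b) (- int H)"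
  proof -
    have "(\<Sum>s\<in>{- int H..<int H}. sq_osc m M b s) = (\<Sum>t<2*H. sq_osc m M b (- int H + int t))"
      by (rule sum.reindex_bij_witness[where i = "\<lambda>t. - int H + int t" and j = "\<lambda>s. nat (s + int H)"]) auto
    then show ?thesis using assms(3) by (simp add: avg_def)
  qed
  have "osc_avg M H ?b \<le> (\<Sum>s\<in>{- int H..<int H}. \<eta> + sq_osc m M b s / \<eta>) / real H"
    unfolding osc_avg_def by (intro divide_right_mono sum_mono pt) auto
  also have "\<dots> = 2 * \<eta> + (\<Sum>s\<in>{- int H..<int H}. sq_osc m M b s) / \<eta> / real H"
    using assms(3) by (simp add: sum.distrib sum_divide_distrib[symmetric] add_divide_distrib)
  also have "\<dots> = 2 * \<eta> + (2 / \<eta>) * avg (2 * H) (sq_osc m M b) (- int H)"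
    unfolding re using assms(3) by simp
  finally show ?thesis .
qed

text \<open>A doubled twist is again a twist by an admissible function, so a bound that is uniform
  in \<open>g\<close> survives any number of doublings.\<close>

lemma flats_twist_le:
  assumes "\<And>g b. admissible1 g \<Longrightarrow> admissible b \<Longrightarrow> \<Lambda> (twist m g b) \<le> \<Lambda>' b" "admissible1 g" "admissible b"
  shows "flats js H \<Lambda> (twist m g b) \<le> flats js H \<Lambda>' b"
  using assms(2,3)
proof (induction js arbitrary: g b)
  case (Cons j js)
  have "flats js H \<Lambda> (cross j h (twist m g b)) \<le> flats js H \<Lambda>' (cross j h b)" for h
    unfolding cross_twist by (intro Cons admissible1_mult_shift admissible_cross)
  then show ?case by (auto simp: flat_def intro!: divide_right_mono sum_mono)
qed (simp add: assms(1))

text \<open>By the Haar expansion, passing from window \<open>K\<close> to \<open>2 * K\<close> acts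
  on each slice of \<open>cross m h b\<close> separately and produces an oscillation of the doubled
  function at scale \<open>K\<close>. The condition \<open>2 * M <= H\<close> keeps all steps and
  starting points within the ranges of \<open>flat\<close> and \<open>osc_avg\<close>.\<close>

lemma avg_sq_osc_double_window:
  assumes "admissible b" "M > 0" "2 * M \<le> H"
  shows "avg K (sq_osc m M b) (- int H) - avg (2 * K) (sq_osc m M b) (- int H)
    \<le> (real H / real M)\<^sup>2 * flat m H (osc_avg K H) b"
proof -
  define \<phi> where "\<phi> h t = \<bar>avg K (slice (cross m h b)) (- int H + int t) - avg (2 * K) (slice (cross m h b)) (- int H + int t)\<bar>"
    for h :: int and t :: nat
  have sq_osc: "sq_osc m M b = (\<lambda>s. \<Sum>t<2*M. \<Sum>t'<2*M. haar M t * haar M t' * slice (cross m (int t' - int t) b) (s + int t))"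
    using sq_osc_eq_haar[OF assms(1,2)] by blast
  have "avg K (sq_osc m M b) (- int H) - avg (2 * K) (sq_osc m M b) (- int H)
    = (\<Sum>t<2*M. \<Sum>t'<2*M. haar M t * haar M t' *
        (avg K (slice (cross m (int t' - int t) b)) (- int H + int t) - avg (2 * K) (slice (cross m (int t' - int t) b)) (- int H + int t)))"
    unfolding sq_osc by (simp add: avg_sum avg_cmult avg_translate sum_subtractf right_diff_distrib)
  also have "\<dots> \<le> (\<Sum>t<2*M. \<Sum>t'<2*M. (1 / (2 * real M))\<^sup>2 * \<phi> (int t' - int t) t)"
  proof (intro sum_mono)
    fix t t'
    let ?d = "avg K (slice (cross m (int t' - int t) b)) (- int H + int t) - avg (2 * K) (slice (cross m (int t' - int t) b)) (- int H + int t)"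
    have "haar M t * haar M t' * ?d \<le> \<bar>haar M t * haar M t' * ?d\<bar>" by (rule abs_ge_self)
    also have "\<dots> = (1 / (2 * real M))\<^sup>2 * \<bar>?d\<bar>" by (simp add: abs_mult abs_haar power2_eq_square)
    finally show "haar M t * haar M t' * ?d \<le> (1 / (2 * real M))\<^sup>2 * \<phi> (int t' - int t) t"
      by (simp add: \<phi>_def)
  qed
  also have "\<dots> = (1 / (2 * real M))\<^sup>2 * (\<Sum>t<2*M. \<Sum>t'<2*M. \<phi> (int t' - int t) t)"
    by (simp add: sum_distrib_left)
  also have "(\<Sum>t<2*M. \<Sum>t'<2*M. \<phi> (int t' - int t) t) \<le> (\<Sum>h\<in>{- int (2*M)<..<int (2*M)}. \<Sum>t<2*M. \<phi> h t)"
    by (rule sum_diff_le_flat) (simp add: \<phi>_def)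
  also have "\<dots> \<le> (\<Sum>h\<in>{- int H<..<int H}. \<Sum>t<2*M. \<phi> h t)"
    using assms(3) by (intro sum_mono2 sum_nonneg) (auto simp: \<phi>_def)
  also have "\<dots> \<le> (\<Sum>h\<in>{- int H<..<int H}. real H * osc_avg K H (cross m h b))"
  proof (rule sum_mono)
    fix h
    let ?f = "\<lambda>s. \<bar>avg K (slice (cross m h b)) s - avg (2 * K) (slice (cross m h b)) s\<bar>"
    have "(\<Sum>t<2*M. \<phi> h t) = (\<Sum>s\<in>(\<lambda>t. - int H + int t) ` {..<2*M}. ?f s)"
      by (subst sum.reindex) (auto simp: inj_on_def \<phi>_def)
    also have "\<dots> \<le> (\<Sum>s\<in>{- int H..<int H}. ?f s)"
      using assms(3) by (intro sum_mono2) auto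
    also have "\<dots> = real H * osc_avg K H (cross m h b)" using assms by (simp add: osc_avg_def)
    finally show "(\<Sum>t<2*M. \<phi> h t) \<le> real H * osc_avg K H (cross m h b)" .
  qed
  also have "\<dots> = (real H)\<^sup>2 * flat m H (osc_avg K H) b"
    using assms by (simp add: flat_def sum_distrib_left[symmetric] power2_eq_square)
  finally have "avg K (sq_osc m M b) (- int H) - avg (2 * K) (sq_osc m M b) (- int H)
      \<le> (1 / (2 * real M))\<^sup>2 * ((real H)\<^sup>2 * flat m H (osc_avg K H) b)"
    by (simp add: mult_left_mono)
  also have "\<dots> \<le> (real H / real M)\<^sup>2 * flat m H (osc_avg K H) b"
    using flat_nonneg[of "osc_avg K H" b m H] assms osc_avg_nonneg by (simp add: field_simps power2_eq_square)
  finally show ?thesis .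
qed

lemma avg_sq_osc_chain:
  assumes "admissible b" "M > 0" "2 * M \<le> H"
  shows "avg K (sq_osc m M b) (- int H) \<le> avg (2 ^ c * K) (sq_osc m M b) (- int H)
    + (\<Sum>a<c. (real H / real M)\<^sup>2 * flat m H (osc_avg (2 ^ a * K) H) b)"
proof (induction c)
  case (Suc c)
  then show ?case using avg_sq_osc_double_window[OF assms, of "2 ^ c * K" m] by (simp add: mult.assoc)
qed simp

text \<open>Unweighted averages suit nonnegative quantities, Fejer averages suit energies. Passing
  from the former to the latter costs \<open>4 ^ length js\<close> and a doubling of the outer
  scale. Inside, the window is lengthened to \<open>T\<close> by \<open>c\<close> doublings before
  the energies are introduced; the resulting errors are nonnegative and return to unweighted
  averages, the form that the induction uses.\<close>

lemma flats_osc_avg_twist_le: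
  assumes "admissible1 g" "admissible b" "M > 0" "2 * M \<le> H" "\<eta> > 0"
    and T: "T = 2 ^ c * (2 * H)"
  shows "flats js H (osc_avg M H) (twist m g b) \<le> 4 ^ length js * (2 * \<eta> + (2 / \<eta>) *
    (fejers js (2 * H) (fejer m M (long_avg T)) b - fejers js (2 * H) (fejer m (2 * M) (long_avg T)) b + 10 * real H / real T
     + (real H / real M)\<^sup>2 * (\<Sum>a<c. flats js (2 * H) (flat m H (osc_avg (2 ^ a * (2 * H)) H)) b)))"
proof -
  have H: "H > 0" using assms by simp
  let ?L = "\<lambda>b. 2 * \<eta> + (2 / \<eta>) * avg (2 * H) (sq_osc m M b) (- int H)"
  let ?E = "\<lambda>b. \<Sum>a<c. flat m H (osc_avg (2 ^ a * (2 * H)) H) b"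
  let ?R = "\<lambda>b. 2 * \<eta> + (2 / \<eta>) * ((fejer m M (long_avg T) b - fejer m (2 * M) (long_avg T) b + 10 * real H / real T)
      + (real H / real M)\<^sup>2 * ?E b)"
  have nn: "?L b \<ge> 0" for b
    using assms(5) avg_nonneg[of "sq_osc m M b" "2 * H" "- int H"] sq_osc_nonneg by simp
  have "flats js H (osc_avg M H) (twist m g b) \<le> flats js H ?L b"
    by (intro flats_twist_le osc_avg_twist_le assms H)
  also have "\<dots> \<le> 4 ^ length js * fejers js (2 * H) ?L b"
    by (intro flats_le_fejers nn assms H)
  also have "fejers js (2 * H) ?L b \<le> fejers js (2 * H) ?R b"
  proof (intro fejers_mono assms(2))
    fix b assume b: "admissible b"
    have "avg (2 * H) (sq_osc m M b) (- int H) \<le> avg T (sq_osc m M b) (- int H) + (real H / real M)\<^sup>2 * ?E b"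
      using avg_sq_osc_chain[OF b assms(3,4), of "2 * H" m c] by (simp add: T sum_distrib_left)
    also have "avg T (sq_osc m M b) (- int H) \<le> fejer m M (long_avg T) b - fejer m (2 * M) (long_avg T) b + 10 * real H / real T"
      using assms by (intro avg_sq_osc_le b) auto
    finally have "avg (2 * H) (sq_osc m M b) (- int H) \<le> (fejer m M (long_avg T) b - fejer m (2 * M) (long_avg T) b + 10 * real H / real T)
      + (real H / real M)\<^sup>2 * ?E b" by simp
    then show "?L b \<le> ?R b" using assms(5) by (intro add_left_mono mult_left_mono) auto
  qed
  also have "fejers js (2 * H) ?R b = 2 * \<eta> + (2 / \<eta>) * (fejers js (2 * H) (fejer m M (long_avg T)) b
      - fejers js (2 * H) (fejer m (2 * M) (long_avg T)) b + 10 * real H / real T + (real H / real M)\<^sup>2 * fejers js (2 * H) ?E b)"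
    using H by (simp only: fejers_add fejers_cmult fejers_diff fejers_const)
  finally have 1: "flats js H (osc_avg M H) (twist m g b) \<le> 4 ^ length js * (2 * \<eta> + (2 / \<eta>) * (fejers js (2 * H) (fejer m M (long_avg T)) b
      - fejers js (2 * H) (fejer m (2 * M) (long_avg T)) b + 10 * real H / real T + (real H / real M)\<^sup>2 * fejers js (2 * H) ?E b))"
    by simp
  have "fejers js (2 * H) ?E b \<le> flats js (2 * H) ?E b"
    by (intro fejers_le_flats assms sum_nonneg flat_nonneg osc_avg_nonneg) (use H in auto)
  also have "flats js (2 * H) ?E b = (\<Sum>a<c. flats js (2 * H) (flat m H (osc_avg (2 ^ a * (2 * H)) H)) b)"
    by (rule flats_sum) simp
  finally show ?thesis using assms(5)
    by (intro order_trans[OF 1] mult_left_mono add_left_mono) auto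
qed

text \<open>On the left only the scale of direction \<open>m\<close> doubles, which does not
  telescope. On the right all scales double. Each outer direction costs an edge error
  \<open>10 * (2 * H) / T\<close> by almost monotonicity; doubling the long window costs an
  oscillation at scale \<open>T\<close> and an edge error \<open>3 * (2 * M) / T\<close>.\<close>

lemma fejers_energy_decrement:
  assumes "admissible b" "M > 0" "2 * M \<le> H"
  shows "fejers js (2 * H) (fejer m M (long_avg T)) b - fejers js (2 * H) (fejer m (2 * M) (long_avg T)) b
    \<le> fejers js (2 * H) (fejer m M (long_avg T)) b - fejers js (2 * (2 * H)) (fejer m (2 * M) (long_avg (2 * T))) b
      + real (length js) * (20 * real H / real T) + 3 * real H / real T
      + flats js (4 * H) (flat m (2 * M) (osc_avg T (2 * M))) b"
proof -
  have H: "H > 0" using assms by simp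
  have "fejers js (2 * (2 * H)) (fejer m (2 * M) (long_avg T)) b
     \<le> fejers js (2 * H) (fejer m (2 * M) (long_avg T)) b + real (length js) * (20 * real H / real T)"
    using fejers_almost_decreasing[of "2 * H" "fejer m (2 * M) (long_avg T)" "20 * real H / real T" b js]
      fejer_fejer_long_avg_almost_decreasing[of _ "2 * H" "2 * M" _ m T] assms H by simp
  moreover have "fejers js (2 * (2 * H)) (fejer m (2 * M) (long_avg (2 * T))) b - fejers js (2 * (2 * H)) (fejer m (2 * M) (long_avg T)) b
     \<le> flats js (4 * H) (flat m (2 * M) (osc_avg T (2 * M))) b + 3 * real H / real T"
  proof -
    have "fejers js (4 * H) (fejer m (2 * M) (long_avg (2 * T))) b
        \<le> fejers js (4 * H) (\<lambda>b. fejer m (2 * M) (long_avg T) b + (flat m (2 * M) (osc_avg T (2 * M)) b + 3 * real H / real T)) b"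
    proof (intro fejers_mono assms(1))
      fix b assume b: "admissible b"
      have "fejer m (2 * M) (long_avg (2 * T)) b \<le> fejer m (2 * M) (\<lambda>b. long_avg T b + (osc_avg T (2 * M) b + 3 * real H / real T)) b"
      proof (intro fejer_mono b)
        fix b assume b: "admissible b"
        have "3 * real (2 * M) / real T \<le> 3 * real H / real T"
          using assms by (intro divide_right_mono) auto
        then show "long_avg (2 * T) b \<le> long_avg T b + (osc_avg T (2 * M) b + 3 * real H / real T)"
          using long_avg_double_le[OF b, of "2 * M" T] assms(2) by (simp add: abs_le_iff)
      qed
      also have "\<dots> = fejer m (2 * M) (long_avg T) b + (fejer m (2 * M) (osc_avg T (2 * M)) b + 3 * real H / real T)"
        using assms(2) by (simp only: fejer_add fejer_const)
      also have "fejer m (2 * M) (osc_avg T (2 * M)) b \<le> flat m (2 * M) (osc_avg T (2 * M)) b"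
        using assms(2) by (intro fejer_le_flat b osc_avg_nonneg) auto
      finally show "fejer m (2 * M) (long_avg (2 * T)) b
        \<le> fejer m (2 * M) (long_avg T) b + (flat m (2 * M) (osc_avg T (2 * M)) b + 3 * real H / real T)" by simp
    qed
    also have "\<dots> = fejers js (4 * H) (fejer m (2 * M) (long_avg T)) b
        + (fejers js (4 * H) (flat m (2 * M) (osc_avg T (2 * M))) b + 3 * real H / real T)"
      using H by (simp only: fejers_add fejers_const)
    also have "fejers js (4 * H) (flat m (2 * M) (osc_avg T (2 * M))) b \<le> flats js (4 * H) (flat m (2 * M) (osc_avg T (2 * M))) b"
      using H by (intro fejers_le_flats flat_nonneg osc_avg_nonneg assms) auto
    finally show ?thesis by simp
  qed
  ultimately show ?thesis by linarith
qed

text \<open>Brings all ranges to the common size \<open>H\<close>, so that direction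
  \<open>m\<close> can join the list: one factor \<open>H / K\<close> comes from the steps in
  direction \<open>m\<close>, the other from the starting points in \<open>osc_avg\<close>.\<close>

lemma flats_flat_osc_avg_enlarge:
  assumes "admissible b" "K > 0" "K \<le> H"
  shows "flats js H (flat m K (osc_avg T K)) b \<le> (real H / real K)\<^sup>2 * flats (js @ [m]) H (osc_avg T H) b"
proof -
  have "flats js H (flat m K (osc_avg T K)) b \<le> flats js H (\<lambda>b. (real H / real K)\<^sup>2 * flat m H (osc_avg T H) b) b"
    using flats_osc_avg_enlarge[of _ K H "[m]" T] assms by (intro flats_mono) (auto simp: power2_eq_square)
  then show ?thesis by (simp add: flats_cmult flats_snoc)
qed

text \<open>A translation in \<open>x\<close> removes \<open>t\<close> from the slice of a single
  function, so nothing oscillates, and doubling yields a function of the same shape. This is the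
  base of the induction.\<close>

lemma flats_osc_avg_const:
  assumes "admissible1 g"
  shows "flats js H (osc_avg M H) (\<lambda>x t. g (x + m * t)) = 0"
  using assms
proof (induction js arbitrary: g)
  case Nil
  have "slice (\<lambda>x t. g (x + m * t)) s = mean g" for s
    using mean_shift[of g "m * s"] Nil by (simp add: slice_def admissible1_def)
  then have "slice (\<lambda>x t. g (x + m * t)) = (\<lambda>s. mean g)" by blast
  moreover have "avg M (\<lambda>s. c) s - avg (2 * M) (\<lambda>s. c) s = 0" for c s
    by (simp add: avg_def)
  ultimately show ?case by (simp add: osc_avg_def)
next
  case (Cons j js)
  have "cross j h (\<lambda>x t. g (x + m * t)) = (\<lambda>x t. (\<lambda>y. g y * g (y + (m - j) * h)) (x + m * t))" for h
    by (simp add: cross_def fun_eq_iff algebra_simps)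
  then have "flats js H (osc_avg M H) (cross j h (\<lambda>x t. g (x + m * t))) = 0" for h
    using Cons.IH[OF admissible1_mult_shift[OF Cons.prems]] by simp
  then show ?case by (simp add: flat_def)
qed

lemma fejers_long_avg_bound:
  assumes "admissible b" "H > 0" "M > 0"
  shows "\<bar>fejers js H (fejer m M (long_avg T)) b\<bar> \<le> 1"
proof -
  have L: "-1 \<le> long_avg T b \<and> long_avg T b \<le> 1" if "admissible b" for b
    using avg_bound[of "slice b" 1 T 0] abs_slice_le[OF that] by (simp add: long_avg_def abs_le_iff)
  have "fejer m M (long_avg T) b \<le> 1 \<and> -1 \<le> fejer m M (long_avg T) b" if "admissible b" for b
    using fejer_mono[of "long_avg T" "\<lambda>b. 1", OF _ that, of m M] fejer_mono[of "\<lambda>b. -1" "long_avg T", OF _ that, of m M]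
      L assms(3) by (simp add: fejer_const)
  then show ?thesis
    using fejers_mono[of "fejer m M (long_avg T)" "\<lambda>b. 1", OF _ assms(1), of js H]
      fejers_mono[of "\<lambda>b. -1" "fejer m M (long_avg T)", OF _ assms(1), of js H] assms(2)
    by (simp add: fejers_const)
qed

end

section \<open>Quantities that are small at most scales\<close>

text \<open>The second argument of \<open>a\<close> is the logarithm of the scale; all bounds are uniform over \<open>d \<in> A\<close>.\<close>

definition small_on :: "'d set \<Rightarrow> ('d \<Rightarrow> nat \<Rightarrow> real) \<Rightarrow> bool" where
  "small_on A a \<longleftrightarrow> (\<forall>e>0. \<exists>L0. \<forall>d\<in>A. \<forall>n0. \<forall>L\<ge>L0. (\<Sum>n=n0..<n0+L. a d n) \<le> e * real L)"

lemma small_onD: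
  assumes "small_on A a" "e > 0"
  obtains L0 where "\<And>d n0 L. d \<in> A \<Longrightarrow> L \<ge> L0 \<Longrightarrow> (\<Sum>n=n0..<n0+L. a d n) \<le> e * real L"
  using assms unfolding small_on_def by metis

lemma small_on_add:
  assumes "small_on A a" "small_on A b"
  shows "small_on A (\<lambda>d n. a d n + b d n)"
  unfolding small_on_def
proof (intro allI impI)
  fix e :: real assume "e > 0"
  then have e: "e / 2 > 0" by simp
  from small_onD[OF assms(1) e] obtain L1
    where 1: "\<And>d n0 L. d \<in> A \<Longrightarrow> L \<ge> L1 \<Longrightarrow> (\<Sum>n=n0..<n0+L. a d n) \<le> e / 2 * real L" by blast
  from small_onD[OF assms(2) e] obtain L2
    where 2: "\<And>d n0 L. d \<in> A \<Longrightarrow> L \<ge> L2 \<Longrightarrow> (\<Sum>n=n0..<n0+L. b d n) \<le> e / 2 * real L" by blast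
  show "\<exists>L0. \<forall>d\<in>A. \<forall>n0. \<forall>L\<ge>L0. (\<Sum>n=n0..<n0+L. a d n + b d n) \<le> e * real L"
  proof (rule exI[of _ "max L1 L2"], intro ballI allI impI)
    fix d n0 L assume "d \<in> A" "max L1 L2 \<le> L"
    then show "(\<Sum>n=n0..<n0+L. a d n + b d n) \<le> e * real L"
      using 1[of d L n0] 2[of d L n0] by (simp add: sum.distrib)
  qed
qed

lemma small_on_cmult:
  assumes "small_on A a" "c \<ge> 0"
  shows "small_on A (\<lambda>d n. c * a d n)"
  unfolding small_on_def
proof (intro allI impI)
  fix e :: real assume e: "e > 0"
  then have "e / (c + 1) > 0" using assms(2) by simp
  from small_onD[OF assms(1) this] obtain L1
    where 1: "\<And>d n0 L. d \<in> A \<Longrightarrow> L \<ge> L1 \<Longrightarrow> (\<Sum>n=n0..<n0+L. a d n) \<le> e / (c + 1) * real L" by blast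
  have "c * (e / (c + 1)) \<le> e" using e assms(2) by (simp add: field_simps)
  then have le: "c * (e / (c + 1) * real L) \<le> e * real L" for L
    by (metis mult.assoc mult_right_mono of_nat_0_le_iff)
  show "\<exists>L0. \<forall>d\<in>A. \<forall>n0. \<forall>L\<ge>L0. (\<Sum>n=n0..<n0+L. c * a d n) \<le> e * real L"
    unfolding sum_distrib_left[symmetric]
    using 1 le assms(2) by (meson mult_left_mono order_trans)
qed

lemma small_on_zero: "small_on A (\<lambda>d n. 0)"
  by (simp add: small_on_def)

lemma small_on_sum:
  assumes "\<And>i. i \<in> I \<Longrightarrow> small_on A (a i)"
  shows "small_on A (\<lambda>d n. \<Sum>i\<in>I. a i d n)"
  using assms by (induction I rule: infinite_finite_induct) (auto intro: small_on_zero small_on_add)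

lemma small_on_shift:
  assumes "small_on A a"
  shows "small_on A (\<lambda>d n. a d (n + i))"
proof -
  have sh: "(\<Sum>n=n0..<n0+L. a d (n + i)) = (\<Sum>n=(n0+i)..<(n0+i)+L. a d n)" for d n0 L
    using sum.shift_bounds_nat_ivl[of "a d" n0 i "n0 + L"] by (simp add: add_ac)
  show ?thesis using assms unfolding small_on_def sh by blast
qed

lemma small_on_mono:
  assumes "small_on A a" "\<And>d n. d \<in> A \<Longrightarrow> b d n \<le> a d n"
  shows "small_on A b"
proof -
  have "(\<Sum>n=n0..<n0+L. b d n) \<le> (\<Sum>n=n0..<n0+L. a d n)" if "d \<in> A" for d n0 L
    by (intro sum_mono assms(2) that)
  then show ?thesis using assms(1) unfolding small_on_def by (meson order_trans)
qed

text \<open>The majorant may depend on \<open>e\<close>. Auxiliary parameters can thus be fixed in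
  terms of \<open>e\<close> before the sum over scales is taken.\<close>

lemma small_on_approx:
  assumes "\<And>e. e > 0 \<Longrightarrow> \<exists>a. small_on A a \<and> (\<forall>d\<in>A. \<forall>n. b d n \<le> a d n + e)"
  shows "small_on A b"
  unfolding small_on_def
proof (intro allI impI)
  fix e :: real assume e: "e > 0"
  then obtain a where a: "small_on A a" "\<And>d n. d \<in> A \<Longrightarrow> b d n \<le> a d n + e / 2"
    using assms[of "e / 2"] by auto
  from small_onD[OF a(1), of "e / 2"] e obtain L1
    where 1: "\<And>d n0 L. d \<in> A \<Longrightarrow> L \<ge> L1 \<Longrightarrow> (\<Sum>n=n0..<n0+L. a d n) \<le> e / 2 * real L"
    by (metis half_gt_zero)
  show "\<exists>L0. \<forall>d\<in>A. \<forall>n0. \<forall>L\<ge>L0. (\<Sum>n=n0..<n0+L. b d n) \<le> e * real L"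
  proof (rule exI[of _ L1], intro ballI allI impI)
    fix d n0 L assume dL: "d \<in> A" "L1 \<le> L"
    have "(\<Sum>n=n0..<n0+L. b d n) \<le> (\<Sum>n=n0..<n0+L. a d n + e / 2)"
      by (intro sum_mono a(2) dL)
    also have "\<dots> = (\<Sum>n=n0..<n0+L. a d n) + e / 2 * real L" by (simp add: sum.distrib)
    also have "\<dots> \<le> e * real L" using 1[OF dL, of n0] by simp
    finally show "(\<Sum>n=n0..<n0+L. b d n) \<le> e * real L" .
  qed
qed

text \<open>The total is at most 2 for any number of scales. Bounded energies enter the argument
  only through this fact.\<close>

lemma small_on_telescope:
  assumes "\<And>d n. d \<in> A \<Longrightarrow> \<bar>\<Psi> d n\<bar> \<le> (1::real)"
  shows "small_on A (\<lambda>d n. \<Psi> d n - \<Psi> d (Suc n))"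
  unfolding small_on_def
proof (intro allI impI)
  fix e :: real assume e: "e > 0"
  show "\<exists>L0. \<forall>d\<in>A. \<forall>n0. \<forall>L\<ge>L0. (\<Sum>n=n0..<n0+L. \<Psi> d n - \<Psi> d (Suc n)) \<le> e * real L"
  proof (rule exI[of _ "nat \<lceil>2 / e\<rceil>"], intro ballI allI impI)
    fix d n0 L assume d: "d \<in> A" "nat \<lceil>2 / e\<rceil> \<le> L"
    then have "2 / e \<le> real L" by linarith
    then have "2 \<le> e * real L" using e by (simp add: field_simps)
    moreover have "(\<Sum>n=n0..<n0+L. \<Psi> d n - \<Psi> d (Suc n)) = \<Psi> d n0 - \<Psi> d (n0 + L)"
      by (induction L) auto
    ultimately show "(\<Sum>n=n0..<n0+L. \<Psi> d n - \<Psi> d (Suc n)) \<le> e * real L"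
      using assms[OF d(1), of n0] assms[OF d(1), of "n0 + L"] by (simp add: abs_le_iff)
  qed
qed

section \<open>Induction on the number of remaining functions\<close>

definition line_prod :: "(nat \<Rightarrow> int \<Rightarrow> real) \<Rightarrow> nat \<Rightarrow> nat \<Rightarrow> int \<Rightarrow> int \<Rightarrow> real" where
  "line_prod f m k = (\<lambda>x t. \<Prod>i=m..k. f i (x + int i * t))"

context periodic_mean
begin

lemma line_prod_twist: "m < k \<Longrightarrow> line_prod f m k = twist (int m) (f m) (line_prod f (Suc m) k)"
  by (simp add: line_prod_def twist_def fun_eq_iff prod.atLeast_Suc_atMost)

lemma admissible_line_prod:
  assumes "\<And>i. i \<le> k \<Longrightarrow> admissible1 (f i)" "m \<le> k"
  shows "admissible (line_prod f m k)"
  using assms(2)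
proof (induction rule: inc_induct)
  case base
  show ?case using assms(1)[of k] admissible1_shift by (simp add: admissible_def line_prod_def)
next
  case (step n)
  then show ?case using assms(1)[of n] by (simp add: line_prod_twist admissible_twist)
qed

text \<open>The functions with index below \<open>m\<close> are gone; each has left one doubling in
  the direction in which it was constant.\<close>

definition box_osc :: "nat \<Rightarrow> nat \<Rightarrow> (nat \<Rightarrow> int \<Rightarrow> real) \<Rightarrow> nat \<Rightarrow> nat \<Rightarrow> real" where
  "box_osc m k f K H = flats (map int [0..<m]) H (osc_avg K H) (line_prod f m k)"

lemma box_osc_enlarge:
  assumes "\<And>i. i \<le> k \<Longrightarrow> admissible1 (f i)" "m \<le> k" "H > 0" "H \<le> H'"
  shows "box_osc m k f K H \<le> (real H' / real H) ^ Suc m * box_osc m k f K H'"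
  using flats_osc_avg_enlarge[where js = "map int [0..<m]" and K = K, OF admissible_line_prod[OF assms(1,2)] assms(3,4)]
  by (simp add: box_osc_def)

lemma box_osc_last:
  assumes "\<And>i. i \<le> k \<Longrightarrow> admissible1 (f i)"
  shows "box_osc k k f K H = 0"
  using flats_osc_avg_const[OF assms[OF order_refl], of "map int [0..<k]" H K "int k"]
  by (simp add: box_osc_def line_prod_def)

text \<open>The scales of direction \<open>m\<close>, of the earlier directions and of the window in
  \<open>t\<close> have fixed ratios, so that passing from \<open>n\<close> to \<open>Suc n\<close>
  doubles all of them.\<close>

definition energy :: "nat \<Rightarrow> nat \<Rightarrow> (nat \<Rightarrow> int \<Rightarrow> real) \<Rightarrow> nat \<Rightarrow> nat \<Rightarrow> nat \<Rightarrow> real" where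
  "energy m k f q c n = fejers (map int [0..<m]) (2 * 2 ^ (n + q))
     (fejer (int m) (2 ^ n) (long_avg (2 ^ (n + q + 1 + c)))) (line_prod f (Suc m) k)"

text \<open>Here \<open>2 ^ c\<close> is the ratio of the long window to \<open>2 * H\<close>: a
  larger \<open>c\<close> shrinks the edge errors, at the price of more window changes. The errors
  \<open>10\<close>, \<open>3\<close> and \<open>20 * m\<close>, in units of \<open>H / T\<close>,
  make up the constant. The condition on \<open>q\<close> ensures \<open>2 * M <= H\<close>.\<close>

lemma box_osc_step:
  assumes f: "\<And>i. i \<le> k \<Longrightarrow> admissible1 (f i)" and mk: "m < k" and q: "q \<ge> 1" and \<eta>: "\<eta> > 0"
  shows "box_osc m k f (2 ^ n) (2 ^ (n + q)) \<le> 4 ^ m * (2 * \<eta> + (2 / \<eta>) *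
    (energy m k f q c n - energy m k f q c (Suc n) + (13 + 20 * real m) / 2 ^ c
     + (2 ^ q)\<^sup>2 * (\<Sum>a<c. 4 * box_osc (Suc m) k f (2 ^ (n + (q + 1 + a))) (2 ^ (n + (q + 1))))
     + (2 ^ (q + 1))\<^sup>2 * box_osc (Suc m) k f (2 ^ (n + (q + 1 + c))) (2 ^ (n + (q + 2)))))"
proof -
  let ?js = "map int [0..<m]"
  let ?b = "line_prod f (Suc m) k"
  define M :: nat where "M = 2 ^ n"
  define H :: nat where "H = 2 ^ (n + q)"
  define T :: nat where "T = 2 ^ (n + q + 1 + c)"
  have T: "T = 2 ^ c * (2 * H)" by (simp add: T_def H_def power_add)
  have M: "M > 0" by (simp add: M_def)
  have HM: "real H / real M = 2 ^ q" by (simp add: H_def M_def power_add)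
  have MH: "2 * M \<le> H" using q
    by (auto simp: M_def H_def power_add intro: self_le_power[of 2 q])
  have H: "H > 0" by (simp add: H_def)
  have b: "admissible ?b" using f mk by (intro admissible_line_prod) auto
  have HT: "real H / real T = 1 / (2 * 2 ^ c)" using H by (simp add: T field_simps)
  have s1: "flats ?js (2 * H) (flat (int m) H (osc_avg K H)) ?b \<le> 4 * box_osc (Suc m) k f K (2 * H)" for K
    using flats_flat_osc_avg_enlarge[OF b H, of "2 * H" ?js "int m" K] H
    by (simp add: box_osc_def power2_eq_square)
  have s2: "flats ?js (4 * H) (flat (int m) (2 * M) (osc_avg T (2 * M))) ?b \<le> (2 ^ (q + 1))\<^sup>2 * box_osc (Suc m) k f T (4 * H)"
  proof -
    have "real (4 * H) / real (2 * M) = 2 ^ (q + 1)" using HM by simp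
    then show ?thesis
      using flats_flat_osc_avg_enlarge[OF b, of "2 * M" "4 * H" ?js "int m" T] M MH by (simp add: box_osc_def)
  qed
  have e1: "energy m k f q c n = fejers ?js (2 * H) (fejer (int m) M (long_avg T)) ?b"
    by (simp add: energy_def H_def M_def T_def)
  have e2: "energy m k f q c (Suc n) = fejers ?js (2 * (2 * H)) (fejer (int m) (2 * M) (long_avg (2 * T))) ?b"
    by (simp add: energy_def H_def M_def T_def)
  have "box_osc m k f M H \<le> 4 ^ length ?js * (2 * \<eta> + (2 / \<eta>) *
    (fejers ?js (2 * H) (fejer (int m) M (long_avg T)) ?b - fejers ?js (2 * H) (fejer (int m) (2 * M) (long_avg T)) ?b + 10 * real H / real T
     + (real H / real M)\<^sup>2 * (\<Sum>a<c. flats ?js (2 * H) (flat (int m) H (osc_avg (2 ^ a * (2 * H)) H)) ?b)))"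
    unfolding box_osc_def line_prod_twist[OF mk]
    using f mk by (intro flats_osc_avg_twist_le b M MH \<eta> T) auto
  also have "\<dots> \<le> 4 ^ length ?js * (2 * \<eta> + (2 / \<eta>) *
    (energy m k f q c n - energy m k f q c (Suc n) + (13 + 20 * real m) / 2 ^ c
     + (real H / real M)\<^sup>2 * (\<Sum>a<c. 4 * box_osc (Suc m) k f (2 ^ a * (2 * H)) (2 * H))
     + (2 ^ (q + 1))\<^sup>2 * box_osc (Suc m) k f T (4 * H)))"
  proof -
    have "fejers ?js (2 * H) (fejer (int m) M (long_avg T)) ?b - fejers ?js (2 * H) (fejer (int m) (2 * M) (long_avg T)) ?b
        \<le> energy m k f q c n - energy m k f q c (Suc n) + real m * (20 * (real H / real T)) + 3 * (real H / real T)
          + (2 ^ (q + 1))\<^sup>2 * box_osc (Suc m) k f T (4 * H)"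
      using fejers_energy_decrement[OF b M MH, of ?js "int m" T] s2 unfolding e1 e2 by simp
    moreover have "real m * (20 * (real H / real T)) + 3 * (real H / real T) + 10 * real H / real T
        \<le> (13 + 20 * real m) / 2 ^ c"
    proof -
      have "real m * (20 * (real H / real T)) + 3 * (real H / real T) + 10 * real H / real T
          = (13 + 20 * real m) * (real H / real T)" by (simp add: algebra_simps add_divide_distrib)
      also have "\<dots> \<le> (13 + 20 * real m) * (1 / 2 ^ c)"
        unfolding HT by (intro mult_left_mono) (auto simp: field_simps)
      finally show ?thesis by simp
    qed
    moreover have "(real H / real M)\<^sup>2 * (\<Sum>a<c. flats ?js (2 * H) (flat (int m) H (osc_avg (2 ^ a * (2 * H)) H)) ?b)
        \<le> (real H / real M)\<^sup>2 * (\<Sum>a<c. 4 * box_osc (Suc m) k f (2 ^ a * (2 * H)) (2 * H))"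
      by (intro mult_left_mono sum_mono s1) auto
    ultimately show ?thesis using \<eta> by (intro mult_left_mono add_left_mono) auto
  qed
  finally show ?thesis
    by (simp add: HM M_def H_def T_def power_add mult_ac)
qed

lemma energy_bound:
  assumes f: "\<And>i. i \<le> k \<Longrightarrow> admissible1 (f i)" and mk: "m < k"
  shows "\<bar>energy m k f q c n\<bar> \<le> 1"
  unfolding energy_def using f mk by (intro fejers_long_avg_bound admissible_line_prod) auto

end

text \<open>Cycle, normalisation and functions together form the index, so that smallness over this
  set is uniform in all three.\<close>

definition systems :: "nat \<Rightarrow> (int \<times> real \<times> (nat \<Rightarrow> int \<Rightarrow> real)) set" where
  "systems k = {(P, S, f). periodic_mean P S \<and> (\<forall>i\<le>k. periodic_mean.admissible1 P S (f i))}"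

abbreviation sys_box_osc :: "nat \<Rightarrow> nat \<Rightarrow> int \<times> real \<times> (nat \<Rightarrow> int \<Rightarrow> real) \<Rightarrow> nat \<Rightarrow> nat \<Rightarrow> real" where
  "sys_box_osc m k d \<equiv> periodic_mean.box_osc (fst d) (fst (snd d)) m k (snd (snd d))"

lemma systemsD:
  assumes "d \<in> systems k"
  shows "periodic_mean (fst d) (fst (snd d))"
    "\<And>i. i \<le> k \<Longrightarrow> periodic_mean.admissible1 (fst d) (fst (snd d)) (snd (snd d) i)"
  using assms by (auto simp: systems_def)

text \<open>The step produces windows longer than \<open>2 ^ n\<close> by a fixed factor
  \<open>2 ^ i\<close>. Taking the window as the new reference scale means widening the ranges by
  \<open>2 ^ i\<close>, which costs a constant independent of the scale.\<close>

lemma small_on_box_osc_rescale: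
  assumes "\<And>q. small_on (systems k) (\<lambda>d n. sys_box_osc m k d (2 ^ n) (2 ^ (n + q)))" "m \<le> k"
  shows "small_on (systems k) (\<lambda>d n. sys_box_osc m k d (2 ^ (n + i)) (2 ^ (n + q)))"
proof (rule small_on_mono)
  show "small_on (systems k) (\<lambda>d n. (2 ^ i) ^ Suc m * sys_box_osc m k d (2 ^ (n + i)) (2 ^ (n + i + q)))"
    by (intro small_on_cmult small_on_shift[of "systems k" "\<lambda>d n. sys_box_osc m k d (2 ^ n) (2 ^ (n + q))"] assms(1)) auto
next
  fix d n assume d: "d \<in> systems k"
  interpret periodic_mean "fst d" "fst (snd d)" by (rule systemsD[OF d])
  have "real (2 ^ (n + i + q)) / real (2 ^ (n + q)) = 2 ^ i"
    by (simp add: power_add)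
  moreover have "(2::nat) ^ (n + q) \<le> 2 ^ (n + i + q)" by (rule power_increasing) auto
  ultimately show "box_osc m k (snd (snd d)) (2 ^ (n + i)) (2 ^ (n + q))
      \<le> (2 ^ i) ^ Suc m * box_osc m k (snd (snd d)) (2 ^ (n + i)) (2 ^ (n + i + q))"
    using box_osc_enlarge[where H = "2 ^ (n + q)" and H' = "2 ^ (n + i + q)" and K = "2 ^ (n + i)", OF systemsD(2)[OF d] assms(2)] by simp
qed

text \<open>Downward in \<open>m\<close>. First \<eta> is chosen from \<open>e\<close>, then
  \<open>c\<close> from \<eta>; neither depends on the scale or the system. The forms with one
  function less then carry constant coefficients, and the energy differences telescope.\<close>

lemma small_on_box_osc:
  assumes "m \<le> k"
  shows "small_on (systems k) (\<lambda>d n. sys_box_osc m k d (2 ^ n) (2 ^ (n + q)))"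
  using assms
proof (induction m arbitrary: q rule: inc_induct)
  case base
  show ?case
    by (rule small_on_mono[OF small_on_zero])
      (metis order_refl periodic_mean.box_osc_last systemsD)
next
  case (step m)
  have main: "small_on (systems k) (\<lambda>d n. sys_box_osc m k d (2 ^ n) (2 ^ (n + q)))" if q: "q \<ge> 1" for q
  proof (rule small_on_approx)
    fix e :: real assume e: "e > 0"
    \<comment> \<open>Makes the term \<open>4 ^ m * (2 * \<eta>)\<close> equal to
      \<open>e / 2\<close>; the edge errors, \<open>W / 2 ^ c\<close> in all, get the other
      half.\<close>
    define \<eta> where "\<eta> = e / (4 * 4 ^ m)"
    have \<eta>: "\<eta> > 0" using e by (simp add: \<eta>_def)
    define W where "W = 4 ^ m * (2 / \<eta>) * (13 + 20 * real m)"
    obtain c :: nat where c: "2 * W / e < 2 ^ c" using real_arch_pow[of 2 "2 * W / e"] by auto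
    let ?a = "\<lambda>d n. 4 ^ m * (2 / \<eta>) * (
      (periodic_mean.energy (fst d) (fst (snd d)) m k (snd (snd d)) q c n
        - periodic_mean.energy (fst d) (fst (snd d)) m k (snd (snd d)) q c (Suc n))
      + (2 ^ q)\<^sup>2 * (\<Sum>a<c. 4 * sys_box_osc (Suc m) k d (2 ^ (n + (q + 1 + a))) (2 ^ (n + (q + 1))))
      + (2 ^ (q + 1))\<^sup>2 * sys_box_osc (Suc m) k d (2 ^ (n + (q + 1 + c))) (2 ^ (n + (q + 2))))"
    have "small_on (systems k) ?a"
      using \<eta> step
      by (intro small_on_cmult small_on_add small_on_sum small_on_telescope small_on_box_osc_rescale)
        (auto intro!: periodic_mean.energy_bound dest: systemsD)
    moreover have "sys_box_osc m k d (2 ^ n) (2 ^ (n + q)) \<le> ?a d n + e" if d: "d \<in> systems k" for d n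
    proof -
      interpret periodic_mean "fst d" "fst (snd d)" by (rule systemsD[OF d])
      have "4 ^ m * (2 / \<eta>) * ((13 + 20 * real m) / 2 ^ c) \<le> e / 2"
      proof -
        have "2 * W < 2 ^ c * e" using c e by (simp add: pos_divide_less_eq)
        then have "W / 2 ^ c \<le> e / 2" by (simp add: field_simps)
        then show ?thesis by (simp add: W_def)
      qed
      moreover have "4 ^ m * (2 * \<eta>) \<le> e / 2" using e by (simp add: \<eta>_def)
      moreover have "sys_box_osc m k d (2 ^ n) (2 ^ (n + q))
          \<le> 4 ^ m * (2 * \<eta>) + 4 ^ m * (2 / \<eta>) * ((13 + 20 * real m) / 2 ^ c) + ?a d n"
        using box_osc_step[where n = n and c = c, OF systemsD(2)[OF d] step.hyps(2) q \<eta>] by (simp only: algebra_simps)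
      ultimately show ?thesis by linarith
    qed
    ultimately show "\<exists>a. small_on (systems k) a \<and>
        (\<forall>d\<in>systems k. \<forall>n. sys_box_osc m k d (2 ^ n) (2 ^ (n + q)) \<le> a d n + e)"
      by blast
  qed
  \<comment> \<open>Widening the ranges by a factor 2 replaces \<open>q\<close> by
    \<open>Suc q\<close>, so that \<open>q = 0\<close> is covered too.\<close>
  show ?case
  proof (rule small_on_mono)
    show "small_on (systems k) (\<lambda>d n. 2 ^ Suc m * sys_box_osc m k d (2 ^ n) (2 ^ (n + Suc q)))"
      by (intro small_on_cmult main) auto
  next
    fix d n assume d: "d \<in> systems k"
    interpret periodic_mean "fst d" "fst (snd d)" by (rule systemsD[OF d])
    show "sys_box_osc m k d (2 ^ n) (2 ^ (n + q)) \<le> 2 ^ Suc m * sys_box_osc m k d (2 ^ n) (2 ^ (n + Suc q))"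
      using box_osc_enlarge[where m = m and H = "2 ^ (n + q)" and H' = "2 ^ (n + Suc q)" and K = "2 ^ n", OF systemsD(2)[OF d]] step.hyps by simp
  qed
qed

section \<open>From dyadic scales to sums against the odd kernel\<close>

lemma small_on_unshift:
  assumes "small_on A a" "\<And>d n. d \<in> A \<Longrightarrow> b d (n + c) \<le> a d n" "\<And>d n. d \<in> A \<Longrightarrow> b d n \<le> v"
    and v: "v \<ge> 0"
  shows "small_on A b"
  unfolding small_on_def
proof (intro allI impI)
  fix e :: real assume e: "e > 0"
  from small_onD[OF assms(1), of "e / 2"] e obtain L1
    where 1: "\<And>d n0 L. d \<in> A \<Longrightarrow> L \<ge> L1 \<Longrightarrow> (\<Sum>n=n0..<n0+L. a d n) \<le> e / 2 * real L"
    by (metis half_gt_zero)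
  \<comment> \<open>The first \<open>c\<close> scales have only the trivial bound
    \<open>c * v\<close>; the last summand makes this at most \<open>e / 2 * L\<close>.\<close>
  define L0 where "L0 = L1 + c + nat \<lceil>2 * (real c * v) / e\<rceil>"
  have "(\<Sum>n=n0..<n0+L. b d n) \<le> e * real L" if d: "d \<in> A" and L: "L \<ge> L0" for d n0 L
  proof -
    have "2 * (real c * v) / e \<le> real L" using L unfolding L0_def by linarith
    then have cv: "real c * v \<le> e / 2 * real L" using e by (simp add: field_simps)
    have Lc: "c \<le> L" "L1 \<le> L - c" using L by (auto simp: L0_def)
    have "(\<Sum>n=n0..<n0+L. b d n) = (\<Sum>n=n0..<n0+c. b d n) + (\<Sum>n=n0+c..<n0+L. b d n)"
      using Lc by (subst sum.atLeastLessThan_concat) auto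
    also have "(\<Sum>n=n0..<n0+c. b d n) \<le> (\<Sum>n=n0..<n0+c. v)"
      by (intro sum_mono assms(3) d)
    also have "(\<Sum>n=n0+c..<n0+L. b d n) = (\<Sum>n=n0..<n0+(L-c). b d (n + c))"
      using sum.shift_bounds_nat_ivl[of "b d" n0 c "n0 + (L - c)"] Lc by (simp add: add_ac)
    also have "\<dots> \<le> (\<Sum>n=n0..<n0+(L-c). a d n)"
      by (intro sum_mono assms(2) d)
    also have "\<dots> \<le> e / 2 * real (L - c)" by (intro 1 d Lc)
    also have "\<dots> \<le> e / 2 * real L" using e by (intro mult_left_mono) auto
    finally show ?thesis using cv by simp
  qed
  then show "\<exists>L0. \<forall>d\<in>A. \<forall>n0. \<forall>L\<ge>L0. (\<Sum>n=n0..<n0+L. b d n) \<le> e * real L" by blast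
qed

text \<open>Summation by parts with \<open>1 / t - 1 / (t + 1) = 1 / (t * (t + 1))\<close>. Partial
  sums divided by \<open>t\<close> are averages, so the main term is an average-valued sum with
  weight about \<open>1 / t\<close>.\<close>

lemma abel_summation_reciprocal:
  fixes c :: "nat \<Rightarrow> real"
  assumes "1 \<le> a" "a \<le> b"
  shows "(\<Sum>t=a..b. c t / real t) = (\<Sum>t=1..b. c t) / (real b + 1) - (\<Sum>t=1..a-1. c t) / real a
    + (\<Sum>t=a..b. (\<Sum>u=1..t. c u) / (real t * (real t + 1)))"
proof -
  have part: "s / (x + 1) + s / (x * (x + 1)) = s / x" if "x > 0" for s x :: real
  proof -
    have "s / x - s / (x + 1) = s / (x * (x + 1))" using that by (simp add: diff_frac_eq algebra_simps)
    then show ?thesis by simp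
  qed
  show ?thesis using assms(2)
  proof (induction rule: dec_induct)
    case base
    have "(\<Sum>u=1..a. c u) = (\<Sum>u=1..a-1. c u) + c a"
      using assms(1) by (cases a) auto
    then show ?case using assms(1) part[of "real a" "\<Sum>u=1..a. c u"] by (simp add: add_divide_distrib)
  next
    case (step n)
    have "(\<Sum>u=1..Suc n. c u) = (\<Sum>u=1..n. c u) + c (Suc n)" by simp
    then have "(\<Sum>u=1..Suc n. c u) / (real (Suc n) + 1) + (\<Sum>u=1..Suc n. c u) / (real (Suc n) * (real (Suc n) + 1))
        = (\<Sum>u=1..n. c u) / (real n + 1) + c (Suc n) / real (Suc n)"
      using part[of "real (Suc n)" "\<Sum>u=1..Suc n. c u"] by (simp add: add_divide_distrib add.commute)
    then show ?case using step by simp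
  qed
qed

lemma avg_telescope_doubling:
  "\<bar>avg M C s - avg (2 ^ e * M) C s\<bar> \<le> (\<Sum>a<e. \<bar>avg (2 ^ a * M) C s - avg (2 * (2 ^ a * M)) C s\<bar>)"
proof (induction e)
  case (Suc e)
  then show ?case by (simp add: mult.assoc)
qed simp

text \<open>Averages commute, so the difference is a mean of shifts by less than \<open>M\<close> of
  a window of length \<open>N\<close>.\<close>

lemma avg_avg_near:
  assumes "\<And>s. \<bar>C s\<bar> \<le> 1" "M > 0"
  shows "\<bar>avg N C s - avg N (avg M C) s\<bar> \<le> 2 * real M / real N"
proof -
  have "avg N (avg M C) s = avg M (avg N C) s" using avg_comm[of N M C s] by simp
  also have "avg N C s - avg M (avg N C) s = (\<Sum>t<M. avg N C s - avg N C (s + int t)) / real M"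
    using assms(2) by (simp add: avg_def[of M] sum_subtractf diff_divide_distrib)
  finally have eq: "avg N C s - avg N (avg M C) s = (\<Sum>t<M. avg N C s - avg N C (s + int t)) / real M" .
  have "\<bar>avg N C s - avg N C (s + int t)\<bar> \<le> 2 * real M / real N" if "t < M" for t
    by (rule order_trans[OF avg_shift[OF assms(1)] divide_right_mono]) (use that in auto)
  then have "\<bar>\<Sum>t<M. avg N C s - avg N C (s + int t)\<bar> \<le> (\<Sum>t<M. 2 * real M / real N)"
    by (intro order_trans[OF sum_abs] sum_mono) auto
  then show ?thesis unfolding eq using assms(2) by (simp add: field_simps)
qed

text \<open>The two starts give the windows \<open>1..N\<close> and \<open>-N..-1\<close>. Three
  comparisons lead to one common value: averaging first over \<open>M\<close>, doubling
  \<open>M\<close> up to \<open>2 ^ e * M\<close> at the cost of oscillations, and moving the then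
  very long windows to the origin. The last two are made at each point of the window, hence the sum
  over \<open>s\<close>.\<close>

lemma avg_near_const:
  assumes C: "\<And>s. \<bar>C s\<bar> \<le> 1" and "M > 0" "N > 0" "N < H" "s0 = 1 \<or> s0 = - int N"
  shows "\<bar>avg N C s0 - avg (2 ^ e * M) C 0\<bar> \<le> 2 * real M / real N + 2 * real H / (2 ^ e * real M)
    + (\<Sum>a<e. (\<Sum>s\<in>{- int H..<int H}. \<bar>avg (2 ^ a * M) C s - avg (2 * (2 ^ a * M)) C s\<bar>) / real N)"
proof -
  let ?M = "2 ^ e * M"
  let ?d = "\<lambda>a s. \<bar>avg (2 ^ a * M) C s - avg (2 * (2 ^ a * M)) C s\<bar>"
  have "avg N (avg M C) s0 - avg ?M C 0 = (\<Sum>t<N. avg M C (s0 + int t) - avg ?M C 0) / real N"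
    using assms(3) by (simp add: avg_def[of N] sum_subtractf diff_divide_distrib)
  also have "\<bar>\<dots>\<bar> \<le> (\<Sum>t<N. (\<Sum>a<e. ?d a (s0 + int t)) + 2 * real H / (2 ^ e * real M)) / real N"
    unfolding abs_divide
  proof (simp, intro divide_right_mono order_trans[OF sum_abs] sum_mono)
    fix t assume "t \<in> {..<N}"
    then have "\<bar>avg ?M C (s0 + int t) - avg ?M C 0\<bar> \<le> 2 * real H / real ?M"
      using assms by (intro order_trans[OF avg_shift[OF C] divide_right_mono]) auto
    then show "\<bar>avg M C (s0 + int t) - avg ?M C 0\<bar> \<le> (\<Sum>a<e. ?d a (s0 + int t)) + 2 * real H / (2 ^ e * real M)"
      using avg_telescope_doubling[of M C "s0 + int t" e] by simp
  qed simp
  also have "\<dots> = (\<Sum>a<e. (\<Sum>t<N. ?d a (s0 + int t)) / real N) + 2 * real H / (2 ^ e * real M)"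
    using assms(3) by (simp add: sum.distrib add_divide_distrib sum_divide_distrib[symmetric] sum.swap[of _ "{..<N}"])
  also have "(\<Sum>a<e. (\<Sum>t<N. ?d a (s0 + int t)) / real N) \<le> (\<Sum>a<e. (\<Sum>s\<in>{- int H..<int H}. ?d a s) / real N)"
  proof (intro sum_mono divide_right_mono)
    fix a
    have "(\<Sum>t<N. ?d a (s0 + int t)) = (\<Sum>s\<in>(\<lambda>t. s0 + int t) ` {..<N}. ?d a s)"
      by (subst sum.reindex) (auto simp: inj_on_def)
    also have "\<dots> \<le> (\<Sum>s\<in>{- int H..<int H}. ?d a s)"
      using assms by (intro sum_mono2) auto
    finally show "(\<Sum>t<N. ?d a (s0 + int t)) \<le> (\<Sum>s\<in>{- int H..<int H}. ?d a s)" .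
  qed simp
  finally show ?thesis using avg_avg_near[where C = C and N = N and s = s0, OF C assms(2)] by linarith
qed

definition odd_sum :: "(int \<Rightarrow> real) \<Rightarrow> nat \<Rightarrow> real" where
  "odd_sum C N = (\<Sum>t=1..N. C (int t) - C (- int t))"

lemma odd_sum_eq_avg:
  assumes "N > 0"
  shows "odd_sum C N / real N = avg N C 1 - avg N C (- int N)"
proof -
  have "(\<Sum>t=1..N. C (int t)) = (\<Sum>t<N. C (1 + int t))"
    by (rule sum.reindex_bij_witness[where i = Suc and j = "\<lambda>t. t - 1"]) auto
  moreover have "(\<Sum>t=1..N. C (- int t)) = (\<Sum>t<N. C (- int N + int t))"
    by (rule sum.reindex_bij_witness[where i = "\<lambda>t. N - t" and j = "\<lambda>t. N - t"]) auto
  ultimately show ?thesis by (simp add: odd_sum_def avg_def sum_subtractf diff_divide_distrib)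
qed

lemma odd_sum_bound:
  assumes "\<And>s. \<bar>C s\<bar> \<le> 1"
  shows "\<bar>odd_sum C N\<bar> \<le> 2 * real N"
proof -
  have "\<bar>C (int t) - C (- int t)\<bar> \<le> 2" for t
    using assms[of "int t"] assms[of "- int t"] by linarith
  then have "\<bar>odd_sum C N\<bar> \<le> (\<Sum>t=1..N. 2)"
    unfolding odd_sum_def by (intro order_trans[OF sum_abs] sum_mono)
  then show ?thesis by simp
qed

definition dyadic_block :: "(int \<Rightarrow> real) \<Rightarrow> nat \<Rightarrow> real" where
  "dyadic_block C j = (\<Sum>t\<in>{2^j..<2^Suc j}. \<bar>odd_sum C t\<bar> / (real t * (real t + 1)))"

lemma block_le:
  assumes "\<And>t. t \<in> {2^j..<2^Suc j} \<Longrightarrow> \<bar>odd_sum C t\<bar> / real t \<le> v"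
  shows "dyadic_block C j \<le> v"
proof -
  have v: "v \<ge> 0" using assms[of "2^j"] by (force intro: order_trans[rotated])
  have "dyadic_block C j \<le> (\<Sum>t\<in>{2^j..<2^Suc j::nat}. v / 2 ^ j)"
    unfolding dyadic_block_def
  proof (rule sum_mono)
    fix t :: nat assume t: "t \<in> {2^j..<2^Suc j}"
    then have "2 ^ j \<le> real t" by (simp add: numeral_power_le_of_nat_cancel_iff)
    have "(0::real) < 2 ^ j" by simp
    have "\<bar>odd_sum C t\<bar> / (real t * (real t + 1)) = (\<bar>odd_sum C t\<bar> / real t) / (real t + 1)" by simp
    also have "\<dots> \<le> v / 2 ^ j"
      using \<open>2 ^ j \<le> real t\<close> \<open>(0::real) < 2 ^ j\<close> by (intro frac_le[OF v assms[OF t]]) linarith+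
    finally show "\<bar>odd_sum C t\<bar> / (real t * (real t + 1)) \<le> v / 2 ^ j" .
  qed
  then show ?thesis by simp
qed

lemma sum_le_blocks:
  assumes "2 ^ n0 \<le> a" "b < 2 ^ (n0 + L)"
  shows "(\<Sum>t=a..b. \<bar>odd_sum C t\<bar> / (real t * (real t + 1))) \<le> (\<Sum>j=n0..<n0+L. dyadic_block C j)"
proof -
  have "(\<Sum>j=n0..<n0+L. dyadic_block C j) = (\<Sum>t\<in>{2^n0..<2^(n0+L)}. \<bar>odd_sum C t\<bar> / (real t * (real t + 1)))"
  proof (induction L)
    case (Suc L)
    then show ?case
      by (simp add: dyadic_block_def sum.atLeastLessThan_concat del: power_Suc)
  qed simp
  moreover have "(\<Sum>t=a..b. \<bar>odd_sum C t\<bar> / (real t * (real t + 1)))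
      \<le> (\<Sum>t\<in>{2^n0..<2^(n0+L)}. \<bar>odd_sum C t\<bar> / (real t * (real t + 1)))"
    using assms by (intro sum_mono2) auto
  ultimately show ?thesis by simp
qed

text \<open>For \<open>N\<close> of size about \<open>2 ^ (n + c)\<close>, the short window
  \<open>2 ^ n\<close> is a factor \<open>2 ^ c\<close> below \<open>N\<close>, and the long one,
  \<open>2 ^ (n + 2 * c + 1)\<close>, is a factor \<open>2 ^ c\<close> above \<open>H\<close>. The
  edge errors on the two sides of the origin sum to \<open>8 / 2 ^ c\<close>, and the
  \<open>2 * c + 1\<close> oscillations in between are those of \<open>box_osc 0\<close>.\<close>

lemma small_on_block:
  "small_on (systems k) (\<lambda>d. dyadic_block (periodic_mean.slice (fst d) (fst (snd d)) (line_prod (snd (snd d)) 0 k)))"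
  (is "small_on _ ?b")
proof (rule small_on_approx)
  fix e :: real assume e: "e > 0"
  obtain c :: nat where c: "8 / e < 2 ^ c" using real_arch_pow[of 2 "8 / e"] by auto
  then have c8: "8 / 2 ^ c \<le> e" using e by (simp add: field_simps)
  let ?a = "\<lambda>d n. 4 * (\<Sum>a<2*c+1. sys_box_osc 0 k d (2 ^ (n + a)) (2 ^ (n + (c + 1))))"
  have bd: "?b d n \<le> 2" if d: "d \<in> systems k" for d n
  proof (rule block_le)
    interpret periodic_mean "fst d" "fst (snd d)" by (rule systemsD[OF d])
    fix t :: nat assume "t \<in> {2 ^ n..<2 ^ Suc n}"
    then have "t > 0" by (auto intro: Suc_leI less_le_trans[of 0 "2 ^ n"])
    then show "\<bar>odd_sum (slice (line_prod (snd (snd d)) 0 k)) t\<bar> / real t \<le> 2"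
      using odd_sum_bound[of "slice (line_prod (snd (snd d)) 0 k)" t, OF abs_slice_le[OF admissible_line_prod[OF systemsD(2)[OF d]]]]
      by (simp add: field_simps)
  qed
  have le: "?b d (n + c) \<le> ?a d n + e" if d: "d \<in> systems k" for d n
  proof (rule block_le)
    interpret periodic_mean "fst d" "fst (snd d)" by (rule systemsD[OF d])
    let ?C = "slice (line_prod (snd (snd d)) 0 k)"
    have C1: "\<bar>?C s\<bar> \<le> 1" for s by (intro abs_slice_le admissible_line_prod systemsD(2)[OF d]) auto
    fix N :: nat assume N: "N \<in> {2 ^ (n + c)..<2 ^ Suc (n + c)}"
    then have N0: "N > 0" by (auto intro: less_le_trans[of 0 "2 ^ (n + c)"])
    have Nr: "2 ^ (n + c) \<le> real N" using N by (simp add: numeral_power_le_of_nat_cancel_iff)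
    define M :: nat where "M = 2 ^ n"
    define H :: nat where "H = 2 ^ (n + (c + 1))"
    have M: "M > 0" and NH: "N < H" using N by (auto simp: M_def H_def)
    define Q where "Q = (\<Sum>a<2*c+1. (\<Sum>s\<in>{- int H..<int H}. \<bar>avg (2 ^ a * M) ?C s - avg (2 * (2 ^ a * M)) ?C s\<bar>) / real N)"
    have Q: "Q \<le> 2 * (\<Sum>a<2*c+1. box_osc 0 k (snd (snd d)) (2 ^ (n + a)) (2 ^ (n + (c + 1))))"
    proof -
      have HN: "real H / real N \<le> 2"
        using Nr N0 by (simp add: H_def field_simps power_add)
      have "Q = (\<Sum>a<2*c+1. (real H / real N) * osc_avg (2 ^ a * M) H (line_prod (snd (snd d)) 0 k))"
        using M NH by (simp add: Q_def osc_avg_def field_simps)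
      also have "\<dots> \<le> (\<Sum>a<2*c+1. 2 * osc_avg (2 ^ a * M) H (line_prod (snd (snd d)) 0 k))"
        by (intro sum_mono mult_right_mono HN osc_avg_nonneg)
      finally show ?thesis
        by (simp add: box_osc_def M_def H_def power_add sum_distrib_left mult.commute)
    qed
    have MN: "2 * real M / real N \<le> 2 / 2 ^ c"
      using Nr N0 by (simp add: M_def field_simps power_add)
    have HM: "2 * real H / (2 ^ (2*c+1) * real M) = 2 / 2 ^ c"
    proof -
      have "(2::real) ^ (2*c+1) = 2 * (2 ^ c * 2 ^ c)" by (metis Suc_eq_plus1 mult_2 power_Suc power_add)
      then show ?thesis by (simp add: M_def H_def power_add)
    qed
    have "\<bar>avg N ?C s0 - avg (2 ^ (2*c+1) * M) ?C 0\<bar> \<le> 4 / 2 ^ c + Q" if "s0 = 1 \<or> s0 = - int N" for s0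
      using avg_near_const[where C = ?C and e = "2*c+1", OF C1 M N0 NH that] MN HM unfolding Q_def by linarith
    from this[of 1] this[of "- int N"] have "\<bar>avg N ?C 1 - avg N ?C (- int N)\<bar> \<le> 8 / 2 ^ c + 2 * Q"
      by linarith
    then show "\<bar>odd_sum ?C N\<bar> / real N \<le> ?a d n + e"
      using Q c8 odd_sum_eq_avg[OF N0, of ?C] N0 by (simp add: abs_divide[symmetric])
  qed
  have sm: "small_on (systems k) ?a"
    by (intro small_on_cmult small_on_sum small_on_box_osc_rescale small_on_box_osc) auto
  \<comment> \<open>Block \<open>n + c\<close> is compared with scale \<open>n\<close>, so the
    blocks below \<open>c\<close> are left over; for them the trivial bound 2 is used.\<close>
  have "small_on (systems k) (\<lambda>d n. ?b d n - e)"
  proof (rule small_on_unshift[OF sm, of _ c 2])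
    fix d n assume d: "d \<in> systems k"
    show "?b d (n + c) - e \<le> ?a d n" using le[OF d, of n] by simp
    show "?b d n - e \<le> 2" using bd[OF d, of n] e by simp
  qed simp
  then show "\<exists>a. small_on (systems k) a \<and> (\<forall>d\<in>systems k. \<forall>n. ?b d n \<le> a d n + e)"
    by (intro exI conjI) auto
qed

section \<open>The kernel \<open>1 / t\<close>\<close>

definition annulus :: "real \<Rightarrow> real \<Rightarrow> int set" where
  "annulus r R = {t. r \<le> \<bar>of_int t\<bar> \<and> \<bar>of_int t\<bar> \<le> R}"

lemma annulus_eq:
  assumes "1 \<le> r"
  shows "annulus r R = int ` {nat \<lceil>r\<rceil>..nat \<lfloor>R\<rfloor>} \<union> (\<lambda>t. - int t) ` {nat \<lceil>r\<rceil>..nat \<lfloor>R\<rfloor>}"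
    (is "_ = int ` {?a..?b} \<union> _")
proof (intro equalityI subsetI)
  fix t :: int assume "t \<in> annulus r R"
  then have "nat \<bar>t\<bar> \<in> {?a..?b}" unfolding annulus_def by (auto simp: nat_le_iff le_nat_iff) linarith+
  moreover have "t = int (nat \<bar>t\<bar>) \<or> t = - int (nat \<bar>t\<bar>)" by linarith
  ultimately show "t \<in> int ` {?a..?b} \<union> (\<lambda>t. - int t) ` {?a..?b}" by blast
next
  fix t :: int assume "t \<in> int ` {?a..?b} \<union> (\<lambda>t. - int t) ` {?a..?b}"
  then obtain u where u: "?a \<le> u" "u \<le> ?b" "t = int u \<or> t = - int u" by auto
  then have "r \<le> real u" "real u \<le> R" using assms by linarith+
  then show "t \<in> annulus r R" using u by (auto simp: annulus_def)
qed

lemma sum_annulus: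
  assumes "1 \<le> r"
  shows "(\<Sum>t\<in>annulus r R. \<phi> t) = (\<Sum>t=nat \<lceil>r\<rceil>..nat \<lfloor>R\<rfloor>. \<phi> (int t) + \<phi> (- int t) :: 'a::comm_monoid_add)"
proof -
  have "1 \<le> nat \<lceil>r\<rceil>" using assms by linarith
  then show ?thesis unfolding annulus_eq[OF assms]
    by (subst sum.union_disjoint) (auto simp: sum.reindex inj_on_def sum.distrib)
qed

text \<open>An annulus meets about as many dyadic blocks as the logarithm of \<open>R / r\<close>,
  and their sum is a small multiple of that number. The boundary terms of the summation by parts are
  bounded and are absorbed because \<open>R / r\<close> is large.\<close>

lemma kernel_bound_periodic:
  assumes "e > 0"
  shows "\<exists>K>1. \<forall>d\<in>systems k. \<forall>r R. 1 \<le> r \<longrightarrow> r \<le> R \<longrightarrow> K \<le> R / r \<longrightarrow>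
    \<bar>\<Sum>t\<in>annulus r R.
       periodic_mean.slice (fst d) (fst (snd d)) (line_prod (snd (snd d)) 0 k) t / of_int t\<bar> \<le> e * ln (R / r)"
proof -
  from small_onD[OF small_on_block, of "e / 8" k] assms obtain L0 where
    L0: "\<And>d n0 L. d \<in> systems k \<Longrightarrow> L0 \<le> L \<Longrightarrow>
      (\<Sum>n=n0..<n0+L. dyadic_block (periodic_mean.slice (fst d) (fst (snd d)) (line_prod (snd (snd d)) 0 k)) n) \<le> e / 8 * real L"
    by (metis divide_pos_pos zero_less_numeral)
  \<comment> \<open>Then \<open>e / 2 * B\<close> is the constant part of the final bound: 4 for the
    boundary terms, the rest for scales not paid for by the logarithm.\<close>
  define B where "B = (4 + e / 8 * (real L0 + 2)) / (e / 2)"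
  have B: "B > 0" using assms by (simp add: B_def add_pos_nonneg)
  show ?thesis
  proof (rule exI[of _ "exp B"], intro conjI ballI allI impI)
    show "exp B > 1" using B by simp
    fix d r R assume d: "d \<in> systems k" and r: "(1::real) \<le> r" "r \<le> R" "exp B \<le> R / r"
    interpret periodic_mean "fst d" "fst (snd d)" by (rule systemsD[OF d])
    define C' where "C' = slice (line_prod (snd (snd d)) 0 k)"
    have C1: "\<bar>C' s\<bar> \<le> 1" for s unfolding C'_def by (intro abs_slice_le admissible_line_prod systemsD(2)[OF d]) auto
    define X where "X = ln (R / r)"
    have XB: "B \<le> X" using r(3) unfolding X_def by (metis exp_gt_zero exp_ln less_le_trans ln_le_cancel_iff ln_exp)
    define a where "a = nat \<lceil>r\<rceil>"
    define b where "b = nat \<lfloor>R\<rfloor>"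
    have a1: "1 \<le> a" using r unfolding a_def by linarith
    have b1: "1 \<le> b" using r unfolding b_def by linarith
    have sum: "(\<Sum>t\<in>annulus r R. C' t / of_int t) = (\<Sum>t=a..b. (C' (int t) - C' (- int t)) / real t)"
      unfolding a_def b_def using sum_annulus[OF r(1), of "\<lambda>t. C' t / of_int t" R] by (simp add: diff_divide_distrib)
    have "\<bar>\<Sum>t=a..b. (C' (int t) - C' (- int t)) / real t\<bar> \<le> e * X"
    proof (cases "a \<le> b")
      case False
      then show ?thesis using XB B assms by simp
    next
      case ab: True
      obtain n0 where n0: "2 ^ n0 \<le> a" "a < 2 ^ (n0 + 1)" using ex_power_ivl1[of 2 a] a1 by auto
      obtain nb where nb: "2 ^ nb \<le> b" "b < 2 ^ (nb + 1)" using ex_power_ivl1[of 2 b] b1 by auto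
      \<comment> \<open>At least \<open>L0\<close> scales are used, even when fewer are met, so that
        smallness applies; the additional blocks are nonnegative.\<close>
      define L where "L = max L0 (nb + 1 - n0)"
      have bL: "b < 2 ^ (n0 + L)"
        by (rule less_le_trans[OF nb(2) power_increasing]) (auto simp: L_def)
      have Lle: "real L \<le> real L0 + 2 + 2 * X"
      proof (cases "nb \<le> n0 + 1")
        case True
        then show ?thesis using XB B by (auto simp: L_def max_def)
      next
        case False
        have "(2::real) ^ nb \<le> R"
        proof -
          have "real (2 ^ nb) \<le> real b" using nb(1) by (simp only: of_nat_le_iff)
          also have "real b \<le> R" using r unfolding b_def by linarith
          finally show ?thesis by simp
        qed
        moreover have "r \<le> 2 ^ (n0 + 1)"
        proof -
          have "r \<le> real a" using r unfolding a_def by linarith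
          also have "real a \<le> real (2 ^ (n0 + 1))" using n0(2) by (simp only: of_nat_le_iff less_imp_le)
          finally show ?thesis by simp
        qed
        ultimately have "(2::real) ^ nb / 2 ^ (n0 + 1) \<le> R / r"
          using r by (intro frac_le) auto
        then have "(2::real) ^ (nb - (n0 + 1)) \<le> R / r"
          using False by (simp add: power_diff)
        then have "real (nb - (n0 + 1)) * ln 2 \<le> X"
          unfolding X_def using r by (subst ln_realpow[symmetric]) (auto simp: ln_le_cancel_iff)
        moreover have "real (nb - (n0 + 1)) * (1 / 2) \<le> real (nb - (n0 + 1)) * ln 2"
          using ln2_ge_two_thirds by (intro mult_left_mono) auto
        moreover have "real L \<le> real L0 + real (nb - (n0 + 1)) + 2" using False by (auto simp: L_def)
        ultimately show ?thesis by argo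
      qed
      have "(\<Sum>t=a..b. (C' (int t) - C' (- int t)) / real t)
          = odd_sum C' b / (real b + 1) - odd_sum C' (a - 1) / real a + (\<Sum>t=a..b. odd_sum C' t / (real t * (real t + 1)))"
        unfolding odd_sum_def by (rule abel_summation_reciprocal[OF a1 ab])
      moreover have "\<bar>odd_sum C' b / (real b + 1)\<bar> \<le> 2"
        using odd_sum_bound[where C = C' and N = b, OF C1] by (simp add: field_simps)
      moreover have "\<bar>odd_sum C' (a - 1) / real a\<bar> \<le> 2"
        using odd_sum_bound[where C = C' and N = "a - 1", OF C1] a1 by (simp add: field_simps of_nat_diff)
      moreover have "\<bar>\<Sum>t=a..b. odd_sum C' t / (real t * (real t + 1))\<bar> \<le> e / 8 * real L"
      proof -
        have "\<bar>\<Sum>t=a..b. odd_sum C' t / (real t * (real t + 1))\<bar> \<le> (\<Sum>t=a..b. \<bar>odd_sum C' t\<bar> / (real t * (real t + 1)))"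
          by (rule order_trans[OF sum_abs]) (auto intro!: sum_mono simp: abs_mult)
        also have "\<dots> \<le> (\<Sum>j=n0..<n0+L. dyadic_block C' j)" by (rule sum_le_blocks[OF n0(1) bL])
        also have "\<dots> \<le> e / 8 * real L" unfolding C'_def by (rule L0[OF d]) (simp add: L_def)
        finally show ?thesis .
      qed
      moreover have "e / 8 * real L \<le> e / 8 * (real L0 + 2 + 2 * X)"
        using assms Lle by (intro mult_left_mono) auto
      moreover have "4 + e / 8 * (real L0 + 2) \<le> e / 2 * X"
      proof -
        have "4 + e / 8 * (real L0 + 2) = e / 2 * B" using assms by (simp add: B_def)
        also have "\<dots> \<le> e / 2 * X" using XB assms by (intro mult_left_mono) auto
        finally show ?thesis .
      qed
      moreover have "e / 8 * (real L0 + 2 + 2 * X) = e / 8 * (real L0 + 2) + e * X / 4" by (simp add: field_simps)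
      moreover have "e * X \<ge> 0" using assms XB B by simp
      ultimately show ?thesis by argo
    qed
    then show "\<bar>\<Sum>t\<in>annulus r R. slice (line_prod (snd (snd d)) 0 k) t / of_int t\<bar> \<le> e * ln (R / r)"
      unfolding C'_def[symmetric] X_def[symmetric] sum .
  qed
qed

section \<open>From cycles to finitely supported functions on the integers\<close>

lemma sum_int_window: "(\<Sum>x\<in>{0..<2 * V + 1}. \<phi> (x - V)) = (\<Sum>y\<in>{- V..V}. \<phi> (y::int))"
  by (rule sum.reindex_bij_witness[where i = "\<lambda>y. y + V" and j = "\<lambda>x. x - V"]) auto

text \<open>The functions are repeated with a period so long that no shift \<open>i * t\<close> with
  \<open>|t| <= R\<close> wraps around. The factor \<open>f 0\<close> is not shifted and confines
  \<open>x\<close> to \<open>{-W..W}\<close>. The normalisation of \<open>mean\<close> by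
  \<open>S\<close> is undone at the end.\<close>

lemma kernel_bound_real:
  assumes "e > 0"
  shows "\<exists>K>1. \<forall>r R f W S. 1 \<le> r \<longrightarrow> r \<le> R \<longrightarrow> K \<le> R / r \<longrightarrow> S > 0 \<longrightarrow>
    (\<forall>i\<le>k. \<forall>x. \<bar>f i x\<bar> \<le> (1::real)) \<longrightarrow> (\<forall>i\<le>k. \<forall>x. \<bar>x\<bar> > W \<longrightarrow> f i x = 0) \<longrightarrow>
    (\<forall>i\<le>k. (\<Sum>x\<in>{-W..W}. \<bar>f i x\<bar>) \<le> S) \<longrightarrow>
    \<bar>\<Sum>t\<in>annulus r R. (\<Sum>x\<in>{-W..W}. \<Prod>i\<le>k. f i (x + int i * t)) / of_int t\<bar> \<le> e * ln (R / r) * S"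
proof -
  from kernel_bound_periodic[OF assms, of k] obtain K where K: "K > 1"
    and bd: "\<And>d r R. d \<in> systems k \<Longrightarrow> 1 \<le> r \<Longrightarrow> r \<le> R \<Longrightarrow> K \<le> R / r \<Longrightarrow>
      \<bar>\<Sum>t\<in>annulus r R. periodic_mean.slice (fst d) (fst (snd d)) (line_prod (snd (snd d)) 0 k) t / of_int t\<bar> \<le> e * ln (R / r)"
    by blast
  have "\<bar>\<Sum>t\<in>annulus r R. (\<Sum>x\<in>{-W..W}. \<Prod>i\<le>k. f i (x + int i * t)) / of_int t\<bar> \<le> e * ln (R / r) * S"
    if r: "1 \<le> r" "r \<le> R" "K \<le> R / r" and S: "S > 0"
      and f1: "\<And>i x. i \<le> k \<Longrightarrow> \<bar>f i x\<bar> \<le> 1" and f0: "\<And>i x. i \<le> k \<Longrightarrow> \<bar>x\<bar> > W \<Longrightarrow> f i x = 0"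
      and fS: "\<And>i. i \<le> k \<Longrightarrow> (\<Sum>x\<in>{-W..W}. \<bar>f i x\<bar>) \<le> S" for r R S :: real and f W
  proof (cases "W < 0")
    case True
    then show ?thesis using S r assms by simp
  next
    case False
    define V where "V = W + int k * \<lfloor>R\<rfloor> + 1"
    have WV: "W < V" using r False by (simp add: V_def)
    define P where "P = 2 * V + 1"
    have P: "P > 0" using False WV by (simp add: P_def)
    define g where "g i x = f i ((x + V) mod P - V)" for i :: nat and x
    interpret periodic_mean P S by unfold_locales (use P S in auto)
    have per_g: "periodic (g i)" for i
    proof -
      have "(x + P + V) mod P = (x + V) mod P" for x
        using mod_add_self2[of "x + V" P] by (simp add: add_ac)
      then show ?thesis by (simp add: periodic_def g_def)
    qed
    have g_eq: "g i x = f i x" if "x \<in> {-V..V}" for i x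
      using that by (simp add: g_def P_def)
    have shiftV: "(\<Sum>x\<in>{0..<P}. h x) = (\<Sum>y\<in>{-V..V}. h y)" if "periodic h" for h :: "int \<Rightarrow> real"
      using sum_periodic_shift[OF that, of "- V"] sum_int_window[of h V] by (simp add: P_def)
    have "admissible1 (g i)" if i: "i \<le> k" for i
      unfolding admissible1_def
    proof (intro conjI allI per_g)
      show "\<bar>g i x\<bar> \<le> 1" for x unfolding g_def by (rule f1[OF i])
      have "(\<Sum>x\<in>{0..<P}. \<bar>g i x\<bar>) = (\<Sum>x\<in>{-V..V}. \<bar>g i x\<bar>)"
        using per_g[of i] by (intro shiftV) (auto simp: periodic_def)
      also have "\<dots> = (\<Sum>x\<in>{-V..V}. \<bar>f i x\<bar>)" by (simp add: g_eq)
      also have "\<dots> = (\<Sum>x\<in>{-W..W}. \<bar>f i x\<bar>)"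
        using WV by (intro sum.mono_neutral_right) (auto intro!: f0[OF i])
      also have "\<dots> \<le> S" by (rule fS[OF i])
      finally show "mean (\<lambda>x. \<bar>g i x\<bar>) \<le> 1" using S by (simp add: mean_def)
    qed
    then have d: "(P, S, g) \<in> systems k" by (simp add: systems_def periodic_mean_axioms)
    have C_eq: "slice (line_prod g 0 k) t = (\<Sum>x\<in>{-W..W}. \<Prod>i\<le>k. f i (x + int i * t)) / S"
      if t: "t \<in> annulus r R" for t
    proof -
      have tR: "\<bar>t\<bar> \<le> \<lfloor>R\<rfloor>" using t by (simp add: annulus_def le_floor_iff)
      have "periodic (\<lambda>x. \<Prod>i\<le>k. g i (x + int i * t))"
        unfolding periodic_def
      proof (intro allI prod.cong refl)
        fix x i
        show "g i (x + P + int i * t) = g i (x + int i * t)"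
          using per_g[of i, unfolded periodic_def, rule_format, of "x + int i * t"] by (simp add: add_ac)
      qed
      then have "(\<Sum>x\<in>{0..<P}. \<Prod>i\<le>k. g i (x + int i * t)) = (\<Sum>x\<in>{-V..V}. \<Prod>i\<le>k. g i (x + int i * t))"
        by (rule shiftV)
      also have "\<dots> = (\<Sum>x\<in>{-W..W}. \<Prod>i\<le>k. g i (x + int i * t))"
      proof (intro sum.mono_neutral_right ballI)
        fix x assume x: "x \<in> {-V..V} - {-W..W}"
        then have "g 0 (x + int 0 * t) = 0" using g_eq[of x 0] f0[of 0 x] by auto
        then show "(\<Prod>i\<le>k. g i (x + int i * t)) = 0" by (intro prod_zero bexI[of _ 0]) auto
      qed (use WV in auto)
      also have "\<dots> = (\<Sum>x\<in>{-W..W}. \<Prod>i\<le>k. f i (x + int i * t))"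
      proof (intro sum.cong prod.cong refl g_eq)
        fix x and i assume x: "x \<in> {-W..W}" and i: "i \<in> {..k}"
        have "\<bar>int i * t\<bar> \<le> int k * \<lfloor>R\<rfloor>" unfolding abs_mult using i tR by (intro mult_mono) auto
        then show "x + int i * t \<in> {-V..V}" using x by (auto simp: V_def)
      qed
      finally show ?thesis by (simp add: slice_def mean_def line_prod_def atLeast0AtMost)
    qed
    have "\<bar>\<Sum>t\<in>annulus r R. (\<Sum>x\<in>{-W..W}. \<Prod>i\<le>k. f i (x + int i * t)) / S / of_int t\<bar> \<le> e * ln (R / r)"
      using bd[OF d r] by (simp add: C_eq)
    moreover have "(\<Sum>t\<in>annulus r R. (\<Sum>x\<in>{-W..W}. \<Prod>i\<le>k. f i (x + int i * t)) / S / of_int t)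
        = (\<Sum>t\<in>annulus r R. (\<Sum>x\<in>{-W..W}. \<Prod>i\<le>k. f i (x + int i * t)) / of_int t) / S"
      by (simp add: sum_divide_distrib mult.commute)
    ultimately show ?thesis using S by (simp add: pos_divide_le_eq)
  qed
  note main = this
  show ?thesis by (intro exI[of _ K] conjI allI impI K main) auto
qed

text \<open>The dual form: index 0 carries the function that tests the norm of the truncated
  sum.\<close>

definition multi_form :: "nat \<Rightarrow> (nat \<Rightarrow> int \<Rightarrow> complex) \<Rightarrow> int \<Rightarrow> real \<Rightarrow> real \<Rightarrow> complex" where
  "multi_form k f W r R = (\<Sum>t\<in>annulus r R. (\<Sum>x\<in>{-W..W}. \<Prod>i\<le>k. f i (x + int i * t)) / of_int t)"

text \<open>Real and imaginary parts of all factors give \<open>2 ^ Suc k\<close> real forms, whence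
  \<open>e'\<close>. The case \<open>S = 0\<close> is apart because \<open>S\<close> was a divisor;
  it forces \<open>f 0\<close> to vanish.\<close>

lemma kernel_bound_complex:
  assumes "e > 0"
  shows "\<exists>K>1. \<forall>r R f W S. 1 \<le> r \<longrightarrow> r \<le> R \<longrightarrow> K \<le> R / r \<longrightarrow> S \<ge> 0 \<longrightarrow>
    (\<forall>i\<le>k. \<forall>x. norm (f i x) \<le> 1) \<longrightarrow> (\<forall>i\<le>k. \<forall>x. \<bar>x\<bar> > W \<longrightarrow> f i x = 0) \<longrightarrow>
    (\<forall>i\<le>k. (\<Sum>x\<in>{-W..W}. norm (f i x)) \<le> S) \<longrightarrow>
    norm (multi_form k f W r R) \<le> e * ln (R / r) * S"
proof -
  define e' where "e' = e / 2 ^ Suc k"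
  have e': "e' > 0" using assms by (simp add: e'_def)
  from kernel_bound_real[OF e', of k] obtain K where K: "K > 1"
    and bd: "\<And>r R f W S. 1 \<le> r \<Longrightarrow> r \<le> R \<Longrightarrow> K \<le> R / r \<Longrightarrow> S > 0 \<Longrightarrow>
    (\<forall>i\<le>k. \<forall>x. \<bar>f i x\<bar> \<le> (1::real)) \<Longrightarrow> (\<forall>i\<le>k. \<forall>x. \<bar>x\<bar> > W \<longrightarrow> f i x = 0) \<Longrightarrow>
    (\<forall>i\<le>k. (\<Sum>x\<in>{-W..W}. \<bar>f i x\<bar>) \<le> S) \<Longrightarrow>
    \<bar>\<Sum>t\<in>annulus r R. (\<Sum>x\<in>{-W..W}. \<Prod>i\<le>k. f i (x + int i * t)) / of_int t\<bar> \<le> e' * ln (R / r) * S"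
    by blast
  have "norm (multi_form k f W r R) \<le> e * ln (R / r) * S"
    if r: "1 \<le> r" "r \<le> R" "K \<le> R / r" and S: "S \<ge> 0"
      and f1: "\<And>i x. i \<le> k \<Longrightarrow> norm (f i x) \<le> 1" and f0: "\<And>i x. i \<le> k \<Longrightarrow> \<bar>x\<bar> > W \<Longrightarrow> f i x = 0"
      and fS: "\<And>i. i \<le> k \<Longrightarrow> (\<Sum>x\<in>{-W..W}. norm (f i x)) \<le> S" for r R S :: real and f W
  proof (cases "S = 0")
    case True
    then have "(\<Sum>x\<in>{-W..W}. norm (f 0 x)) = 0"
      using fS[of 0] sum_nonneg[of "{-W..W}" "\<lambda>x. norm (f 0 x)"] by simp
    then have "f 0 x = 0" if "x \<in> {-W..W}" for x
      using that by (simp add: sum_nonneg_eq_0_iff)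
    then have "(\<Prod>i\<le>k. f i (x + int i * t)) = 0" if "x \<in> {-W..W}" for x t
      using that by (intro prod_zero) (auto intro!: bexI[of _ 0])
    then have "(\<Sum>x\<in>{-W..W}. \<Prod>i\<le>k. f i (x + int i * t)) = 0" for t
      by (intro sum.neutral) auto
    then show ?thesis unfolding multi_form_def using True by (simp del: prod_zero_iff)
  next
    case False
    then have S0: "S > 0" using S by simp
    define h where "h A i x = (if i \<in> A then Re (f i x) else Im (f i x))" for A i x
    have h_le: "\<bar>h A i x\<bar> \<le> norm (f i x)" for A i x
      by (simp add: h_def abs_Re_le_cmod abs_Im_le_cmod)
    define \<Lambda> where "\<Lambda> A = (\<Sum>t\<in>annulus r R. (\<Sum>x\<in>{-W..W}. \<Prod>i\<le>k. h A i (x + int i * t)) / of_int t)" for A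
    have \<Lambda>: "\<bar>\<Lambda> A\<bar> \<le> e' * ln (R / r) * S" for A
      unfolding \<Lambda>_def
    proof (intro bd r S0 allI impI)
      fix i assume i: "i \<le> k"
      show "\<bar>h A i x\<bar> \<le> 1" for x using h_le[of A i x] f1[OF i, of x] by linarith
      show "h A i x = 0" if "\<bar>x\<bar> > W" for x using f0[OF i that] by (simp add: h_def)
      show "(\<Sum>x\<in>{-W..W}. \<bar>h A i x\<bar>) \<le> S"
        by (rule order_trans[OF sum_mono fS[OF i]]) (rule h_le)
    qed
    have expand: "(\<Prod>i\<le>k. f i (x + int i * t))
        = (\<Sum>A\<in>Pow {..k}. \<i> ^ card ({..k} - A) * of_real (\<Prod>i\<le>k. h A i (x + int i * t)))" for x t
    proof -
      have "(\<Prod>i\<le>k. f i (x + int i * t))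
          = (\<Prod>i\<le>k. of_real (Re (f i (x + int i * t))) + \<i> * of_real (Im (f i (x + int i * t))))"
        by (simp add: complex_eq[symmetric])
      also have "\<dots> = (\<Sum>A\<in>Pow {..k}. (\<Prod>i\<in>A. of_real (Re (f i (x + int i * t))))
          * (\<Prod>i\<in>{..k} - A. \<i> * of_real (Im (f i (x + int i * t)))))"
        by (rule prod_add) simp
      also have "\<dots> = (\<Sum>A\<in>Pow {..k}. \<i> ^ card ({..k} - A) * of_real (\<Prod>i\<le>k. h A i (x + int i * t)))"
      proof (rule sum.cong[OF refl])
        fix A assume A: "A \<in> Pow {..k}"
        have "(\<Prod>i\<le>k. h A i (x + int i * t))
            = (\<Prod>i\<in>{..k} - A. h A i (x + int i * t)) * (\<Prod>i\<in>A. h A i (x + int i * t))"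
          using A by (intro prod.subset_diff) auto
        also have "(\<Prod>i\<in>{..k} - A. h A i (x + int i * t)) = (\<Prod>i\<in>{..k} - A. Im (f i (x + int i * t)))"
          by (intro prod.cong) (auto simp: h_def)
        also have "(\<Prod>i\<in>A. h A i (x + int i * t)) = (\<Prod>i\<in>A. Re (f i (x + int i * t)))"
          by (intro prod.cong) (auto simp: h_def)
        finally show "(\<Prod>i\<in>A. of_real (Re (f i (x + int i * t))))
          * (\<Prod>i\<in>{..k} - A. \<i> * of_real (Im (f i (x + int i * t))))
          = \<i> ^ card ({..k} - A) * of_real (\<Prod>i\<le>k. h A i (x + int i * t))"
          by (simp add: prod.distrib)
      qed
      finally show ?thesis .
    qed
    have "multi_form k f W r R = (\<Sum>A\<in>Pow {..k}. \<i> ^ card ({..k} - A) * of_real (\<Lambda> A))"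
    proof -
      have "multi_form k f W r R = (\<Sum>t\<in>annulus r R. \<Sum>A\<in>Pow {..k}. \<i> ^ card ({..k} - A) *
          (of_real (\<Sum>x\<in>{-W..W}. \<Prod>i\<le>k. h A i (x + int i * t)) / of_int t))"
        unfolding multi_form_def expand
        by (subst sum.swap) (simp add: sum_distrib_left sum_divide_distrib)
      also have "\<dots> = (\<Sum>A\<in>Pow {..k}. \<i> ^ card ({..k} - A) * of_real (\<Lambda> A))"
        by (subst sum.swap) (simp add: \<Lambda>_def sum_distrib_left)
      finally show ?thesis .
    qed
    also have "norm \<dots> \<le> (\<Sum>A\<in>Pow {..k}. norm (\<i> ^ card ({..k} - A) * of_real (\<Lambda> A)))"
      by (rule norm_sum)
    also have "\<dots> \<le> (\<Sum>A\<in>Pow {..k}. e' * ln (R / r) * S)"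
      by (rule sum_mono) (simp add: norm_mult norm_power \<Lambda>)
    also have "\<dots> = e * ln (R / r) * S"
      by (simp add: card_Pow e'_def)
    finally show ?thesis .
  qed
  note main = this
  show ?thesis by (intro exI[of _ K] conjI allI impI K main) auto
qed

section \<open>General exponents\<close>

lemma weighted_am_gm:
  fixes u a :: "'i \<Rightarrow> real"
  assumes "finite I" "I \<noteq> {}" "\<And>i. i \<in> I \<Longrightarrow> u i > 0" "\<And>i. i \<in> I \<Longrightarrow> a i > 0" "sum a I = 1"
  shows "(\<Prod>i\<in>I. u i powr a i) \<le> (\<Sum>i\<in>I. a i * u i)"
proof -
  have "ln (\<Sum>i\<in>I. a i *\<^sub>R u i) \<ge> (\<Sum>i\<in>I. a i * ln (u i))"
    by (rule concave_on_sum[OF assms(1,2) ln_concave]) (use assms in \<open>auto simp: less_imp_le\<close>)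
  moreover have pos: "(\<Sum>i\<in>I. a i * u i) > 0"
    using assms by (intro sum_pos) auto
  ultimately have "exp (\<Sum>i\<in>I. a i * ln (u i)) \<le> (\<Sum>i\<in>I. a i * u i)"
    by (simp add: ln_ge_iff)
  moreover have "exp (\<Sum>i\<in>I. a i * ln (u i)) = (\<Prod>i\<in>I. u i powr a i)"
    unfolding exp_sum[OF assms(1)]
    by (intro prod.cong refl) (use assms(3) in \<open>auto simp: powr_def less_imp_neq[symmetric]\<close>)
  ultimately show ?thesis by simp
qed

lemma sum_reciprocal_le_ln:
  assumes "1 \<le> a" "a \<le> b"
  shows "(\<Sum>t=a..b. 1 / real t) \<le> 1 + ln (real b / real a)"
  using assms(2)
proof (induction rule: dec_induct)
  case base
  then show ?case using assms(1) by simp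
next
  case (step n)
  have n: "real n > 0" using assms(1) step by simp
  have "ln (real n / real (Suc n)) \<le> real n / real (Suc n) - 1"
    using n by (intro ln_le_minus_one) auto
  also have "\<dots> = - (1 / real (Suc n))" by (simp add: field_simps)
  finally have "1 / real (Suc n) \<le> ln (real (Suc n)) - ln (real n)"
    using n by (simp add: ln_div)
  then show ?case using step assms(1) n by (simp add: ln_div)
qed

lemma sum_reciprocal_annulus:
  assumes "1 \<le> r" "r \<le> R"
  shows "(\<Sum>t\<in>annulus r R. 1 / \<bar>real_of_int t\<bar>) \<le> 2 + 2 * ln (R / r)"
proof -
  let ?a = "nat \<lceil>r\<rceil>" and ?b = "nat \<lfloor>R\<rfloor>"
  have eq: "(\<Sum>t\<in>annulus r R. 1 / \<bar>real_of_int t\<bar>) = 2 * (\<Sum>t=?a..?b. 1 / real t)"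
    using sum_annulus[OF assms(1), of "\<lambda>t. 1 / \<bar>real_of_int t\<bar>" R] by (simp add: sum_distrib_left)
  have l0: "ln (R / r) \<ge> 0" using assms by simp
  show ?thesis
  proof (cases "?a \<le> ?b")
    case True
    have a: "1 \<le> ?a" "r \<le> real ?a" "real ?b \<le> R" using assms by linarith+
    have "real ?b / real ?a \<le> R / r" using a assms by (intro frac_le) auto
    then have "ln (real ?b / real ?a) \<le> ln (R / r)" using a True assms by (subst ln_le_cancel_iff) auto
    then show ?thesis using sum_reciprocal_le_ln[OF a(1) True] unfolding eq by linarith
  qed (use eq l0 in simp)
qed

section \<open>Decomposition into level sets\<close>

lemma prod_if_zero:
  "finite I \<Longrightarrow> (\<Prod>i\<in>I. if Q i then z i else 0) = (if \<forall>i\<in>I. Q i then \<Prod>i\<in>I. z i else (0::'a::comm_semiring_1))"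
  by (induction I rule: finite_induct) auto

text \<open>A tuple of levels lies in two windows \<open>{m, m+1}\<close> if it is constant, and in one if its spread is \<open>1\<close>.\<close>

lemma sum_level_windows:
  fixes z :: "nat \<Rightarrow> 'a::comm_ring_1" and l :: "nat \<Rightarrow> int"
  assumes "\<And>i. i \<le> k \<Longrightarrow> \<bar>l i\<bar> < N"
  shows "(\<Sum>m\<in>{-N..N}. (\<Prod>i\<le>k. if l i \<in> {m, m + 1} then z i else 0) - (\<Prod>i\<le>k. if l i \<in> {m} then z i else 0))
    = (if \<forall>i\<le>k. \<forall>j\<le>k. l i \<le> l j + 1 then \<Prod>i\<le>k. z i else 0)"
proof -
  define a where "a = Min (l ` {..k})"
  have "a \<in> l ` {..k}" unfolding a_def by (rule Min_in) auto
  then obtain j where j: "j \<le> k" "l j = a" by auto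
  have a_le: "a \<le> l i" if "i \<le> k" for i using that by (auto simp: a_def)
  define Z where "Z = (\<Prod>i\<le>k. z i)"
  define \<phi> where "\<phi> m = (\<Prod>i\<le>k. if l i \<in> {m, m + 1} then z i else 0) - (\<Prod>i\<le>k. if l i \<in> {m} then z i else 0)" for m
  have \<phi>: "\<phi> m = (if \<forall>i\<le>k. l i \<in> {m, m + 1} then Z else 0) - (if \<forall>i\<le>k. l i \<in> {m} then Z else 0)" for m
    unfolding \<phi>_def Z_def by (subst (1 2) prod_if_zero) auto
  have "(\<Sum>m\<in>{-N..N}. \<phi> m) = (\<Sum>m\<in>{a - 1, a}. \<phi> m)"
  proof (intro sum.mono_neutral_right ballI)
    fix m assume "m \<in> {-N..N} - {a - 1, a}"
    then have "l j \<notin> {m, m + 1}" using j by auto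
    then show "\<phi> m = 0" unfolding \<phi> using j(1) by auto
  qed (use assms[OF j(1)] j in auto)
  also have "\<dots> = \<phi> (a - 1) + \<phi> a" by simp
  also have "\<phi> (a - 1) = (if \<forall>i\<le>k. l i = a then Z else 0)"
  proof -
    have "l i \<in> {a - 1, a - 1 + 1} \<longleftrightarrow> l i = a" if "i \<le> k" for i using a_le[OF that] by auto
    moreover have "l j \<notin> {a - 1}" using j by simp
    ultimately show ?thesis unfolding \<phi> using j(1) by auto
  qed
  also have "\<phi> a = (if \<forall>i\<le>k. l i \<le> a + 1 then Z else 0) - (if \<forall>i\<le>k. l i = a then Z else 0)"
  proof -
    have "l i \<in> {a, a + 1} \<longleftrightarrow> l i \<le> a + 1" if "i \<le> k" for i using a_le[OF that] by auto
    then show ?thesis unfolding \<phi> by auto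
  qed
  also have "(\<forall>i\<le>k. l i \<le> a + 1) \<longleftrightarrow> (\<forall>i\<le>k. \<forall>j\<le>k. l i \<le> l j + 1)"
  proof (intro iffI allI impI)
    fix i j assume "\<forall>i\<le>k. l i \<le> a + 1" "i \<le> k" "j \<le> k"
    then have "l i \<le> a + 1" by blast
    then show "l i \<le> l j + 1" using a_le[OF \<open>j \<le> k\<close>] by linarith
  next
    fix i assume "\<forall>i\<le>k. \<forall>j\<le>k. l i \<le> l j + 1" "i \<le> k"
    then show "l i \<le> a + 1" using j by blast
  qed
  finally show ?thesis unfolding \<phi>_def Z_def by simp
qed

text \<open>With \<open>1 / a\<close> the exponent of the space, the powers
  \<open>norm z powr (1 / a)\<close> have bounded sum for every function, and this makes the levels
  of different functions comparable. The level of 0 is a mere convention: products with a zero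
  factor vanish.\<close>

definition level :: "real \<Rightarrow> real \<Rightarrow> complex \<Rightarrow> int" where
  "level M a z = \<lfloor>log M (norm z powr (1 / a))\<rfloor>"

lemma level_bounds:
  assumes "M > 1" "z \<noteq> 0"
  shows "M powr of_int (level M a z) \<le> norm z powr (1 / a)" "norm z powr (1 / a) < M powr (of_int (level M a z) + 1)"
proof -
  have u: "norm z powr (1 / a) > 0" using assms by simp
  have "of_int (level M a z) \<le> log M (norm z powr (1 / a))" "log M (norm z powr (1 / a)) < of_int (level M a z) + 1"
    unfolding level_def by linarith+
  then show "M powr of_int (level M a z) \<le> norm z powr (1 / a)" "norm z powr (1 / a) < M powr (of_int (level M a z) + 1)"
    using assms(1) u by (simp_all add: le_log_iff log_less_iff)
qed

lemma norm_eq_powr_powr: "z \<noteq> 0 \<Longrightarrow> a > 0 \<Longrightarrow> norm z = (norm z powr (1 / a)) powr a"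
  by (simp add: powr_powr)

lemma multi_form_scale:
  "multi_form k (\<lambda>i x. c i * h i x) W r R = (\<Prod>i\<le>k. c i) * multi_form k h W r R"
  by (simp add: multi_form_def prod.distrib sum_distrib_left mult.assoc)

text \<open>Division of \<open>f i\<close> by \<open>A i\<close> brings the values below 1, and the
  \<open>A i\<close> multiply to \<open>M powr (m + 2)\<close> since the exponents add up to 1.
  Where the restricted functions are nonzero, the powers
  \<open>norm (f i x) powr (1 / \<alpha> i)\<close> are at least \<open>M powr m\<close>, so the l1
  sums are at most \<open>M powr (- m)\<close> times the sum of powers. Together this gives
  \<open>M^2\<close>.\<close>

lemma multi_form_level_window:
  fixes \<alpha> :: "nat \<Rightarrow> real" and f :: "nat \<Rightarrow> int \<Rightarrow> complex"
  assumes \<alpha>: "\<And>i. i \<le> k \<Longrightarrow> \<alpha> i > 0" "(\<Sum>i\<le>k. \<alpha> i) = 1" and M: "M > 1" and J: "J \<subseteq> {m, m + 1}"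
    and f0: "\<And>i x. i \<le> k \<Longrightarrow> \<bar>x\<bar> > W \<Longrightarrow> f i x = 0"
    and bd: "\<And>f S. S \<ge> 0 \<Longrightarrow> \<forall>i\<le>k. \<forall>x. norm (f i x) \<le> 1 \<Longrightarrow> \<forall>i\<le>k. \<forall>x. \<bar>x\<bar> > W \<longrightarrow> f i x = 0 \<Longrightarrow>
      \<forall>i\<le>k. (\<Sum>x\<in>{-W..W}. norm (f i x)) \<le> S \<Longrightarrow> norm (multi_form k f W r R) \<le> c * S"
  shows "norm (multi_form k (\<lambda>i x. if level M (\<alpha> i) (f i x) \<in> J then f i x else 0) W r R)
    \<le> M\<^sup>2 * c * (\<Sum>i\<le>k. \<Sum>x\<in>{-W..W}. if level M (\<alpha> i) (f i x) \<in> {m, m + 1} then norm (f i x) powr (1 / \<alpha> i) else 0)"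
    (is "norm (multi_form k ?g W r R) \<le> M\<^sup>2 * c * ?U")
proof -
  define A where "A i = M powr ((of_int m + 2) * \<alpha> i)" for i
  have A: "A i > 0" for i using M by (simp add: A_def)
  define h where "h i x = ?g i x / of_real (A i)" for i x
  let ?S = "M powr (- of_int m) * ?U"
  have prodA: "(\<Prod>i\<le>k. A i) = M powr (of_int m + 2)"
    using M \<alpha>(2) by (simp add: A_def powr_sum[symmetric] sum_distrib_left[symmetric])
  have U: "?U \<ge> 0" by (intro sum_nonneg) auto
  have "norm (multi_form k h W r R) \<le> c * ?S"
  proof (intro bd allI impI)
    show "0 \<le> ?S" using U by simp
    fix i assume i: "i \<le> k"
    show h1: "norm (h i x) \<le> 1" for x
    proof (cases "?g i x = 0")
      case True
      then show ?thesis by (simp add: h_def)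
    next
      case False
      then have z: "f i x \<noteq> 0" "level M (\<alpha> i) (f i x) \<in> J" by (auto split: if_splits)
      have "norm (f i x) powr (1 / \<alpha> i) \<le> M powr (of_int (level M (\<alpha> i) (f i x)) + 1)"
        using level_bounds(2)[OF M z(1)] by (simp add: less_imp_le)
      also have "\<dots> \<le> M powr (of_int m + 2)" using z(2) J M by auto
      finally have "(norm (f i x) powr (1 / \<alpha> i)) powr \<alpha> i \<le> (M powr (of_int m + 2)) powr \<alpha> i"
        using \<alpha>(1)[OF i] by (intro powr_mono2) auto
      then have "norm (f i x) \<le> A i"
        using norm_eq_powr_powr[OF z(1) \<alpha>(1)[OF i]] by (simp add: A_def powr_powr)
      then show ?thesis using z A[of i] by (simp add: h_def norm_divide)
    qed
    show "h i x = 0" if "\<bar>x\<bar> > W" for x using f0[OF i that] by (simp add: h_def)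
    have pt: "norm (h i x) \<le> M powr (- of_int m) *
        (if level M (\<alpha> i) (f i x) \<in> {m, m + 1} then norm (f i x) powr (1 / \<alpha> i) else 0)" for x
    proof (cases "?g i x = 0")
      case True
      then show ?thesis by (simp add: h_def)
    next
      case False
      then have z: "f i x \<noteq> 0" "level M (\<alpha> i) (f i x) \<in> J" by (auto split: if_splits)
      have "M powr of_int m \<le> M powr (of_int (level M (\<alpha> i) (f i x)))" using z(2) J M by auto
      also have "\<dots> \<le> norm (f i x) powr (1 / \<alpha> i)" by (rule level_bounds(1)[OF M z(1)])
      finally have "M powr (- of_int m) * M powr of_int m \<le> M powr (- of_int m) * norm (f i x) powr (1 / \<alpha> i)"
        by (intro mult_left_mono) auto
      moreover have "M powr (- of_int m) * M powr of_int m = 1" using M by (simp add: powr_add[symmetric])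
      moreover have "level M (\<alpha> i) (f i x) \<in> {m, m + 1}" using z(2) J by blast
      ultimately show ?thesis using h1[of x] by auto
    qed
    have "(\<Sum>x\<in>{-W..W}. norm (h i x)) \<le> (\<Sum>x\<in>{-W..W}. M powr (- of_int m) *
        (if level M (\<alpha> i) (f i x) \<in> {m, m + 1} then norm (f i x) powr (1 / \<alpha> i) else 0))"
      by (intro sum_mono pt)
    also have "\<dots> = M powr (- of_int m) * (\<Sum>x\<in>{-W..W}.
        if level M (\<alpha> i) (f i x) \<in> {m, m + 1} then norm (f i x) powr (1 / \<alpha> i) else 0)"
      by (simp only: sum_distrib_left)
    also have "\<dots> \<le> ?S"
      by (intro mult_left_mono member_le_sum[of i "{..k}"] sum_nonneg) (use i in auto)
    finally show "(\<Sum>x\<in>{-W..W}. norm (h i x)) \<le> ?S" .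
  qed
  moreover have "multi_form k ?g W r R = of_real (M powr (of_int m + 2)) * multi_form k h W r R"
  proof -
    have "?g = (\<lambda>i x. of_real (A i) * h i x)" using A by (simp add: h_def fun_eq_iff less_imp_neq[symmetric])
    then have "multi_form k ?g W r R = multi_form k (\<lambda>i x. of_real (A i) * h i x) W r R" by simp
    also have "\<dots> = (\<Prod>i\<le>k. of_real (A i)) * multi_form k h W r R" by (rule multi_form_scale)
    also have "(\<Prod>i\<le>k. of_real (A i)) = (of_real (M powr (of_int m + 2)) :: complex)"
      by (simp add: prodA[symmetric])
    finally show ?thesis .
  qed
  ultimately have "norm (multi_form k ?g W r R) \<le> M powr (of_int m + 2) * (c * ?S)"
    by (simp add: norm_mult mult_left_mono)
  also have "\<dots> = (M powr (of_int m + 2) * M powr (- of_int m)) * c * ?U" by (simp add: mult_ac)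
  also have "M powr (of_int m + 2) * M powr (- of_int m) = M\<^sup>2"
    using M by (simp add: powr_add[symmetric] powr_numeral)
  finally show ?thesis .
qed

text \<open>Exponent \<delta> is moved from the small factor \<open>j\<close> to the large factor
  \<open>i\<close>. This gains \<open>(u j / u i) powr \<delta>\<close>, and the new exponents are
  still positive with sum 1, so the weighted arithmetic-geometric inequality applies to
  them.\<close>

lemma prod_norm_far_levels:
  fixes z :: "nat \<Rightarrow> complex" and \<alpha> :: "nat \<Rightarrow> real"
  assumes \<alpha>: "\<And>i. i \<le> k \<Longrightarrow> \<alpha> i > \<delta>" "(\<Sum>i\<le>k. \<alpha> i) = 1" and \<delta>: "\<delta> > 0" and M: "M > 1"
    and z: "\<And>i. i \<le> k \<Longrightarrow> z i \<noteq> 0" and ij: "i \<le> k" "j \<le> k"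
    and far: "level M (\<alpha> i) (z i) > level M (\<alpha> j) (z j) + 1"
  shows "(\<Prod>l\<le>k. norm (z l)) \<le> M powr (- \<delta>) *
    (\<Sum>l\<le>k. (\<alpha> l + (if l = i then \<delta> else 0) - (if l = j then \<delta> else 0)) * norm (z l) powr (1 / \<alpha> l))"
proof -
  let ?a = "\<lambda>l. \<alpha> l + (if l = i then \<delta> else 0) - (if l = j then \<delta> else 0)"
  define u where "u l = norm (z l) powr (1 / \<alpha> l)" for l
  have u: "u l > 0" if "l \<le> k" for l using z[OF that] by (simp add: u_def)
  have a0: "?a l > 0" if "l \<le> k" for l using \<alpha>(1)[OF that] \<delta> by auto
  have a1: "(\<Sum>l\<le>k. ?a l) = 1" using \<alpha>(2) ij by (simp add: sum.distrib sum_subtractf)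
  \<comment> \<open>The levels are integers, so they differ by at least 2; one unit is lost to
    rounding.\<close>
  have uij: "u j \<le> u i / M"
  proof -
    have "u j \<le> M powr (of_int (level M (\<alpha> j) (z j)) + 1)"
      using level_bounds(2)[OF M z[OF ij(2)]] by (simp add: u_def less_imp_le)
    also have "\<dots> \<le> M powr (of_int (level M (\<alpha> i) (z i)) - 1)"
      using far M by auto
    also have "\<dots> = M powr of_int (level M (\<alpha> i) (z i)) / M"
      using M by (simp add: powr_diff)
    also have "\<dots> \<le> u i / M"
      using level_bounds(1)[OF M z[OF ij(1)]] M by (intro divide_right_mono) (auto simp: u_def)
    finally show ?thesis .
  qed
  have ui: "u i > 0" "u j > 0" using u ij by auto
  have split: "(\<Prod>l\<le>k. u l powr ?a l) = (\<Prod>l\<le>k. u l powr \<alpha> l) * (u i powr \<delta> / u j powr \<delta>)"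
  proof -
    have "(\<Prod>l\<le>k. u l powr ?a l) = (\<Prod>l\<le>k. u l powr \<alpha> l * (if l = i then u l powr \<delta> else 1) / (if l = j then u l powr \<delta> else 1))"
      using u by (intro prod.cong refl) (auto simp: powr_add powr_diff less_imp_neq[symmetric])
    also have "\<dots> = (\<Prod>l\<le>k. u l powr \<alpha> l) * (u i powr \<delta> / u j powr \<delta>)"
      using ij by (simp add: prod_dividef prod.distrib)
    finally show ?thesis .
  qed
  have "(\<Prod>l\<le>k. norm (z l)) = (\<Prod>l\<le>k. u l powr \<alpha> l)"
  proof (intro prod.cong refl)
    fix l assume l: "l \<in> {..k}"
    then have "\<alpha> l > 0" using \<alpha>(1)[of l] \<delta> by simp
    then show "norm (z l) = u l powr \<alpha> l" using z[of l] l unfolding u_def by (intro norm_eq_powr_powr) auto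
  qed
  also have "\<dots> = (u j powr \<delta> / u i powr \<delta>) * (\<Prod>l\<le>k. u l powr ?a l)"
    unfolding split using ui by simp
  also have "\<dots> \<le> M powr (- \<delta>) * (\<Sum>l\<le>k. ?a l * u l)"
  proof (intro mult_mono)
    have "u j powr \<delta> \<le> (u i / M) powr \<delta>" using uij ui \<delta> by (intro powr_mono2) auto
    also have "\<dots> = u i powr \<delta> * M powr (- \<delta>)" using ui M by (simp add: powr_divide powr_minus_divide)
    finally show "u j powr \<delta> / u i powr \<delta> \<le> M powr (- \<delta>)" using ui by (simp add: pos_divide_le_eq mult.commute)
    show "(\<Prod>l\<le>k. u l powr ?a l) \<le> (\<Sum>l\<le>k. ?a l * u l)"
      using u a0 a1 by (intro weighted_am_gm) auto
  qed (auto intro!: prod_nonneg)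
  finally show ?thesis by (simp add: u_def)
qed

text \<open>Each value lies in two level windows only, so the bounds for near tuples sum to a
  constant, with no loss from the number of levels. Far tuples are estimated trivially in
  \<open>t\<close>; the gain \<open>M powr (- \<delta>)\<close> makes them small. Hence
  \<open>M\<close> is chosen first, and \<open>e'\<close> in terms of \<open>M\<close>.\<close>

lemma multi_form_bound_normalised:
  fixes \<alpha> :: "nat \<Rightarrow> real"
  assumes \<alpha>: "\<And>i. i \<le> k \<Longrightarrow> \<alpha> i > 0" "(\<Sum>i\<le>k. \<alpha> i) = 1" and e: "e > 0"
  shows "\<exists>K>1. \<forall>r R f W. 1 \<le> r \<longrightarrow> r \<le> R \<longrightarrow> K \<le> R / r \<longrightarrow>
    (\<forall>i\<le>k. \<forall>x. \<bar>x\<bar> > W \<longrightarrow> f i x = 0) \<longrightarrow>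
    (\<forall>i\<le>k. (\<Sum>x\<in>{-W..W}. norm (f i x) powr (1 / \<alpha> i)) \<le> 1) \<longrightarrow>
    norm (multi_form k f W r R) \<le> e * ln (R / r)"
proof -
  define \<delta> where "\<delta> = Min (\<alpha> ` {..k}) / 2"
  have Min: "Min (\<alpha> ` {..k}) > 0" "\<And>i. i \<le> k \<Longrightarrow> Min (\<alpha> ` {..k}) \<le> \<alpha> i"
    using \<alpha>(1) by (auto simp: Min_gr_iff)
  have \<delta>: "\<delta> > 0" using Min(1) by (simp add: \<delta>_def)
  have \<alpha>\<delta>: "\<alpha> i > \<delta>" if "i \<le> k" for i using Min(1) Min(2)[OF that] unfolding \<delta>_def by linarith
  define b where "b = 8 * (real k + 1)\<^sup>2 / e"
  have b: "b > 0" using e by (simp add: b_def add_pos_nonneg)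
  define M where "M = 1 + b powr (1 / \<delta>)"
  have M: "M > 1" using b by (simp add: M_def)
  have Mb: "4 * (real k + 1)\<^sup>2 * M powr (- \<delta>) \<le> e / 2"
  proof -
    have "b = (b powr (1 / \<delta>)) powr \<delta>" using b \<delta> by (simp add: powr_powr)
    also have "\<dots> \<le> M powr \<delta>" using \<delta> by (intro powr_mono2) (auto simp: M_def)
    finally have "8 * (real k + 1)\<^sup>2 \<le> e * M powr \<delta>" using e by (simp add: b_def field_simps)
    then show ?thesis using M by (simp add: powr_minus field_simps)
  qed
  \<comment> \<open>Compensates the two forms per window, the factor \<open>M^2\<close> and the
    total \<open>2 * (k + 1)\<close> of the windows, leaving \<open>e / 2\<close>.\<close>
  define e' where "e' = e / (8 * (real k + 1) * M\<^sup>2)"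
  have e': "e' > 0" using e M by (simp add: e'_def add_pos_nonneg)
  from kernel_bound_complex[OF e', of k] obtain K0 where K0: "K0 > 1"
    and bd: "\<And>r R f W S. 1 \<le> r \<Longrightarrow> r \<le> R \<Longrightarrow> K0 \<le> R / r \<Longrightarrow> S \<ge> 0 \<Longrightarrow>
    (\<forall>i\<le>k. \<forall>x. norm (f i x) \<le> 1) \<Longrightarrow> (\<forall>i\<le>k. \<forall>x. \<bar>x\<bar> > W \<longrightarrow> f i x = 0) \<Longrightarrow>
    (\<forall>i\<le>k. (\<Sum>x\<in>{-W..W}. norm (f i x)) \<le> S) \<Longrightarrow> norm (multi_form k f W r R) \<le> e' * ln (R / r) * S"
    by blast
  have main: "norm (multi_form k f W r R) \<le> e * ln (R / r)"
    if r: "1 \<le> r" "r \<le> R" "max K0 (exp 1) \<le> R / r"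
      and f0: "\<And>i x. i \<le> k \<Longrightarrow> \<bar>x\<bar> > W \<Longrightarrow> f i x = 0"
      and f1: "\<And>i. i \<le> k \<Longrightarrow> (\<Sum>x\<in>{-W..W}. norm (f i x) powr (1 / \<alpha> i)) \<le> 1" for r R :: real and f W
  proof -
    define X where "X = ln (R / r)"
    \<comment> \<open>The purpose of \<open>exp 1\<close> in the threshold: the sum of
      \<open>1 / |t|\<close>, at most \<open>2 + 2 * X\<close>, is then at most
      \<open>4 * X\<close>.\<close>
    have X: "X \<ge> 1" using r unfolding X_def by (subst ln_ge_iff) auto
    define l where "l i x = level M (\<alpha> i) (f i x)" for i x
    define u where "u i x = norm (f i x) powr (1 / \<alpha> i)" for i x
    have u0: "u i x \<ge> 0" for i x by (simp add: u_def)
    have u_out: "u i x = 0" if "i \<le> k" "\<bar>x\<bar> > W" for i x using f0[OF that] by (simp add: u_def)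
    have u_shift: "(\<Sum>x\<in>{-W..W}. u i (x + c)) \<le> 1" if i: "i \<le> k" for i c
    proof -
      have "(\<Sum>x\<in>{-W..W}. u i (x + c)) = (\<Sum>y\<in>(\<lambda>x. x + c) ` {-W..W}. u i y)"
        by (subst sum.reindex) (auto simp: inj_on_def)
      also have "\<dots> = (\<Sum>y\<in>(\<lambda>x. x + c) ` {-W..W} \<inter> {-W..W}. u i y)"
        using u_out[OF i] by (intro sum.mono_neutral_right) auto
      also have "\<dots> \<le> (\<Sum>y\<in>{-W..W}. u i y)" by (intro sum_mono2 u0) auto
      finally show ?thesis using f1[OF i] by (simp add: u_def)
    qed
    \<comment> \<open>Outside \<open>{-W..W}\<close> the functions vanish and have the level of 0,
      so finitely many levels occur.\<close>
    define Ls where "Ls = (\<lambda>(i, x). \<bar>l i x\<bar>) ` ({..k} \<times> {-W..W}) \<union> (\<lambda>i. \<bar>level M (\<alpha> i) 0\<bar>) ` {..k}"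
    define N where "N = 1 + Max Ls"
    have N: "\<bar>l i x\<bar> < N" if "i \<le> k" for i x
    proof -
      have "\<bar>l i x\<bar> \<in> Ls"
      proof (cases "x \<in> {-W..W}")
        case True
        then show ?thesis using that unfolding Ls_def by force
      next
        case False
        then have "l i x = level M (\<alpha> i) 0" using f0[OF that, of x] by (auto simp: l_def)
        then show ?thesis using that unfolding Ls_def by auto
      qed
      then have "\<bar>l i x\<bar> \<le> Max Ls" by (intro Max_ge) (auto simp: Ls_def)
      then show ?thesis by (simp add: N_def)
    qed
    define g where "g J i x = (if l i x \<in> J then f i x else 0)" for J i x
    define T where "T x t = (if \<forall>i\<le>k. \<forall>j\<le>k. l i (x + int i * t) \<le> l j (x + int j * t) + 1 then 0 else \<Prod>i\<le>k. f i (x + int i * t))"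
      for x t
    have decomp: "(\<Prod>i\<le>k. f i (x + int i * t)) = (\<Sum>m\<in>{-N..N}. (\<Prod>i\<le>k. g {m, m + 1} i (x + int i * t))
        - (\<Prod>i\<le>k. g {m} i (x + int i * t))) + T x t" for x t
      unfolding g_def
      by (subst sum_level_windows[where l = "\<lambda>i. l i (x + int i * t)" and z = "\<lambda>i. f i (x + int i * t)"])
        (auto simp: T_def N)
    have multi_form_eq: "multi_form k f W r R = (\<Sum>m\<in>{-N..N}. multi_form k (g {m, m + 1}) W r R - multi_form k (g {m}) W r R)
        + (\<Sum>t\<in>annulus r R. (\<Sum>x\<in>{-W..W}. T x t) / of_int t)"
    proof -
      have "(\<Sum>x\<in>{-W..W}. \<Prod>i\<le>k. f i (x + int i * t)) = (\<Sum>m\<in>{-N..N}.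
          (\<Sum>x\<in>{-W..W}. \<Prod>i\<le>k. g {m, m + 1} i (x + int i * t)) - (\<Sum>x\<in>{-W..W}. \<Prod>i\<le>k. g {m} i (x + int i * t)))
          + (\<Sum>x\<in>{-W..W}. T x t)" for t
        unfolding decomp sum.distrib sum_subtractf[symmetric] by (subst sum.swap) (rule refl)
      then have "multi_form k f W r R = (\<Sum>t\<in>annulus r R. \<Sum>m\<in>{-N..N}.
          (\<Sum>x\<in>{-W..W}. \<Prod>i\<le>k. g {m, m + 1} i (x + int i * t)) / of_int t
          - (\<Sum>x\<in>{-W..W}. \<Prod>i\<le>k. g {m} i (x + int i * t)) / of_int t)
          + (\<Sum>t\<in>annulus r R. (\<Sum>x\<in>{-W..W}. T x t) / of_int t)"
        by (simp add: multi_form_def add_divide_distrib sum.distrib sum_divide_distrib[of _ "{-N..N}"] diff_divide_distrib)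
      then show ?thesis by (subst (asm) sum.swap) (simp add: multi_form_def sum_subtractf)
    qed
    define U where "U m = (\<Sum>i\<le>k. \<Sum>x\<in>{-W..W}. if l i x \<in> {m, m + 1} then u i x else 0)" for m
    have window: "norm (multi_form k (g J) W r R) \<le> M\<^sup>2 * (e' * X) * U m" if J: "J \<subseteq> {m, m + 1}" for J m
      unfolding U_def u_def l_def g_def
      by (rule multi_form_level_window[OF \<alpha> M J f0]) (use bd[of r R _ _ W] r in \<open>auto simp: X_def\<close>)
    have sumU: "(\<Sum>m\<in>{-N..N}. U m) \<le> 2 * (real k + 1)"
    proof -
      have "(\<Sum>m\<in>{-N..N}. U m) = (\<Sum>i\<le>k. \<Sum>x\<in>{-W..W}. \<Sum>m\<in>{-N..N}. if l i x \<in> {m, m + 1} then u i x else 0)"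
        unfolding U_def by (subst sum.swap, rule sum.cong[OF refl], rule sum.swap)
      also have "\<dots> \<le> (\<Sum>i\<le>k. \<Sum>x\<in>{-W..W}. 2 * u i x)"
      proof (intro sum_mono)
        fix i x
        have "(\<Sum>m\<in>{-N..N}. if l i x \<in> {m, m + 1} then u i x else 0)
            = (\<Sum>m\<in>{-N..N} \<inter> {l i x - 1, l i x}. if l i x \<in> {m, m + 1} then u i x else 0)"
          by (intro sum.mono_neutral_right) auto
        also have "\<dots> \<le> (\<Sum>m\<in>{l i x - 1, l i x}. u i x)"
          by (rule order_trans[OF sum_mono[where g = "\<lambda>_. u i x"] sum_mono2]) (auto simp: u0)
        finally show "(\<Sum>m\<in>{-N..N}. if l i x \<in> {m, m + 1} then u i x else 0) \<le> 2 * u i x" by simp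
      qed
      also have "\<dots> \<le> (\<Sum>i\<le>k. 2)"
        using f1 by (intro sum_mono) (simp add: sum_distrib_left[symmetric] u_def)
      finally show ?thesis by simp
    qed
    have close: "norm (\<Sum>m\<in>{-N..N}. multi_form k (g {m, m + 1}) W r R - multi_form k (g {m}) W r R) \<le> e / 2 * X"
    proof -
      have "norm (\<Sum>m\<in>{-N..N}. multi_form k (g {m, m + 1}) W r R - multi_form k (g {m}) W r R)
          \<le> (\<Sum>m\<in>{-N..N}. 2 * (M\<^sup>2 * (e' * X) * U m))"
      proof (rule order_trans[OF norm_sum sum_mono])
        fix m
        show "norm (multi_form k (g {m, m + 1}) W r R - multi_form k (g {m}) W r R) \<le> 2 * (M\<^sup>2 * (e' * X) * U m)"
          using window[of "{m, m + 1}" m] window[of "{m}" m]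
            norm_triangle_ineq4[of "multi_form k (g {m, m + 1}) W r R" "multi_form k (g {m}) W r R"] by simp
      qed
      also have "\<dots> = 2 * M\<^sup>2 * (e' * X) * (\<Sum>m\<in>{-N..N}. U m)"
        by (simp add: sum_distrib_left mult.assoc)
      also have "\<dots> \<le> 2 * M\<^sup>2 * (e' * X) * (2 * (real k + 1))"
        using e' X by (intro mult_left_mono sumU) auto
      also have "\<dots> = e / 2 * X"
      proof -
        have "8 * (real k + 1) * M\<^sup>2 \<noteq> 0" using M by (simp add: add_nonneg_eq_0_iff)
        then have "e' * (8 * (real k + 1) * M\<^sup>2) = e" by (simp add: e'_def)
        moreover have "2 * M\<^sup>2 * (e' * X) * (2 * (real k + 1)) = (e' * (8 * (real k + 1) * M\<^sup>2)) / 2 * X" by simp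
        ultimately show ?thesis by simp
      qed
      finally show ?thesis .
    qed
    have T_le: "(\<Sum>x\<in>{-W..W}. norm (T x t)) \<le> (real k + 1)\<^sup>2 * M powr (- \<delta>)" for t
    proof -
      let ?a = "\<lambda>i j n. \<alpha> n + (if n = i then \<delta> else 0) - (if n = j then \<delta> else 0)"
      have a0: "?a i j n \<ge> 0" if "n \<le> k" for i j n using \<alpha>\<delta>[OF that] \<delta> by auto
      have a1: "(\<Sum>n\<le>k. ?a i j n) = 1" if "i \<le> k" "j \<le> k" for i j
        using \<alpha>(2) that by (simp add: sum.distrib sum_subtractf)
      let ?s = "\<lambda>i j x. M powr (- \<delta>) * (\<Sum>n\<le>k. ?a i j n * u n (x + int n * t))"
      have s0: "?s i j x \<ge> 0" for i j x using a0 u0 by (intro mult_nonneg_nonneg sum_nonneg) auto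
      have "norm (T x t) \<le> (\<Sum>i\<le>k. \<Sum>j\<le>k. ?s i j x)" for x
      proof (cases "T x t = 0")
        case True
        then show ?thesis using s0 by (simp add: sum_nonneg)
      next
        case False
        then obtain i j where ij: "i \<le> k" "j \<le> k" "l i (x + int i * t) > l j (x + int j * t) + 1"
          and nz: "(\<Prod>i\<le>k. f i (x + int i * t)) \<noteq> 0" and T: "T x t = (\<Prod>i\<le>k. f i (x + int i * t))"
          unfolding T_def by (auto simp: not_le split: if_splits)
        have "norm (T x t) \<le> ?s i j x"
          unfolding T prod_norm[symmetric] u_def
          using nz ij by (intro prod_norm_far_levels[where z = "\<lambda>n. f n (x + int n * t)"] \<alpha>\<delta> \<alpha>(2) \<delta> M) (auto simp: l_def)
        also have "\<dots> \<le> (\<Sum>j\<le>k. ?s i j x)"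
          using ij by (intro member_le_sum[of j] s0) auto
        also have "\<dots> \<le> (\<Sum>i\<le>k. \<Sum>j\<le>k. ?s i j x)"
          using ij by (intro member_le_sum[of i "{..k}" "\<lambda>i. \<Sum>j\<le>k. ?s i j x"] sum_nonneg s0) auto
        finally show ?thesis .
      qed
      then have "(\<Sum>x\<in>{-W..W}. norm (T x t)) \<le> (\<Sum>x\<in>{-W..W}. \<Sum>i\<le>k. \<Sum>j\<le>k. ?s i j x)"
        by (intro sum_mono)
      also have "\<dots> = (\<Sum>i\<le>k. \<Sum>j\<le>k. \<Sum>x\<in>{-W..W}. ?s i j x)"
        by (subst sum.swap, rule sum.cong[OF refl], rule sum.swap)
      also have "\<dots> \<le> (\<Sum>i\<le>k. \<Sum>j\<le>k. M powr (- \<delta>))"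
      proof (intro sum_mono)
        fix i j assume ij: "i \<in> {..k}" "j \<in> {..k}"
        have "(\<Sum>x\<in>{-W..W}. ?s i j x) = M powr (- \<delta>) * (\<Sum>n\<le>k. ?a i j n * (\<Sum>x\<in>{-W..W}. u n (x + int n * t)))"
          unfolding sum_distrib_left by (subst sum.swap) (simp add: mult_ac)
        also have "\<dots> \<le> M powr (- \<delta>) * (\<Sum>n\<le>k. ?a i j n * 1)"
          using a0 by (intro mult_left_mono sum_mono u_shift) auto
        also have "\<dots> = M powr (- \<delta>)" using a1[of i j] ij by simp
        finally show "(\<Sum>x\<in>{-W..W}. ?s i j x) \<le> M powr (- \<delta>)" .
      qed
      also have "\<dots> = (real k + 1)\<^sup>2 * M powr (- \<delta>)" by (simp add: power2_eq_square algebra_simps)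
      finally show ?thesis .
    qed
    have far: "norm (\<Sum>t\<in>annulus r R. (\<Sum>x\<in>{-W..W}. T x t) / of_int t) \<le> e / 2 * X"
    proof -
      have "norm (\<Sum>t\<in>annulus r R. (\<Sum>x\<in>{-W..W}. T x t) / of_int t)
          \<le> (\<Sum>t\<in>annulus r R. (real k + 1)\<^sup>2 * M powr (- \<delta>) * (1 / \<bar>real_of_int t\<bar>))"
      proof (rule order_trans[OF norm_sum sum_mono])
        fix t
        have "norm (\<Sum>x\<in>{-W..W}. T x t) \<le> (real k + 1)\<^sup>2 * M powr (- \<delta>)"
          by (rule order_trans[OF norm_sum T_le])
        then show "norm ((\<Sum>x\<in>{-W..W}. T x t) / of_int t) \<le> (real k + 1)\<^sup>2 * M powr (- \<delta>) * (1 / \<bar>real_of_int t\<bar>)"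
          by (simp add: norm_divide divide_right_mono)
      qed
      also have "\<dots> = (real k + 1)\<^sup>2 * M powr (- \<delta>) * (\<Sum>t\<in>annulus r R. 1 / \<bar>real_of_int t\<bar>)"
        by (simp only: sum_distrib_left)
      also have "\<dots> \<le> (real k + 1)\<^sup>2 * M powr (- \<delta>) * (4 * X)"
        using sum_reciprocal_annulus[OF r(1,2)] X by (intro mult_left_mono) (auto simp: X_def)
      also have "\<dots> = (4 * (real k + 1)\<^sup>2 * M powr (- \<delta>)) * X" by simp
      also have "\<dots> \<le> e / 2 * X" using X by (intro mult_right_mono Mb) auto
      finally show ?thesis .
    qed
    have "norm (multi_form k f W r R) \<le> e / 2 * X + e / 2 * X"
      unfolding multi_form_eq by (rule norm_triangle_mono[OF close far])
    then show ?thesis by (simp add: X_def)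
  qed
  have "max K0 (exp 1) > 1" using K0 by simp
  then show ?thesis by (intro exI[of _ "max K0 (exp 1)"] conjI allI impI main) auto
qed

section \<open>Duality\<close>

lemma in_lp_imp_sum_le:
  assumes "in_lp q f" "q > 0" "finite A"
  shows "(\<Sum>x\<in>A. norm (f x) powr q) \<le> lp_norm q f powr q"
proof -
  have "(\<Sum>x\<in>A. norm (f x) powr q) \<le> (\<Sum>\<^sub>\<infinity>x. norm (f x) powr q)"
    using assms by (intro finite_sum_le_infsum) (auto simp: in_lp_def)
  also have "\<dots> = lp_norm q f powr q"
    using assms(2) infsum_nonneg[of UNIV "\<lambda>x. norm (f x) powr q"] by (simp add: lp_norm_def powr_powr)
  finally show ?thesis .
qed

lemma lp_norm_eq_0D:
  assumes "in_lp q f" "q > 0" "lp_norm q f = 0"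
  shows "f x = 0"
  using in_lp_imp_sum_le[OF assms(1,2), of "{x}"] assms(3) by simp

text \<open>Every finite set lies in a symmetric window, so one family of finite bounds yields both
  summability and the norm estimate.\<close>

lemma in_lp_if_window_sums_bounded:
  assumes "q > 0" "c \<ge> 0" "\<And>Y. Y \<ge> 0 \<Longrightarrow> (\<Sum>x\<in>{-Y..Y}. norm (F x) powr q) \<le> c powr q"
  shows "in_lp q F \<and> lp_norm q F \<le> c"
proof
  have fin: "(\<Sum>x\<in>A. norm (F x) powr q) \<le> c powr q" if "finite A" for A
  proof -
    define Y where "Y = Max (insert 0 (abs ` A))"
    have "\<bar>x\<bar> \<le> Y" if "x \<in> A" for x using that \<open>finite A\<close> by (auto simp: Y_def)
    then have "A \<subseteq> {-Y..Y}" by (auto simp: abs_le_iff) (metis abs_le_iff minus_le_iff)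
    then have "(\<Sum>x\<in>A. norm (F x) powr q) \<le> (\<Sum>x\<in>{-Y..Y}. norm (F x) powr q)"
      by (intro sum_mono2) auto
    also have "\<dots> \<le> c powr q" using \<open>finite A\<close> by (intro assms(3)) (auto simp: Y_def)
    finally show ?thesis .
  qed
  show in_lp: "in_lp q F"
    unfolding in_lp_def
    by (rule nonneg_bdd_above_summable_on) (auto intro!: bdd_aboveI[of _ "c powr q"] fin)
  have "(\<Sum>\<^sub>\<infinity>x. norm (F x) powr q) \<le> c powr q"
    using in_lp fin unfolding in_lp_def by (intro infsum_le_finite_sums) auto
  then have "lp_norm q F \<le> (c powr q) powr (1 / q)"
    unfolding lp_norm_def using assms(1) by (intro powr_mono2) (auto intro: infsum_nonneg)
  then show "lp_norm q F \<le> c" using assms by (simp add: powr_powr)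
qed

definition trunc_hilbert :: "nat \<Rightarrow> (nat \<Rightarrow> int \<Rightarrow> complex) \<Rightarrow> real \<Rightarrow> real \<Rightarrow> int \<Rightarrow> complex" where
  "trunc_hilbert k f r R x = (\<Sum>t\<in>annulus r R. (\<Prod>i=1..k. f i (x + int i * t)) / of_int t)"

text \<open>For \<open>|x| <= Y\<close> and \<open>|t| <= R\<close> all arguments
  \<open>x + i * t\<close> stay within \<open>W\<close>, so cutting the functions off there does not
  change the pairing.\<close>

lemma multi_form_eq_pairing:
  assumes Y: "0 \<le> Y" and R: "1 \<le> r" "r \<le> R" and W: "W = Y + int k * \<lfloor>R\<rfloor>"
    and g0: "\<And>x. \<bar>x\<bar> > Y \<Longrightarrow> g 0 x = 0"
    and g: "\<And>i x. i \<in> {1..k} \<Longrightarrow> \<bar>x\<bar> \<le> W \<Longrightarrow> g i x = f i x / n i"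
  shows "multi_form k g W r R = (\<Sum>x\<in>{-Y..Y}. g 0 x * trunc_hilbert k f r R x) / (\<Prod>i=1..k. n i)"
proof -
  have YW: "Y \<le> W" using R W by simp
  have inner: "(\<Sum>x\<in>{-W..W}. \<Prod>i\<le>k. g i (x + int i * t))
      = (\<Sum>x\<in>{-Y..Y}. g 0 x * (\<Prod>i=1..k. f i (x + int i * t))) / (\<Prod>i=1..k. n i)" if t: "t \<in> annulus r R" for t
  proof -
    have tR: "\<bar>t\<bar> \<le> \<lfloor>R\<rfloor>" using t by (simp add: annulus_def le_floor_iff)
    have split: "(\<Prod>i\<le>k. g i (x + int i * t)) = g 0 x * (\<Prod>i=1..k. g i (x + int i * t))" for x
      by (simp add: atMost_atLeast0 prod.atLeast_Suc_atMost)
    have "(\<Sum>x\<in>{-W..W}. \<Prod>i\<le>k. g i (x + int i * t)) = (\<Sum>x\<in>{-Y..Y}. \<Prod>i\<le>k. g i (x + int i * t))"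
      unfolding split using YW by (intro sum.mono_neutral_right) (auto simp: g0)
    also have "\<dots> = (\<Sum>x\<in>{-Y..Y}. g 0 x * ((\<Prod>i=1..k. f i (x + int i * t)) / (\<Prod>i=1..k. n i)))"
    proof (rule sum.cong[OF refl])
      fix x assume x: "x \<in> {-Y..Y}"
      have "(\<Prod>i=1..k. g i (x + int i * t)) = (\<Prod>i=1..k. f i (x + int i * t) / n i)"
      proof (intro prod.cong refl g)
        fix i assume i: "i \<in> {1..k}"
        have "\<bar>int i * t\<bar> \<le> int k * \<lfloor>R\<rfloor>" unfolding abs_mult using i tR by (intro mult_mono) auto
        then show "\<bar>x + int i * t\<bar> \<le> W" using x W by auto
      qed
      then show "(\<Prod>i\<le>k. g i (x + int i * t)) = g 0 x * ((\<Prod>i=1..k. f i (x + int i * t)) / (\<Prod>i=1..k. n i))"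
        unfolding split by (simp add: prod_dividef)
    qed
    finally show ?thesis by (simp add: sum_divide_distrib)
  qed
  have "multi_form k g W r R = (\<Sum>t\<in>annulus r R. \<Sum>x\<in>{-Y..Y}. g 0 x * ((\<Prod>i=1..k. f i (x + int i * t)) / of_int t) / (\<Prod>i=1..k. n i))"
    unfolding multi_form_def by (intro sum.cong refl) (simp add: inner sum_divide_distrib mult.commute[of "prod n _"])
  also have "\<dots> = (\<Sum>x\<in>{-Y..Y}. g 0 x * trunc_hilbert k f r R x) / (\<Prod>i=1..k. n i)"
    unfolding trunc_hilbert_def sum_distrib_left sum_divide_distrib by (rule sum.swap)
  finally show ?thesis .
qed

theorem theorem2p1:
  fixes k :: nat and ps :: "nat \<Rightarrow> real" and p :: real
  assumes "k \<ge> 1"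
    and "\<And>i. i \<in> {1..k} \<Longrightarrow> 1 < ps i"
    and "1 < p"
    and "1 / p = (\<Sum>i=1..k. 1 / ps i)"
  shows "\<forall>\<epsilon>>0. \<exists>K. \<forall>R r. 1 \<le> r \<longrightarrow> r \<le> R \<longrightarrow> R / r \<ge> K \<longrightarrow>
           (\<forall>f :: nat \<Rightarrow> int \<Rightarrow> complex. (\<forall>i\<in>{1..k}. in_lp (ps i) (f i)) \<longrightarrow>
              (let F = (\<lambda>x::int. \<Sum>t\<in>{t::int. r \<le> \<bar>of_int t\<bar> \<and> \<bar>of_int t\<bar> \<le> R}.
                          (\<Prod>i=1..k. f i (x + int i * t)) / of_int t)
               in in_lp p F \<and>
                  lp_norm p F \<le> \<epsilon> * ln (R / r) * (\<Prod>i=1..k. lp_norm (ps i) (f i))))"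
proof (intro allI impI)
  fix \<epsilon> :: real assume \<epsilon>: "\<epsilon> > 0"
  \<comment> \<open>\<open>\<alpha> 0\<close> is the reciprocal of the exponent dual to
    \<open>p\<close>, which completes the sum of reciprocals to 1.\<close>
  define \<alpha> where "\<alpha> i = (if i = 0 then 1 - 1 / p else 1 / ps i)" for i
  have \<alpha>0: "\<alpha> i > 0" if "i \<le> k" for i
  proof (cases "i = 0")
    case False
    then have "1 < ps i" using that by (intro assms(2)) auto
    then show ?thesis using False by (simp add: \<alpha>_def)
  qed (use assms(3) in \<open>simp add: \<alpha>_def\<close>)
  have "(\<Sum>i\<le>k. \<alpha> i) = \<alpha> 0 + (\<Sum>i=1..k. \<alpha> i)"
    by (simp add: atMost_atLeast0 sum.atLeast_Suc_atMost)
  also have "(\<Sum>i=1..k. \<alpha> i) = (\<Sum>i=1..k. 1 / ps i)"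
    by (intro sum.cong) (auto simp: \<alpha>_def)
  finally have \<alpha>1: "(\<Sum>i\<le>k. \<alpha> i) = 1" using assms(4) by (simp add: \<alpha>_def)
  from multi_form_bound_normalised[of k \<alpha> \<epsilon>, OF \<alpha>0 \<alpha>1 \<epsilon>] obtain K where K: "K > 1"
    and bd: "\<And>r R f W. 1 \<le> r \<Longrightarrow> r \<le> R \<Longrightarrow> K \<le> R / r \<Longrightarrow>
      (\<forall>i\<le>k. \<forall>x. \<bar>x\<bar> > W \<longrightarrow> f i x = 0) \<Longrightarrow>
      (\<forall>i\<le>k. (\<Sum>x\<in>{-W..W}. norm (f i x) powr (1 / \<alpha> i)) \<le> 1) \<Longrightarrow>
      norm (multi_form k f W r R) \<le> \<epsilon> * ln (R / r)"
    by blast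
  have main: "in_lp p (trunc_hilbert k f r R) \<and>
      lp_norm p (trunc_hilbert k f r R) \<le> \<epsilon> * ln (R / r) * (\<Prod>i=1..k. lp_norm (ps i) (f i))"
    if r: "1 \<le> r" "r \<le> R" "K \<le> R / r" and f: "\<And>i. i \<in> {1..k} \<Longrightarrow> in_lp (ps i) (f i)" for r R f
  proof (rule in_lp_if_window_sums_bounded)
    define n where "n i = lp_norm (ps i) (f i)" for i
    have n0: "n i \<ge> 0" for i by (simp add: n_def lp_norm_def)
    define c where "c = \<epsilon> * ln (R / r) * (\<Prod>i=1..k. n i)"
    have c: "c \<ge> 0" unfolding c_def using \<epsilon> r n0 by (intro mult_nonneg_nonneg prod_nonneg) auto
    then show "\<epsilon> * ln (R / r) * (\<Prod>i=1..k. lp_norm (ps i) (f i)) \<ge> 0" by (simp add: c_def n_def)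
    show "p > 0" using assms(3) by simp
    let ?F = "trunc_hilbert k f r R"
    fix Y :: int assume Y: "Y \<ge> 0"
    define Q where "Q = (\<Sum>x\<in>{-Y..Y}. norm (?F x) powr p)"
    have Q0: "Q \<ge> 0" by (simp add: Q_def sum_nonneg)
    have "Q \<le> c powr p"
    \<comment> \<open>A function of norm zero cannot be normalised, but then the whole sum
      vanishes.\<close>
    proof (cases "\<exists>i\<in>{1..k}. n i = 0")
      case True
      then obtain i where i: "i \<in> {1..k}" "n i = 0" by blast
      have "f i x = 0" for x
        using assms(2)[OF i(1)] i(2) by (intro lp_norm_eq_0D[OF f[OF i(1)]]) (auto simp: n_def)
      then have "(\<Prod>i=1..k. f i (x + int i * t)) = 0" for x t using i(1) by (intro prod_zero bexI[of _ i]) auto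
      then have "?F x = 0" for x unfolding trunc_hilbert_def by (intro sum.neutral) simp
      then show ?thesis by (simp add: Q_def)
    next
      case False
      then have npos: "n i > 0" if "i \<in> {1..k}" for i using n0[of i] that by (metis less_eq_real_def)
      then have prodn: "(\<Prod>i=1..k. n i) > 0" by (intro prod_pos) auto
      show ?thesis
      proof (cases "Q = 0")
        case True
        then show ?thesis by simp
      next
        case False
        then have Q: "Q > 0" using Q0 by simp
        define N where "N = Q powr (1 / p)"
        have N: "N > 0" using Q by (simp add: N_def)
        have Np: "N powr p = Q" using Q assms(3) by (simp add: N_def powr_powr)
        define W where "W = Y + int k * \<lfloor>R\<rfloor>"
        have YW: "Y \<le> W" using r by (simp add: W_def)
        \<comment> \<open>\<open>g 0\<close> is the extremal function of Hoelder's inequality for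
          the truncated sum, normalised in the dual exponent: its pairing with \<open>?F\<close>
          over the window is exactly \<open>N\<close>.\<close>
        define g where "g i x = (if i = 0 then if \<bar>x\<bar> \<le> Y then cnj (?F x) * of_real (norm (?F x) powr (p - 2) / N powr (p - 1)) else 0
            else if \<bar>x\<bar> \<le> W then f i x / of_real (n i) else 0)" for i :: nat and x
        have "norm (multi_form k g W r R) \<le> \<epsilon> * ln (R / r)"
        proof (intro bd r allI impI)
          fix i assume i: "i \<le> k"
          show "g i x = 0" if "\<bar>x\<bar> > W" for x using that YW by (auto simp: g_def)
          show "(\<Sum>x\<in>{-W..W}. norm (g i x) powr (1 / \<alpha> i)) \<le> 1"
          proof (cases "i = 0")
            case True
            have p1: "1 / \<alpha> 0 = p / (p - 1)" using assms(3) by (simp add: \<alpha>_def field_simps)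
            have "norm (g 0 x) powr (1 / \<alpha> 0) = norm (?F x) powr p / Q" if "x \<in> {-Y..Y}" for x
            proof (cases "?F x = 0")
              case False
              have x: "\<bar>x\<bar> \<le> Y" using that by auto
              have "norm (?F x) * norm (?F x) powr (p - 2) = norm (?F x) powr (p - 1)"
                using False powr_add[of "norm (?F x)" 1 "p - 2"] by simp
              then have "norm (g 0 x) = (norm (?F x) / N) powr (p - 1)"
                using x N by (simp add: g_def norm_mult norm_divide powr_divide)
              then have "norm (g 0 x) powr (1 / \<alpha> 0) = (norm (?F x) / N) powr p"
                using assms(3) by (simp add: p1 powr_powr)
              then show ?thesis using N by (simp add: powr_divide Np)
            qed (simp add: g_def)
            moreover have "(\<Sum>x\<in>{-W..W}. norm (g 0 x) powr (1 / \<alpha> 0)) = (\<Sum>x\<in>{-Y..Y}. norm (g 0 x) powr (1 / \<alpha> 0))"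
              using YW by (intro sum.mono_neutral_right) (auto simp: g_def)
            ultimately have "(\<Sum>x\<in>{-W..W}. norm (g 0 x) powr (1 / \<alpha> 0)) = Q / Q"
              by (simp add: Q_def sum_divide_distrib[symmetric])
            then show ?thesis using True by simp
          next
            case False
            then have i1: "i \<in> {1..k}" using i by auto
            have ps: "ps i > 0" "1 / \<alpha> i = ps i" using assms(2)[OF i1] False by (auto simp: \<alpha>_def)
            have "(\<Sum>x\<in>{-W..W}. norm (g i x) powr (1 / \<alpha> i)) = (\<Sum>x\<in>{-W..W}. norm (f i x) powr ps i / n i powr ps i)"
              unfolding ps(2) using False npos[OF i1]
              by (intro sum.cong refl) (auto simp: g_def norm_divide powr_divide)
            also have "\<dots> = (\<Sum>x\<in>{-W..W}. norm (f i x) powr ps i) / n i powr ps i"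
              by (simp add: sum_divide_distrib)
            also have "\<dots> \<le> 1"
              using in_lp_imp_sum_le[OF f[OF i1] ps(1), of "{-W..W}"] npos[OF i1] by (simp add: n_def)
            finally show ?thesis .
          qed
        qed
        moreover have "multi_form k g W r R = of_real (N / (\<Prod>i=1..k. n i))"
        proof -
          have "multi_form k g W r R = (\<Sum>x\<in>{-Y..Y}. g 0 x * ?F x) / (\<Prod>i=1..k. of_real (n i))"
            by (rule multi_form_eq_pairing[OF Y r(1,2) W_def]) (auto simp: g_def)
          also have "(\<Sum>x\<in>{-Y..Y}. g 0 x * ?F x) = (\<Sum>x\<in>{-Y..Y}. of_real (norm (?F x) powr p / N powr (p - 1)))"
          proof (rule sum.cong[OF refl])
            fix x assume "x \<in> {-Y..Y}"
            then have x: "\<bar>x\<bar> \<le> Y" by auto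
            have sq: "cnj (?F x) * ?F x = of_real (norm (?F x) * norm (?F x))"
              by (metis complex_norm_square mult.commute power2_eq_square)
            have pw: "norm (?F x) * norm (?F x) * norm (?F x) powr (p - 2) = norm (?F x) powr p"
            proof (cases "?F x = 0")
              case False
              then show ?thesis using powr_add[of "norm (?F x)" 2 "p - 2"]
                by (simp add: powr_numeral power2_eq_square)
            qed simp
            have "g 0 x * ?F x = (cnj (?F x) * ?F x) * of_real (norm (?F x) powr (p - 2) / N powr (p - 1))"
              using x by (simp add: g_def mult_ac)
            also have "\<dots> = of_real (norm (?F x) * norm (?F x) * (norm (?F x) powr (p - 2) / N powr (p - 1)))"
              unfolding sq by (simp only: of_real_mult)
            also have "norm (?F x) * norm (?F x) * (norm (?F x) powr (p - 2) / N powr (p - 1)) = norm (?F x) powr p / N powr (p - 1)"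
              unfolding pw[symmetric] by simp
            finally show "g 0 x * ?F x = of_real (norm (?F x) powr p / N powr (p - 1))" .
          qed
          also have "\<dots> = of_real (Q / N powr (p - 1))"
            by (simp add: Q_def sum_divide_distrib)
          also have "Q / N powr (p - 1) = N"
            using N unfolding Np[symmetric] by (simp add: powr_diff)
          finally show ?thesis by simp
        qed
        ultimately have "N / (\<Prod>i=1..k. n i) \<le> \<epsilon> * ln (R / r)"
          using N prodn by (simp only: norm_of_real abs_of_pos divide_pos_pos)
        then have "N \<le> c" using prodn by (simp add: c_def pos_divide_le_eq)
        then have "N powr p \<le> c powr p" using N assms(3) by (intro powr_mono2) auto
        then show ?thesis by (simp add: Np)
      qed
    qed
    then show "(\<Sum>x\<in>{-Y..Y}. norm (?F x) powr p) \<le> (\<epsilon> * ln (R / r) * (\<Prod>i=1..k. lp_norm (ps i) (f i))) powr p"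
      by (simp add: Q_def c_def n_def)
  qed
  show "\<exists>K. \<forall>R r. 1 \<le> r \<longrightarrow> r \<le> R \<longrightarrow> R / r \<ge> K \<longrightarrow>
           (\<forall>f :: nat \<Rightarrow> int \<Rightarrow> complex. (\<forall>i\<in>{1..k}. in_lp (ps i) (f i)) \<longrightarrow>
              (let F = (\<lambda>x::int. \<Sum>t\<in>{t::int. r \<le> \<bar>of_int t\<bar> \<and> \<bar>of_int t\<bar> \<le> R}.
                          (\<Prod>i=1..k. f i (x + int i * t)) / of_int t)
               in in_lp p F \<and>
                  lp_norm p F \<le> \<epsilon> * ln (R / r) * (\<Prod>i=1..k. lp_norm (ps i) (f i))))"
    using main unfolding Let_def trunc_hilbert_def[abs_def] annulus_def
    by (intro exI[of _ K] allI impI) auto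
qed

end
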